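(* (i) Let $K$ be a positive kernel operator on $L^2(X,\mu)$, $\alpha\in[0,1]$, $\rho\in\{r,r_{ess}\}$, and let $\rho_n=\rho\big(S_\alpha(K^{2^n})\big)^{2^{-n}}$ for $n\in\mathbb N\cup\{0\}$. Then for each $n$ $$\rho(S_\alpha(K))=\rho_0\le\rho_1\le\cdots\le\rho_n\le\rho(K).$$ (ii) Let $K$ be a nonnegative matrix that defines an operator on $l^2(R)$ and let $\alpha,\beta$ be nonnegative numbers such that $\alpha+\beta\ge1$. For $\rho\in\{r,r_{ess}\}$ and $n\in\mathbb N\cup\{0\}$ let $r_n=\rho\big(S_{\alpha,\beta}(K^{2^n})\big)^{2^{-n}}$. Then for each $n$: if $\rho=r$, $$\rho(S_{\alpha,\beta}(K))=r_0\le r_1\le\cdots\le r_n\le\min\Big\{\rho(K)^{\alpha+\beta},\ \|K^{2^n}\|_\infty^{\frac{\alpha+\beta-1}{2^n}}\rho(K)\Big\};$$ if $\rho=r_{ess}$, $$\rho(S_{\alpha,\beta}(K))=r_0\le r_1\le\cdots\le r_n\le\|K^{2^n}\|_\infty^{\frac{\alpha+\beta-1}{2^n}}\rho(K);$$ and for $\rho\in\{r,r_{ess}\}$ $$r_n\le\|K^{2^n}\|_\infty^{\frac{\alpha+\beta-1}{2^n}}\rho\Big(S_{\frac{\alpha}{\alpha+\beta}}(K^{2^n})\Big)^{2^{-n}}\le\|K^{2^n}\|_\infty^{\frac{\alpha+\beta-1}{2^n}}\rho(K).$$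
   Context: $\mu$ is a $\sigma$-finite positive measure on a $\sigma$-algebra of subsets of a nonempty set $X$; $L^2(X,\mu)$ is the complex Hilbert space. A kernel operator $K$ on $L^2(X,\mu)$ is a linear operator $(Kf)(x)=\int_X k(x,y)f(y)\,d\mu(y)$ with $\mu\times\mu$-measurable kernel $k$ such that $\int_X|k(x,y)f(y)|\,d\mu(y)<\infty$ for all $f$ and almost all $x$. It is positive if it maps nonnegative functions to nonnegative functions (equivalently $k\ge0$ a.e.). $K^*$ has kernel $k(y,x)$ at $(x,y)$. The Hadamard product $K\circ H$ has kernel $k(x,y)h(x,y)$, and $K^{(t)}$, $t\ge0$, has kernel $k(x,y)^t$ (convention $0^0=1$). $S_\alpha(K)=K^{(\alpha)}\circ(K^* )^{(1-\alpha)}$ for $\alpha\in[0,1]$. $K^{2^n}$ is the ordinary power (composition). $r$ is the spectral radius; $\gamma(K)$ is the Hausdorff measure of noncompactness, i.e. the infimum of all $\delta>0$ such that $K(D)\subset M+\delta D$ for some finite set $M$, where $D$ is the closed unit ball; $r_{ess}(K)=\lim_{j\to\infty}\gamma(K^j)^{1/j}$ is the essential spectral radius (the spectral radius of the image of $K$ in the Calkin algebra). $R$ is $\{1,\ldots,N\}$ for some $N\in\mathbb N$ or $R=\mathbb N$; a nonnegative matrix $K=[k(i,j)]_{i,j\in R}$ defines an operator on $l^2(R)$ if $Kx\in l^2(R)$ for all $x\in l^2(R)$, where $(Kx)_i=\sum_jk(i,j)x_j$. Matrices are kernel operators for the counting measure. $\|K\|_\infty=\sup_{i,j\in R}k(i,j)\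 (\le\|K\|<\infty)$. $S_{\alpha,\beta}(K)=K^{(\alpha)}\circ(K^* )^{(\beta)}$ is the matrix with entries $k(i,j)^\alpha k(j,i)^\beta$ (it defines an operator on $l^2(R)$ when $\alpha+\beta\ge1$). *)

theory Defs
  imports "HOL-Analysis.Analysis"
begin

text \<open>The elements of \<open>L\<^sup>2(X,\<mu>)\<close> are represented by square integrable functions; all
  identities between them are identities almost everywhere.\<close>

definition L2 :: "'a measure \<Rightarrow> ('a \<Rightarrow> complex) set" where
  "L2 M = {f. f \<in> borel_measurable M \<and> integrable M (\<lambda>x. (norm (f x))\<^sup>2)}"

definition L2_norm :: "'a measure \<Rightarrow> ('a \<Rightarrow> complex) \<Rightarrow> real" where
  "L2_norm M f = sqrt (LINT x|M. (norm (f x))\<^sup>2)"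

type_synonym 'a operator = "('a \<Rightarrow> complex) \<Rightarrow> ('a \<Rightarrow> complex)"

text \<open>Linearity and boundedness force such a map to respect equality almost everywhere.\<close>

definition bounded_operator :: "'a measure \<Rightarrow> 'a operator \<Rightarrow> bool" where
  "bounded_operator M T \<longleftrightarrow>
     (\<forall>f\<in>L2 M. T f \<in> L2 M) \<and>
     (\<forall>f\<in>L2 M. \<forall>g\<in>L2 M. \<forall>a. AE x in M. T (\<lambda>y. a * f y + g y) x = a * T f x + T g x) \<and>
     (\<exists>C. \<forall>f\<in>L2 M. L2_norm M (T f) \<le> C * L2_norm M f)"

definition positive_operator :: "'a measure \<Rightarrow> 'a operator \<Rightarrow> bool" where
  "positive_operator M T \<longleftrightarrow>
     (\<forall>f\<in>L2 M. (AE x in M. f x \<in> \<real>\<^sub>\<ge>\<^sub>0) \<longrightarrow> (AE x in M. T f x \<in> \<real>\<^sub>\<ge>\<^sub>0))"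

definition spectrum :: "'a measure \<Rightarrow> 'a operator \<Rightarrow> complex set" where
  "spectrum M T = {z. \<not> (\<exists>S. bounded_operator M S \<and>
     (\<forall>f\<in>L2 M. (AE x in M. S (\<lambda>y. z * f y - T f y) x = f x) \<and>
                (AE x in M. z * S f x - T (S f) x = f x)))}"

text \<open>The spectrum is empty only if \<open>\<mu> = 0\<close>, i.e. if \<open>L\<^sup>2\<close> is the zero space; inserting \<open>0\<close>
  makes the spectral radius \<open>0\<close> there and has no effect otherwise.\<close>

definition spectral_radius :: "'a measure \<Rightarrow> 'a operator \<Rightarrow> real" where
  "spectral_radius M T = Sup (insert 0 (norm ` spectrum M T))"

definition noncompactness :: "'a measure \<Rightarrow> 'a operator \<Rightarrow> real" where
  "noncompactness M T = Inf {\<delta>. \<delta> > 0 \<and> (\<exists>F. finite F \<and> F \<subseteq> L2 M \<and>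
     (\<forall>f\<in>L2 M. L2_norm M f \<le> 1 \<longrightarrow> (\<exists>g\<in>F. L2_norm M (\<lambda>x. T f x - g x) \<le> \<delta>)))}"

definition ess_spectral_radius :: "'a measure \<Rightarrow> 'a operator \<Rightarrow> real" where
  "ess_spectral_radius M T = lim (\<lambda>j. root j (noncompactness M (T ^^ j)))"


text \<open>Kernels are real valued: only positive operators matter below, and their kernels are
  nonnegative almost everywhere.\<close>

type_synonym 'a kernel = "'a \<Rightarrow> 'a \<Rightarrow> real"

definition kernel_op :: "'a measure \<Rightarrow> 'a kernel \<Rightarrow> 'a operator" where
  "kernel_op M k f x = (LINT y|M. complex_of_real (k x y) * f y)"

definition kernel_operator :: "'a measure \<Rightarrow> 'a kernel \<Rightarrow> bool" where
  "kernel_operator M k \<longleftrightarrow>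
     (\<lambda>(x, y). k x y) \<in> borel_measurable (M \<Otimes>\<^sub>M M) \<and>
     (\<forall>f\<in>L2 M. (AE x in M. integrable M (\<lambda>y. complex_of_real (k x y) * f y)) \<and>
                kernel_op M k f \<in> L2 M)"

definition kernel_comp :: "'a measure \<Rightarrow> 'a kernel \<Rightarrow> 'a kernel \<Rightarrow> 'a kernel" where
  "kernel_comp M k h x y = (LINT z|M. k x z * h z y)"

text \<open>The kernel of the operator power \<open>K\<^sup>m\<close>, for \<open>m \<ge> 1\<close> (the identity \<open>K\<^sup>0\<close> need not have a
  kernel).\<close>

definition kernel_power :: "'a measure \<Rightarrow> 'a kernel \<Rightarrow> nat \<Rightarrow> 'a kernel" where
  "kernel_power M k m = (kernel_comp M k ^^ (m - 1)) k"

definition kernel_adjoint :: "'a kernel \<Rightarrow> 'a kernel" where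
  "kernel_adjoint k x y = k y x"

text \<open>Real powers with \<open>0\<^sup>0 = 1\<close>; note that \<open>0 powr 0 = 0\<close>.\<close>

definition rpow :: "real \<Rightarrow> real \<Rightarrow> real" where
  "rpow x t = (if t = 0 then 1 else x powr t)"

definition hadamard_prod :: "'a kernel \<Rightarrow> 'a kernel \<Rightarrow> 'a kernel" where
  "hadamard_prod k h x y = k x y * h x y"

definition hadamard_power :: "'a kernel \<Rightarrow> real \<Rightarrow> 'a kernel" where
  "hadamard_power k t x y = rpow (k x y) t"

definition S2 :: "real \<Rightarrow> real \<Rightarrow> 'a kernel \<Rightarrow> 'a kernel" where
  "S2 \<alpha> \<beta> k = hadamard_prod (hadamard_power k \<alpha>) (hadamard_power (kernel_adjoint k) \<beta>)"

definition S1 :: "real \<Rightarrow> 'a kernel \<Rightarrow> 'a kernel" where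
  "S1 \<alpha> k = S2 \<alpha> (1 - \<alpha>) k"


text \<open>A matrix indexed by \<open>R\<close> is a kernel for the counting measure on \<open>R\<close>.\<close>

definition index_set :: "nat set \<Rightarrow> bool" where
  "index_set R \<longleftrightarrow> (\<exists>N\<ge>1. R = {1..N}) \<or> R = {1..}"

definition max_norm :: "nat set \<Rightarrow> nat kernel \<Rightarrow> real" where
  "max_norm R k = (SUP (i, j)\<in>R \<times> R. k i j)"

end

theory Submission
  imports Defs
begin

text \<open>The theorem compares two radii of an operator with a nonnegative kernel, and both are treated by
  one device.  For nonnegative \<open>f\<close> and \<open>g\<close> let \<open>form M k f g\<close> be the double integral of
  \<open>k x y * f y * g x\<close>.  Given a cone \<open>U\<close> of nonnegative functions, the number \<open>kernel_size M U k\<close> is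
  the infimum of all \<open>\<delta>\<close> such that, for some \<open>u\<close> and \<open>v\<close> in \<open>U\<close>,
  \<open>form M k f g \<le> \<delta> + \<integral> f v + \<integral> g u\<close> holds on the positive part of the unit ball.  If \<open>U\<close>
  consists of \<open>0\<close> alone, this is the operator norm; if \<open>U\<close> is the positive cone of \<open>L\<^sup>2\<close>, it is the
  Hausdorff measure of noncompactness (\<open>noncompactness_eq_kernel_size\<close>).

  The definition makes it plain that this size is monotone and sublinear in the kernel and does not
  change under transposition.  By the inequality between weighted means,
  \<open>k(x,y)\<^sup>\<alpha> k(y,x)\<^sup>1\<^sup>-\<^sup>\<alpha> \<le> \<alpha> k(x,y) + (1 - \<alpha>) k(y,x)\<close>, so symmetrisation does not increase the
  size (\<open>kernel_size_S2_le\<close>).  Hoelder's inequality inside the composition integral shows that the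
  powers of a symmetrised kernel are dominated by the symmetrisations of the powers
  (\<open>S2_square_le\<close>, \<open>S2_power_le\<close>).  Once a radius \<open>\<rho>\<close> is known to be the limit of the \<open>j\<close>-th roots
  of the sizes of the \<open>j\<close>-th powers, everything follows, with \<open>S\<close> for the symmetrisation:
  \<open>\<rho>(S(K))\<^sup>2 = \<rho>(S(K)\<^sup>2) \<le> \<rho>(S(K\<^sup>2))\<close> is one link of the chain, and comparing the sizes of
  \<open>S(K)\<^sup>j\<close>, \<open>S(K\<^sup>j)\<close> and \<open>K\<^sup>j\<close> bounds the chain by \<open>\<rho>(K)\<close>.  This part of the argument is the locale
  \<open>kernel_radius\<close>.  For a matrix and exponents with sum \<open>s = \<alpha> + \<beta> > 1\<close>, Hoelder's inequality persists
  because a sum dominates each of its terms, and the kernel \<open>S2 \<alpha> \<beta> k\<close> is at most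
  \<open>m\<^sup>s\<^sup>-\<^sup>1\<close> times \<open>S1 (\<alpha> / s) k\<close> if \<open>m\<close> bounds the entries.

  There remain the two limit formulas.  For the essential spectral radius, the point is the equality
  of \<open>kernel_size\<close> with the measure of noncompactness: the part of a function that lies below a suitable
  multiple of a fixed \<open>L\<^sup>2\<close> function is mapped into a compact set (\<open>interval_compact_nonneg\<close>), and on the
  remaining part the functions \<open>u\<close> and \<open>v\<close> contribute little (\<open>covered_of_dominated\<close>).  For
  the spectral radius, let \<open>R\<close> be the limit of the roots of the norms.  Outside the disc of radius \<open>R\<close>
  the Neumann series converges.  The point \<open>R\<close> itself belongs to the spectrum, by positivity:
  otherwise the resolvents \<open>P\<close> at \<open>\<lambda> > R\<close> would stay bounded as \<open>\<lambda>\<close> tends to \<open>R\<close>, but \<open>P\<^sup>2\<close> dominates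
  \<open>(m + 1) T\<^sup>m / \<lambda>\<^sup>m\<^sup>+\<^sup>2\<close>, so that the norm of \<open>T\<^sup>m\<close> would be at most a multiple of \<open>R\<^sup>m / (m + 1)\<close>, while it is at
  least \<open>R\<^sup>m\<close> (\<open>spectral_radius_limit\<close>).

  Finally, a kernel operator that is positive has an almost everywhere nonnegative kernel
  (\<open>positive_operator_kernel_nonneg\<close>) and is automatically bounded (\<open>kernel_operator_bounded\<close>), so the
  kernel can be replaced by its positive part.\<close>

section \<open>Square integrable nonnegative functions\<close>

definition nn_ball :: "'a measure \<Rightarrow> ('a \<Rightarrow> ennreal) set" where
  "nn_ball M = {f \<in> borel_measurable M. (\<integral>\<^sup>+x. (f x)\<^sup>2 \<partial>M) \<le> 1}"

lemma ennreal_power2_le_iff: "(x::ennreal)\<^sup>2 \<le> y\<^sup>2 \<longleftrightarrow> x \<le> y"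
proof
  assume "x\<^sup>2 \<le> y\<^sup>2"
  show "x \<le> y"
  proof (rule ccontr)
    assume "\<not> x \<le> y"
    then have "y < x" by simp
    then show False
    proof (cases x)
      case (real a)
      with \<open>y < x\<close> obtain b where b: "y = ennreal b" "0 \<le> b" by (cases y) auto
      with real \<open>y < x\<close> have "b < a" using ennreal_less_iff by blast
      then show ?thesis using \<open>x\<^sup>2 \<le> y\<^sup>2\<close> real b by (simp add: ennreal_power)
    next
      case top
      with \<open>y < x\<close> obtain b where b: "y = ennreal b" "0 \<le> b" by (cases y) auto
      then show ?thesis using \<open>x\<^sup>2 \<le> y\<^sup>2\<close> top
        by (simp add: power2_eq_square ennreal_mult_eq_top_iff top_unique)
    qed
  qed
qed (simp add: power_mono)

lemma nn_cauchy_schwarz: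
  assumes [measurable]: "f \<in> borel_measurable M" "g \<in> borel_measurable M"
    and f: "(\<integral>\<^sup>+x. (f x)\<^sup>2 \<partial>M) \<le> ennreal (a\<^sup>2)" and g: "(\<integral>\<^sup>+x. (g x)\<^sup>2 \<partial>M) \<le> ennreal (b\<^sup>2)"
    and ab: "0 \<le> a" "0 \<le> b"
  shows "(\<integral>\<^sup>+x. f x * g x \<partial>M) \<le> ennreal (a * b)"
proof -
  have "(\<integral>\<^sup>+x. f x * g x \<partial>M)\<^sup>2 \<le> (\<integral>\<^sup>+x. (f x)\<^sup>2 \<partial>M) * (\<integral>\<^sup>+x. (g x)\<^sup>2 \<partial>M)"
    by (rule Cauchy_Schwarz_nn_integral) auto
  also have "\<dots> \<le> ennreal (a\<^sup>2) * ennreal (b\<^sup>2)" by (intro mult_mono f g) auto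
  also have "\<dots> = (ennreal (a * b))\<^sup>2"
    using ab by (simp add: ennreal_power ennreal_mult' power_mult_distrib)
  finally show ?thesis by (simp only: ennreal_power2_le_iff)
qed

lemma nn_minkowski:
  assumes [measurable]: "f \<in> borel_measurable M" "g \<in> borel_measurable M"
    and f: "(\<integral>\<^sup>+x. (f x)\<^sup>2 \<partial>M) \<le> ennreal (a\<^sup>2)" and g: "(\<integral>\<^sup>+x. (g x)\<^sup>2 \<partial>M) \<le> ennreal (b\<^sup>2)"
    and ab: "0 \<le> a" "0 \<le> b"
  shows "(\<integral>\<^sup>+x. (f x + g x)\<^sup>2 \<partial>M) \<le> ennreal ((a + b)\<^sup>2)"
proof -
  have "(\<integral>\<^sup>+x. (f x + g x)\<^sup>2 \<partial>M) = (\<integral>\<^sup>+x. (f x)\<^sup>2 + 2 * (f x * g x) + (g x)\<^sup>2 \<partial>M)"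
    by (intro nn_integral_cong) (simp add: power2_sum algebra_simps)
  also have "\<dots> = (\<integral>\<^sup>+x. (f x)\<^sup>2 \<partial>M) + 2 * (\<integral>\<^sup>+x. f x * g x \<partial>M) + (\<integral>\<^sup>+x. (g x)\<^sup>2 \<partial>M)"
    by (simp add: nn_integral_add nn_integral_cmult)
  also have "\<dots> \<le> ennreal (a\<^sup>2) + 2 * ennreal (a * b) + ennreal (b\<^sup>2)"
    by (intro add_mono mult_left_mono f g nn_cauchy_schwarz ab) auto
  also have "\<dots> = ennreal (a\<^sup>2 + 2 * (a * b) + b\<^sup>2)"
    using ab by (simp add: ennreal_mult')
  also have "a\<^sup>2 + 2 * (a * b) + b\<^sup>2 = (a + b)\<^sup>2" by (simp add: power2_sum)
  finally show ?thesis .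
qed

lemma nn_scale:
  assumes [measurable]: "f \<in> borel_measurable M"
    and "(\<integral>\<^sup>+x. (f x)\<^sup>2 \<partial>M) \<le> ennreal (a\<^sup>2)" "0 \<le> c" "0 \<le> a"
  shows "(\<integral>\<^sup>+x. (ennreal c * f x)\<^sup>2 \<partial>M) \<le> ennreal ((c * a)\<^sup>2)"
proof -
  have "(\<integral>\<^sup>+x. (ennreal c * f x)\<^sup>2 \<partial>M) = ennreal (c\<^sup>2) * (\<integral>\<^sup>+x. (f x)\<^sup>2 \<partial>M)"
    using assms by (simp add: power_mult_distrib nn_integral_cmult ennreal_power)
  also have "\<dots> \<le> ennreal (c\<^sup>2) * ennreal (a\<^sup>2)" by (intro mult_left_mono assms) auto
  also have "\<dots> = ennreal ((c * a)\<^sup>2)" by (simp add: power_mult_distrib ennreal_mult')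
  finally show ?thesis .
qed

lemma nn_ball_scale:
  assumes [measurable]: "f \<in> borel_measurable M"
    and "(\<integral>\<^sup>+x. (f x)\<^sup>2 \<partial>M) \<le> ennreal (a\<^sup>2)" "0 < a"
  shows "(\<lambda>x. ennreal (1 / a) * f x) \<in> nn_ball M"
  using nn_scale[OF assms(1,2), of "1 / a"] assms(3) by (auto simp: nn_ball_def)

lemma nn_zero_norm:
  assumes [measurable]: "f \<in> borel_measurable M"
    and "(\<integral>\<^sup>+x. (f x)\<^sup>2 \<partial>M) \<le> ennreal (0\<^sup>2)"
  shows "AE x in M. f x = 0"
proof -
  have "(\<integral>\<^sup>+x. (f x)\<^sup>2 \<partial>M) = 0" using assms by simp
  then show ?thesis by (subst (asm) nn_integral_0_iff_AE) auto
qed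

lemma L2_finite_AE:
  assumes [measurable]: "f \<in> borel_measurable M"
    and "(\<integral>\<^sup>+x. (f x)\<^sup>2 \<partial>M) < \<infinity>"
  shows "AE x in M. f x < \<infinity>"
proof -
  have "AE x in M. (f x)\<^sup>2 \<noteq> \<infinity>"
    by (rule nn_integral_PInf_AE) (use assms in auto)
  then show ?thesis
    by eventually_elim (auto simp: less_top power_eq_top_ennreal)
qed

context sigma_finite_measure
begin

text \<open>Testing against the truncations of \<open>h\<close>, which are normalised and increase to \<open>h\<close>,
  shows the following converse of the Cauchy-Schwarz inequality.\<close>

lemma nn_duality:
  assumes [measurable]: "h \<in> borel_measurable M"
    and h: "\<And>g. g \<in> nn_ball M \<Longrightarrow> (\<integral>\<^sup>+x. h x * g x \<partial>M) \<le> ennreal c" and c: "0 \<le> c"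
  shows "(\<integral>\<^sup>+x. (h x)\<^sup>2 \<partial>M) \<le> ennreal (c\<^sup>2)"
proof -
  obtain A :: "nat \<Rightarrow> 'a set" where A: "range A \<subseteq> sets M" "(\<Union>i. A i) = space M"
    "\<And>i. emeasure M (A i) \<noteq> \<infinity>" "incseq A"
    using sigma_finite_incseq by metis
  then have [measurable]: "A i \<in> sets M" for i by auto
  define H where "H n x = min (h x) (of_nat n) * indicator (A n) x" for n x
  have [measurable]: "H n \<in> borel_measurable M" for n unfolding H_def by measurable
  have bound: "(\<integral>\<^sup>+x. (H n x)\<^sup>2 \<partial>M) \<le> ennreal (c\<^sup>2)" for n
  proof -
    have "(\<integral>\<^sup>+x. (H n x)\<^sup>2 \<partial>M) \<le> (\<integral>\<^sup>+x. (of_nat n)\<^sup>2 * indicator (A n) x \<partial>M)"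
      by (intro nn_integral_mono) (auto simp: H_def indicator_def intro!: power_mono)
    also have "\<dots> = (of_nat n)\<^sup>2 * emeasure M (A n)" by (simp add: nn_integral_cmult_indicator)
    also have "\<dots> < \<infinity>" using A(3)[of n]
      by (simp add: ennreal_mult_less_top less_top of_nat_less_top power_less_top_ennreal)
    finally obtain t where t: "(\<integral>\<^sup>+x. (H n x)\<^sup>2 \<partial>M) = ennreal t" "0 \<le> t"
      by (cases "\<integral>\<^sup>+x. (H n x)\<^sup>2 \<partial>M") auto
    define s where "s = sqrt t"
    have s: "(\<integral>\<^sup>+x. (H n x)\<^sup>2 \<partial>M) = ennreal (s\<^sup>2)" "0 \<le> s" using t by (auto simp: s_def)
    show ?thesis
    proof (cases "s = 0")
      case True then show ?thesis using s by simp
    next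
      case False
      then have "0 < s" using s by simp
      have "ennreal s = ennreal (1 / s) * ennreal (s\<^sup>2)"
        using \<open>0 < s\<close> by (simp flip: ennreal_mult'' add: power2_eq_square)
      also have "\<dots> = (\<integral>\<^sup>+x. ennreal (1 / s) * (H n x)\<^sup>2 \<partial>M)"
        by (simp add: nn_integral_cmult s)
      also have "\<dots> \<le> (\<integral>\<^sup>+x. h x * (ennreal (1 / s) * H n x) \<partial>M)"
      proof (intro nn_integral_mono)
        fix x
        have "(H n x)\<^sup>2 \<le> h x * H n x"
          by (auto simp: H_def power2_eq_square indicator_def intro!: mult_right_mono)
        then have "ennreal (1 / s) * (H n x)\<^sup>2 \<le> ennreal (1 / s) * (h x * H n x)"
          by (intro mult_left_mono) auto
        then show "ennreal (1 / s) * (H n x)\<^sup>2 \<le> h x * (ennreal (1 / s) * H n x)"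
          by (simp add: ac_simps)
      qed
      also have "\<dots> \<le> ennreal c"
        by (rule h, rule nn_ball_scale) (use s \<open>0 < s\<close> in auto)
      finally have "s \<le> c" using c by simp
      then show ?thesis unfolding s by (intro ennreal_leI power_mono s)
    qed
  qed
  have inc: "incseq (\<lambda>n x. (H n x)\<^sup>2)"
  proof (intro incseq_SucI le_funI power_mono)
    fix n x
    have "min (h x) (of_nat n) \<le> min (h x) (of_nat (Suc n))"
      by (intro min.mono of_nat_mono) auto
    then show "H n x \<le> H (Suc n) x"
      using A(4) incseq_SucD[of A n] by (auto simp: H_def indicator_def simp del: of_nat_Suc)
  qed simp
  have "(\<integral>\<^sup>+x. (h x)\<^sup>2 \<partial>M) \<le> (\<integral>\<^sup>+x. (SUP n. (H n x)\<^sup>2) \<partial>M)"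
  proof (intro nn_integral_mono)
    fix x assume "x \<in> space M"
    then obtain m where m: "x \<in> A m" using A(2) by blast
    show "(h x)\<^sup>2 \<le> (SUP n. (H n x)\<^sup>2)"
    proof (cases "h x")
      case (real r)
      obtain l where l: "r \<le> of_nat l" using real_arch_simple by blast
      have "x \<in> A (max m l)" using m A(4) by (metis incseqD max.cobounded1 subsetD)
      moreover have "h x \<le> of_nat (max m l)"
        using real l by (simp add: ennreal_of_nat_eq_real_of_nat)
      ultimately have "H (max m l) x = h x" by (simp add: H_def min_def)
      then show ?thesis by (metis SUP_upper UNIV_I)
    next
      case top
      have "of_nat n \<le> (SUP n. (H n x)\<^sup>2)" for n
      proof -
        have "x \<in> A (max m n)" using m A(4) by (metis incseqD max.cobounded1 subsetD)
        then have H: "H (max m n) x = of_nat (max m n)" using top by (simp add: H_def)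
        have "n \<le> (max m n)\<^sup>2" by (metis le_trans max.cobounded2 power2_nat_le_imp_le le_refl power2_nat_le_eq_le self_le_power zero_less_numeral neq0_conv le0 le_eq_less_or_eq power2_eq_square mult_le_mono le_square)
        then have "(of_nat n :: ennreal) \<le> (of_nat (max m n))\<^sup>2"
          by (metis of_nat_le_iff of_nat_power of_nat_mono)
        then show ?thesis unfolding H[symmetric] by (meson SUP_upper UNIV_I order_trans)
      qed
      then have "(SUP n. of_nat n) \<le> (SUP n. (H n x)\<^sup>2)" by (intro SUP_least) auto
      then have "(SUP n. (H n x)\<^sup>2) = top"
        unfolding ennreal_SUP_of_nat_eq_top by (rule top_unique[THEN iffD1])
      then show ?thesis by (simp only: top_greatest)
    qed
  qed
  also have "\<dots> = (SUP n. \<integral>\<^sup>+x. (H n x)\<^sup>2 \<partial>M)"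
    by (intro nn_integral_monotone_convergence_SUP inc) auto
  also have "\<dots> \<le> ennreal (c\<^sup>2)" by (intro SUP_least bound)
  finally show ?thesis .
qed

end

section \<open>Positive kernels and their bilinear forms\<close>

abbreviation measurable_kernel :: "'a measure \<Rightarrow> 'a kernel \<Rightarrow> bool" where
  "measurable_kernel M k \<equiv> (\<lambda>(x, y). k x y) \<in> borel_measurable (M \<Otimes>\<^sub>M M)"

definition act :: "'a measure \<Rightarrow> 'a kernel \<Rightarrow> ('a \<Rightarrow> ennreal) \<Rightarrow> 'a \<Rightarrow> ennreal" where
  "act M k f x = (\<integral>\<^sup>+y. ennreal (k x y) * f y \<partial>M)"

definition form :: "'a measure \<Rightarrow> 'a kernel \<Rightarrow> ('a \<Rightarrow> ennreal) \<Rightarrow> ('a \<Rightarrow> ennreal) \<Rightarrow> ennreal" where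
  "form M k f g = (\<integral>\<^sup>+x. act M k f x * g x \<partial>M)"

text \<open>Boundedness of the form is boundedness of the operator.  Nonnegativity is demanded at every
  point, not almost everywhere, so that compositions and symmetrisations of such kernels
  are nonnegative at every point as well.\<close>

definition pos_kernel :: "'a measure \<Rightarrow> 'a kernel \<Rightarrow> bool" where
  "pos_kernel M k \<longleftrightarrow> measurable_kernel M k \<and> (\<forall>x y. 0 \<le> k x y) \<and>
     (\<exists>C\<ge>0. \<forall>f\<in>nn_ball M. \<forall>g\<in>nn_ball M. form M k f g \<le> ennreal C)"

text \<open>The order is stated with iterated null sets because the composition of kernels integrates over
  sections.\<close>

definition ae_le :: "'a measure \<Rightarrow> 'a kernel \<Rightarrow> 'a kernel \<Rightarrow> bool" where
  "ae_le M k h \<longleftrightarrow> (AE x in M. AE y in M. k x y \<le> h x y)"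

lemma pos_kernelD:
  assumes "pos_kernel M k"
  shows "measurable_kernel M k" "0 \<le> k x y"
  using assms by (auto simp: pos_kernel_def)

context sigma_finite_measure
begin

interpretation P: pair_sigma_finite M M ..

lemma measurable_act [measurable (raw)]:
  assumes [measurable]: "measurable_kernel M k"
    "f \<in> borel_measurable M" "X \<in> N \<rightarrow>\<^sub>M M"
  shows "(\<lambda>w. act M k f (X w)) \<in> borel_measurable N"
  unfolding act_def by measurable

lemma act_scale:
  assumes [measurable]: "measurable_kernel M k"
    "f \<in> borel_measurable M" and "x \<in> space M"
  shows "act M k (\<lambda>y. c * f y) x = c * act M k f x"
  using assms(3) unfolding act_def by (simp add: mult.left_commute[of _ c] nn_integral_cmult)

lemma act_cong_AE: "AE y in M. f y = g y \<Longrightarrow> act M k f x = act M k g x"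
  unfolding act_def by (intro nn_integral_cong_AE) auto

lemma form_swap:
  assumes [measurable]: "measurable_kernel M k"
    "f \<in> borel_measurable M" "g \<in> borel_measurable M"
  shows "form M (kernel_adjoint k) f g = form M k g f"
proof -
  have "form M (kernel_adjoint k) f g = (\<integral>\<^sup>+x. \<integral>\<^sup>+y. ennreal (k y x) * f y * g x \<partial>M \<partial>M)"
    unfolding form_def act_def kernel_adjoint_def
    by (intro nn_integral_cong) (simp flip: nn_integral_multc)
  also have "\<dots> = (\<integral>\<^sup>+y. \<integral>\<^sup>+x. ennreal (k y x) * f y * g x \<partial>M \<partial>M)"
    by (rule P.Fubini') measurable
  also have "\<dots> = form M k g f"
    unfolding form_def act_def
    by (intro nn_integral_cong, subst nn_integral_multc[symmetric]) (simp_all add: ac_simps)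
  finally show ?thesis .
qed

lemma form_mono:
  assumes "ae_le M k h"
  shows "form M k f g \<le> form M h f g"
  unfolding form_def act_def
proof (rule nn_integral_mono_AE)
  show "AE x in M. (\<integral>\<^sup>+y. ennreal (k x y) * f y \<partial>M) * g x \<le> (\<integral>\<^sup>+y. ennreal (h x y) * f y \<partial>M) * g x"
    using assms unfolding ae_le_def
    by eventually_elim (auto intro!: mult_right_mono nn_integral_mono_AE ennreal_leI elim!: eventually_mono)
qed

text \<open>The bound on the unit ball extends by homogeneity; functions of norm \<open>0\<close> cannot be normalised,
  but they vanish almost everywhere.\<close>

lemma form_scale:
  assumes k[measurable]: "measurable_kernel M k"
    and C: "\<And>f g. f \<in> nn_ball M \<Longrightarrow> g \<in> nn_ball M \<Longrightarrow> form M k f g \<le> ennreal C" "0 \<le> C"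
    and f[measurable]: "f \<in> borel_measurable M" "(\<integral>\<^sup>+x. (f x)\<^sup>2 \<partial>M) \<le> ennreal (a\<^sup>2)" "0 \<le> a"
    and g[measurable]: "g \<in> borel_measurable M" "(\<integral>\<^sup>+x. (g x)\<^sup>2 \<partial>M) \<le> ennreal (b\<^sup>2)" "0 \<le> b"
  shows "form M k f g \<le> ennreal (C * a * b)"
proof -
  consider "a = 0" | "b = 0" | "0 < a" "0 < b" using f g by linarith
  then show ?thesis
  proof cases
    case 1
    then have "AE y in M. f y = 0" using f by (intro nn_zero_norm) auto
    then have "act M k f x = 0" for x
      using act_cong_AE[of f "\<lambda>_. 0" k x] by (simp add: act_def)
    then show ?thesis by (simp add: form_def)
  next
    case 2
    then have "AE y in M. g y = 0" using g by (intro nn_zero_norm) auto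
    then have "form M k f g = (\<integral>\<^sup>+x. 0 \<partial>M)" unfolding form_def
      by (intro nn_integral_cong_AE) auto
    then show ?thesis by simp
  next
    case 3
    let ?f = "\<lambda>x. ennreal (1 / a) * f x" and ?g = "\<lambda>x. ennreal (1 / b) * g x"
    have e: "ennreal t * (ennreal (1 / t) * z) = z" if "0 < t" for t z
      using that by (simp add: mult.assoc[symmetric] ennreal_mult'[symmetric])
    have "form M k f g = (\<integral>\<^sup>+x. ennreal (a * b) * (act M k ?f x * ?g x) \<partial>M)"
      unfolding form_def
    proof (intro nn_integral_cong)
      fix x assume "x \<in> space M"
      have "act M k f x = act M k (\<lambda>y. ennreal a * ?f y) x" using 3 by (simp add: e)
      also have "\<dots> = ennreal a * act M k ?f x" by (rule act_scale) (use \<open>x \<in> space M\<close> in auto)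
      finally have "act M k f x * g x = (ennreal a * act M k ?f x) * (ennreal b * ?g x)"
        using 3 by (simp add: e)
      also have "\<dots> = ennreal (a * b) * (act M k ?f x * ?g x)"
        using 3 by (simp add: ennreal_mult' ac_simps)
      finally show "act M k f x * g x = ennreal (a * b) * (act M k ?f x * ?g x)" .
    qed
    also have "\<dots> = ennreal (a * b) * form M k ?f ?g"
      unfolding form_def by (rule nn_integral_cmult) measurable
    also have "\<dots> \<le> ennreal (a * b) * ennreal C"
      by (intro mult_left_mono C nn_ball_scale) (use f g 3 in auto)
    also have "\<dots> = ennreal (C * a * b)" using 3 C by (simp add: ennreal_mult'[symmetric] ac_simps)
    finally show ?thesis .
  qed
qed

text \<open>By duality, a bound of the form is a bound of the operator.\<close>

lemma act_L2:
  assumes k[measurable]: "measurable_kernel M k"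
    and C: "\<And>f g. f \<in> nn_ball M \<Longrightarrow> g \<in> nn_ball M \<Longrightarrow> form M k f g \<le> ennreal C" "0 \<le> C"
    and f[measurable]: "f \<in> borel_measurable M" "(\<integral>\<^sup>+x. (f x)\<^sup>2 \<partial>M) \<le> ennreal (a\<^sup>2)" "0 \<le> a"
  shows "(\<integral>\<^sup>+x. (act M k f x)\<^sup>2 \<partial>M) \<le> ennreal ((C * a)\<^sup>2)"
proof (rule nn_duality)
  fix g assume g: "g \<in> nn_ball M"
  show "(\<integral>\<^sup>+x. act M k f x * g x \<partial>M) \<le> ennreal (C * a)"
    using form_scale[OF k C f, of g 1] g by (auto simp: nn_ball_def form_def)
qed (use C f in auto)

lemma pos_kernel_act_finite:
  assumes k: "pos_kernel M k" and f[measurable]: "f \<in> borel_measurable M" "(\<integral>\<^sup>+x. (f x)\<^sup>2 \<partial>M) < \<infinity>"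
  shows "(\<integral>\<^sup>+x. (act M k f x)\<^sup>2 \<partial>M) < \<infinity>"
proof -
  obtain t where t: "(\<integral>\<^sup>+x. (f x)\<^sup>2 \<partial>M) = ennreal t" "0 \<le> t" using f by (cases "(\<integral>\<^sup>+x. (f x)\<^sup>2 \<partial>M)") auto
  obtain C where C: "0 \<le> C" "\<forall>f\<in>nn_ball M. \<forall>g\<in>nn_ball M. form M k f g \<le> ennreal C"
    using k by (auto simp: pos_kernel_def)
  have "(\<integral>\<^sup>+x. (act M k f x)\<^sup>2 \<partial>M) \<le> ennreal ((C * sqrt t)\<^sup>2)"
    by (rule act_L2) (use C k t in \<open>auto simp: pos_kernel_def\<close>)
  then show ?thesis by (simp add: le_less_trans)
qed

end

section \<open>Composition of positive kernels\<close>

definition ae_eq :: "'a measure \<Rightarrow> 'a kernel \<Rightarrow> 'a kernel \<Rightarrow> bool" where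
  "ae_eq M k h \<longleftrightarrow> (AE x in M. AE y in M. k x y = h x y)"

text \<open>Unlike \<open>kernel_comp\<close>, which is \<open>0\<close> where the integral diverges, this composition obeys Tonelli's
  theorem at every point.\<close>

definition nn_comp :: "'a measure \<Rightarrow> 'a kernel \<Rightarrow> 'a kernel \<Rightarrow> 'a \<Rightarrow> 'a \<Rightarrow> ennreal" where
  "nn_comp M k h x y = (\<integral>\<^sup>+z. ennreal (k x z) * ennreal (h z y) \<partial>M)"

lemma ae_le_refl: "ae_le M k k"
  by (simp add: ae_le_def)

lemma ae_eq_imp_le: "ae_eq M k h \<Longrightarrow> ae_le M k h"
  by (auto simp: ae_le_def ae_eq_def elim!: eventually_mono)

lemma ae_eq_sym: "ae_eq M k h \<Longrightarrow> ae_eq M h k"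
  by (auto simp: ae_eq_def elim!: eventually_mono)

lemma ae_eq_refl: "ae_eq M k k"
  by (simp add: ae_eq_def)

lemma AE_AE_elim2:
  assumes "AE x in M. AE y in M. P x y" "AE x in M. AE y in M. Q x y"
    and "\<And>x y. P x y \<Longrightarrow> Q x y \<Longrightarrow> R x y"
  shows "AE x in M. AE y in M. R x y"
  using assms(1,2)
proof eventually_elim
  case (elim x)
  then show ?case by eventually_elim (rule assms(3))
qed

lemma ae_le_trans:
  assumes "ae_le M k h" "ae_le M h l"
  shows "ae_le M k l"
  unfolding ae_le_def by (rule AE_AE_elim2[OF assms[unfolded ae_le_def]]) auto

lemma ae_eq_trans:
  assumes "ae_eq M k h" "ae_eq M h l"
  shows "ae_eq M k l"
  unfolding ae_eq_def by (rule AE_AE_elim2[OF assms[unfolded ae_eq_def]]) auto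

lemma ae_le_antisym:
  assumes "ae_le M k h" "ae_le M h k"
  shows "ae_eq M k h"
  unfolding ae_eq_def by (rule AE_AE_elim2[OF assms[unfolded ae_le_def]]) auto

lemma measurable_kernel_at:
  assumes "measurable_kernel M k"
    and "X \<in> N \<rightarrow>\<^sub>M M" "Y \<in> N \<rightarrow>\<^sub>M M"
  shows "(\<lambda>w. k (X w) (Y w)) \<in> N \<rightarrow>\<^sub>M borel"
  using measurable_compose[OF measurable_Pair[OF assms(2,3)] assms(1)] by simp

lemma measurable_kernel_adjoint [measurable (raw)]:
  assumes [measurable]: "measurable_kernel M k"
    and [measurable]: "X \<in> N \<rightarrow>\<^sub>M M" "Y \<in> N \<rightarrow>\<^sub>M M"
  shows "(\<lambda>w. kernel_adjoint k (X w) (Y w)) \<in> N \<rightarrow>\<^sub>M borel"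
  unfolding kernel_adjoint_def by (rule measurable_kernel_at) fact+

context sigma_finite_measure
begin

interpretation P: pair_sigma_finite M M ..

lemma measurable_kernel_comp [measurable (raw)]:
  assumes [measurable]: "measurable_kernel M k"
    "measurable_kernel M h"
    and [measurable]: "X \<in> N \<rightarrow>\<^sub>M M" "Y \<in> N \<rightarrow>\<^sub>M M"
  shows "(\<lambda>w. kernel_comp M k h (X w) (Y w)) \<in> N \<rightarrow>\<^sub>M borel"
  unfolding kernel_comp_def by measurable

lemma measurable_nn_comp [measurable (raw)]:
  assumes [measurable]: "measurable_kernel M k"
    "measurable_kernel M h"
    and [measurable]: "X \<in> N \<rightarrow>\<^sub>M M" "Y \<in> N \<rightarrow>\<^sub>M M"
  shows "(\<lambda>w. nn_comp M k h (X w) (Y w)) \<in> N \<rightarrow>\<^sub>M borel"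
  unfolding nn_comp_def by measurable

lemma AE_le_swap:
  assumes [measurable]: "measurable_kernel M k"
    "measurable_kernel M h"
    and "ae_le M k h"
  shows "AE y in M. AE x in M. k x y \<le> h x y"
  using assms(3) unfolding ae_le_def by (subst P.AE_commute[symmetric]) measurable

lemma ae_le_adjoint:
  assumes "measurable_kernel M k"
    "measurable_kernel M h" "ae_le M k h"
  shows "ae_le M (kernel_adjoint k) (kernel_adjoint h)"
  using AE_le_swap[OF assms] by (simp add: ae_le_def kernel_adjoint_def)

lemma act_nn_comp:
  assumes [measurable]: "measurable_kernel M k"
    "measurable_kernel M h" "f \<in> borel_measurable M"
    and x[measurable]: "x \<in> space M"
  shows "(\<integral>\<^sup>+y. nn_comp M k h x y * f y \<partial>M) = act M k (act M h f) x"
proof -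
  have "(\<integral>\<^sup>+y. nn_comp M k h x y * f y \<partial>M)
    = (\<integral>\<^sup>+y. \<integral>\<^sup>+z. ennreal (k x z) * (ennreal (h z y) * f y) \<partial>M \<partial>M)"
    unfolding nn_comp_def
    by (intro nn_integral_cong, subst nn_integral_multc[symmetric]) (simp_all add: ac_simps)
  also have "\<dots> = (\<integral>\<^sup>+z. \<integral>\<^sup>+y. ennreal (k x z) * (ennreal (h z y) * f y) \<partial>M \<partial>M)"
    by (rule P.Fubini') measurable
  also have "\<dots> = act M k (act M h f) x"
    unfolding act_def by (intro nn_integral_cong) (simp add: nn_integral_cmult)
  finally show ?thesis .
qed

lemma obtain_positive_L2:
  obtains \<phi> :: "'a \<Rightarrow> real" where "\<phi> \<in> borel_measurable M" "\<And>x. 0 < \<phi> x" "integrable M \<phi>"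
    "(\<integral>\<^sup>+x. (ennreal (\<phi> x))\<^sup>2 \<partial>M) < \<infinity>"
proof -
  obtain \<phi> :: "'a \<Rightarrow> real" where \<phi>: "\<phi> \<in> borel_measurable M" "\<And>x. 0 < \<phi> x" "\<And>x. \<phi> x \<le> 1"
    "integrable M \<phi>"
    by (rule obtain_positive_integrable_function) blast
  have "(\<integral>\<^sup>+x. (ennreal (\<phi> x))\<^sup>2 \<partial>M) \<le> (\<integral>\<^sup>+x. ennreal (\<phi> x) \<partial>M)"
    using \<phi> by (intro nn_integral_mono)
      (auto simp: ennreal_power power2_eq_square less_imp_le intro!: ennreal_leI mult_left_le)
  also have "\<dots> < \<infinity>"
    using \<phi> by (simp add: nn_integral_eq_integral less_imp_le)
  finally show ?thesis using that \<phi> by blast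
qed

text \<open>Applied to a strictly positive function in \<open>L\<^sup>2\<close>, the product of the two operators gives an almost
  everywhere finite function; an infinite value of the kernel on a set of positive measure would
  prevent this.\<close>

lemma nn_comp_finite:
  assumes k: "pos_kernel M k" and h: "pos_kernel M h"
  shows "AE x in M. AE y in M. nn_comp M k h x y < \<infinity>"
proof -
  note [measurable] = pos_kernelD(1)[OF k] pos_kernelD(1)[OF h]
  obtain \<phi> :: "'a \<Rightarrow> real" where \<phi>[measurable]: "\<phi> \<in> borel_measurable M" and pos: "\<And>x. 0 < \<phi> x"
    and fin: "(\<integral>\<^sup>+x. (ennreal (\<phi> x))\<^sup>2 \<partial>M) < \<infinity>"
    by (rule obtain_positive_L2) blast
  have "(\<integral>\<^sup>+x. (act M k (act M h (\<lambda>x. ennreal (\<phi> x))) x)\<^sup>2 \<partial>M) < \<infinity>"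
    by (intro pos_kernel_act_finite k h fin) auto
  then have "AE x in M. act M k (act M h (\<lambda>x. ennreal (\<phi> x))) x < \<infinity>"
    by (intro L2_finite_AE) auto
  with AE_space show ?thesis
  proof eventually_elim
    case (elim x)
    then have [measurable]: "x \<in> space M" by simp
    from elim have *: "(\<integral>\<^sup>+y. nn_comp M k h x y * ennreal (\<phi> y) \<partial>M) \<noteq> \<infinity>"
      by (subst act_nn_comp) auto
    have "AE y in M. nn_comp M k h x y * ennreal (\<phi> y) \<noteq> \<infinity>"
      by (rule nn_integral_PInf_AE[OF _ *]) measurable
    then show ?case
    proof (rule eventually_mono)
      fix y assume "nn_comp M k h x y * ennreal (\<phi> y) \<noteq> \<infinity>"
      then show "nn_comp M k h x y < \<infinity>"
        using pos[of y] by (auto simp: ennreal_mult_eq_top_iff less_top)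
    qed
  qed
qed

lemma kernel_comp_nn_comp:
  assumes k: "pos_kernel M k" and h: "pos_kernel M h"
  shows "AE x in M. AE y in M. ennreal (kernel_comp M k h x y) = nn_comp M k h x y"
proof -
  note [measurable] = pos_kernelD(1)[OF k] pos_kernelD(1)[OF h]
  have "AE x in M. (AE y in M. nn_comp M k h x y < \<infinity>) \<and> x \<in> space M"
    using nn_comp_finite[OF k h] by auto
  then show ?thesis
  proof eventually_elim
    case (elim x)
    then have [measurable]: "x \<in> space M" by simp
    have "AE y in M. nn_comp M k h x y < \<infinity> \<and> y \<in> space M" using elim by auto
    then show ?case
    proof eventually_elim
      case (elim y)
      then have [measurable]: "y \<in> space M" by simp
      have "kernel_comp M k h x y = enn2real (nn_comp M k h x y)"
        unfolding kernel_comp_def nn_comp_def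
        by (subst integral_eq_nn_integral)
          (auto simp: ennreal_mult' pos_kernelD[OF k] pos_kernelD[OF h])
      then show ?case using elim by simp
    qed
  qed
qed

lemma act_kernel_comp:
  assumes k: "pos_kernel M k" and h: "pos_kernel M h" and [measurable]: "f \<in> borel_measurable M"
  shows "AE x in M. act M (kernel_comp M k h) f x = act M k (act M h f) x"
proof -
  note [measurable] = pos_kernelD(1)[OF k] pos_kernelD(1)[OF h]
  have "AE x in M. (AE y in M. ennreal (kernel_comp M k h x y) = nn_comp M k h x y) \<and> x \<in> space M"
    using kernel_comp_nn_comp[OF k h] by auto
  then show ?thesis
  proof eventually_elim
    case (elim x)
    then have [measurable]: "x \<in> space M" by simp
    have "act M (kernel_comp M k h) f x = (\<integral>\<^sup>+y. nn_comp M k h x y * f y \<partial>M)"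
      unfolding act_def by (intro nn_integral_cong_AE) (use elim in auto)
    then show ?case using elim by (simp add: act_nn_comp)
  qed
qed

lemma form_comp_le:
  assumes k: "pos_kernel M k" and h: "pos_kernel M h"
    and C: "\<And>f g. f \<in> nn_ball M \<Longrightarrow> g \<in> nn_ball M \<Longrightarrow> form M k f g \<le> ennreal C" "0 \<le> C"
    and D: "\<And>f g. f \<in> nn_ball M \<Longrightarrow> g \<in> nn_ball M \<Longrightarrow> form M h f g \<le> ennreal D" "0 \<le> D"
    and f: "f \<in> nn_ball M" and g: "g \<in> nn_ball M"
  shows "form M (kernel_comp M k h) f g \<le> ennreal (C * D)"
proof -
  note [measurable] = pos_kernelD(1)[OF k] pos_kernelD(1)[OF h]
  have [measurable]: "f \<in> borel_measurable M" "g \<in> borel_measurable M"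
    using f g by (auto simp: nn_ball_def)
  have "form M (kernel_comp M k h) f g = form M k (act M h f) g"
    unfolding form_def by (intro nn_integral_cong_AE) (use act_kernel_comp[OF k h, of f] in auto)
  also have "\<dots> \<le> ennreal (C * D * 1)"
  proof (rule form_scale[OF _ C])
    show "(\<integral>\<^sup>+x. (act M h f x)\<^sup>2 \<partial>M) \<le> ennreal (D\<^sup>2)"
      using act_L2[OF pos_kernelD(1)[OF h] D, of f 1] f by (simp add: nn_ball_def)
  qed (use D g in \<open>auto simp: nn_ball_def\<close>)
  finally show ?thesis by simp
qed

lemma pos_kernel_comp:
  assumes k: "pos_kernel M k" and h: "pos_kernel M h"
  shows "pos_kernel M (kernel_comp M k h)"
proof -
  note [measurable] = pos_kernelD(1)[OF k] pos_kernelD(1)[OF h]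
  obtain C where C: "0 \<le> C" "\<forall>f\<in>nn_ball M. \<forall>g\<in>nn_ball M. form M k f g \<le> ennreal C"
    using k by (auto simp: pos_kernel_def)
  obtain D where D: "0 \<le> D" "\<forall>f\<in>nn_ball M. \<forall>g\<in>nn_ball M. form M h f g \<le> ennreal D"
    using h by (auto simp: pos_kernel_def)
  have "0 \<le> C * D" using C D by simp
  moreover have "\<forall>f\<in>nn_ball M. \<forall>g\<in>nn_ball M. form M (kernel_comp M k h) f g \<le> ennreal (C * D)"
    using C D by (auto intro!: form_comp_le[OF k h])
  moreover have "0 \<le> kernel_comp M k h x y" for x y
    unfolding kernel_comp_def using pos_kernelD[OF k] pos_kernelD[OF h]
    by (intro integral_nonneg_AE) auto
  moreover have "(\<lambda>(x, y). kernel_comp M k h x y) \<in> borel_measurable (M \<Otimes>\<^sub>M M)" by measurable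
  ultimately show ?thesis unfolding pos_kernel_def by blast
qed

lemma pos_kernel_mono:
  assumes h: "pos_kernel M h" and [measurable]: "measurable_kernel M k"
    and "\<And>x y. 0 \<le> k x y" "ae_le M k h"
  shows "pos_kernel M k"
proof -
  obtain C where C: "0 \<le> C" "\<forall>f\<in>nn_ball M. \<forall>g\<in>nn_ball M. form M h f g \<le> ennreal C"
    using h by (auto simp: pos_kernel_def)
  moreover have "form M k f g \<le> form M h f g" for f g by (rule form_mono[OF assms(4)])
  ultimately show ?thesis using assms(2,3) unfolding pos_kernel_def by (meson order_trans)
qed

lemma pos_kernel_adjoint:
  assumes k: "pos_kernel M k"
  shows "pos_kernel M (kernel_adjoint k)"
proof -
  obtain C where C: "0 \<le> C" "\<forall>f\<in>nn_ball M. \<forall>g\<in>nn_ball M. form M k f g \<le> ennreal C"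
    using k by (auto simp: pos_kernel_def)
  have "form M (kernel_adjoint k) f g \<le> ennreal C" if "f \<in> nn_ball M" "g \<in> nn_ball M" for f g
    using form_swap[OF pos_kernelD(1)[OF k], of f g] C that by (auto simp: nn_ball_def)
  moreover note [measurable] = pos_kernelD(1)[OF k]
  have "(\<lambda>(x, y). kernel_adjoint k x y) \<in> borel_measurable (M \<Otimes>\<^sub>M M)" by measurable
  ultimately show ?thesis using C pos_kernelD(2)[OF k]
    unfolding pos_kernel_def by (auto simp: kernel_adjoint_def)
qed

lemma form_combine:
  assumes [measurable]: "measurable_kernel M k"
    "measurable_kernel M h"
    "f \<in> borel_measurable M" "g \<in> borel_measurable M"
    and nonneg: "\<And>x y. 0 \<le> k x y" "\<And>x y. 0 \<le> h x y" "0 \<le> a" "0 \<le> b"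
  shows "form M (\<lambda>x y. a * k x y + b * h x y) f g = ennreal a * form M k f g + ennreal b * form M h f g"
proof -
  have "form M (\<lambda>x y. a * k x y + b * h x y) f g
      = (\<integral>\<^sup>+x. ennreal a * (act M k f x * g x) + ennreal b * (act M h f x * g x) \<partial>M)"
    unfolding form_def
  proof (intro nn_integral_cong)
    fix x assume [measurable]: "x \<in> space M"
    have "act M (\<lambda>x y. a * k x y + b * h x y) f x
       = (\<integral>\<^sup>+y. ennreal a * (ennreal (k x y) * f y) + ennreal b * (ennreal (h x y) * f y) \<partial>M)"
      unfolding act_def by (intro nn_integral_cong)
        (simp add: nonneg ennreal_plus ennreal_mult' distrib_right mult.assoc)
    also have "\<dots> = ennreal a * act M k f x + ennreal b * act M h f x"
      unfolding act_def by (subst nn_integral_add) (simp_all add: nn_integral_cmult)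
    finally show "act M (\<lambda>x y. a * k x y + b * h x y) f x * g x
      = ennreal a * (act M k f x * g x) + ennreal b * (act M h f x * g x)"
      by (simp add: distrib_right mult.assoc)
  qed
  also have "\<dots> = ennreal a * form M k f g + ennreal b * form M h f g"
    unfolding form_def by (subst nn_integral_add) (simp_all add: nn_integral_cmult)
  finally show ?thesis .
qed

lemma pos_kernel_combine:
  assumes k: "pos_kernel M k" and h: "pos_kernel M h" and ab: "0 \<le> a" "0 \<le> b"
  shows "pos_kernel M (\<lambda>x y. a * k x y + b * h x y)"
proof -
  note [measurable] = pos_kernelD(1)[OF k] pos_kernelD(1)[OF h]
  obtain C where C: "0 \<le> C" "\<forall>f\<in>nn_ball M. \<forall>g\<in>nn_ball M. form M k f g \<le> ennreal C"
    using k by (auto simp: pos_kernel_def)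
  obtain D where D: "0 \<le> D" "\<forall>f\<in>nn_ball M. \<forall>g\<in>nn_ball M. form M h f g \<le> ennreal D"
    using h by (auto simp: pos_kernel_def)
  have "form M (\<lambda>x y. a * k x y + b * h x y) f g \<le> ennreal (a * C + b * D)"
    if f: "f \<in> nn_ball M" and g: "g \<in> nn_ball M" for f g
  proof -
    have "form M (\<lambda>x y. a * k x y + b * h x y) f g = ennreal a * form M k f g + ennreal b * form M h f g"
      using f g ab pos_kernelD(2)[OF k] pos_kernelD(2)[OF h]
      by (intro form_combine) (auto simp: nn_ball_def)
    also have "\<dots> \<le> ennreal a * ennreal C + ennreal b * ennreal D"
      using C D f g by (intro add_mono mult_left_mono) auto
    also have "\<dots> = ennreal (a * C + b * D)" using C D ab by (simp add: ennreal_mult')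
    finally show ?thesis .
  qed
  moreover have "(\<lambda>(x, y). a * k x y + b * h x y) \<in> borel_measurable (M \<Otimes>\<^sub>M M)" by measurable
  ultimately show ?thesis
    using C D ab pos_kernelD(2)[OF k] pos_kernelD(2)[OF h]
    unfolding pos_kernel_def by (intro conjI exI[of _ "a * C + b * D"]) auto
qed

lemma kernel_comp_mono:
  assumes k: "pos_kernel M k" "pos_kernel M k'" "ae_le M k k'"
    and h: "pos_kernel M h" "pos_kernel M h'" "ae_le M h h'"
  shows "ae_le M (kernel_comp M k h) (kernel_comp M k' h')"
proof -
  have "AE y in M. AE z in M. h z y \<le> h' z y"
    by (rule AE_le_swap[OF h(1)[THEN pos_kernelD(1)] h(2)[THEN pos_kernelD(1)] h(3)])
  then have "AE x in M. AE y in M. AE z in M. h z y \<le> h' z y" by simp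
  with k(3)[unfolded ae_le_def] kernel_comp_nn_comp[OF k(1) h(1)] kernel_comp_nn_comp[OF k(2) h(2)]
  have "AE x in M. AE y in M. kernel_comp M k h x y \<le> kernel_comp M k' h' x y"
  proof eventually_elim
    case (elim x)
    from elim(2,3,4) show ?case
    proof eventually_elim
      case (elim y)
      have "nn_comp M k h x y \<le> nn_comp M k' h' x y"
        unfolding nn_comp_def
      proof (rule nn_integral_mono_AE)
        show "AE z in M. ennreal (k x z) * ennreal (h z y) \<le> ennreal (k' x z) * ennreal (h' z y)"
          using \<open>AE y in M. k x y \<le> k' x y\<close> elim(3)
          by eventually_elim (auto intro!: mult_mono ennreal_leI)
      qed
      then have "ennreal (kernel_comp M k h x y) \<le> ennreal (kernel_comp M k' h' x y)"
        using elim by simp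
      then show ?case
        using pos_kernelD(2)[OF pos_kernel_comp[OF k(2) h(2)]] by (simp add: ennreal_le_iff)
    qed
  qed
  then show ?thesis by (simp add: ae_le_def)
qed

lemma kernel_comp_cong:
  assumes "pos_kernel M k" "pos_kernel M k'" "ae_eq M k k'"
    and "pos_kernel M h" "pos_kernel M h'" "ae_eq M h h'"
  shows "ae_eq M (kernel_comp M k h) (kernel_comp M k' h')"
  using assms by (intro ae_le_antisym kernel_comp_mono) (auto intro: ae_eq_imp_le ae_eq_sym)

lemma AE_nn_comp_swap:
  assumes k: "pos_kernel M k" and h: "pos_kernel M h"
  shows "AE y in M. AE x in M. ennreal (kernel_comp M k h x y) = nn_comp M k h x y"
proof -
  note [measurable] = pos_kernelD(1)[OF k] pos_kernelD(1)[OF h]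
  show ?thesis using kernel_comp_nn_comp[OF k h] by (subst P.AE_commute[symmetric]) measurable
qed

lemma kernel_comp_assoc:
  assumes k: "pos_kernel M k" and h: "pos_kernel M h" and l: "pos_kernel M l"
  shows "ae_eq M (kernel_comp M (kernel_comp M k h) l) (kernel_comp M k (kernel_comp M h l))"
proof -
  note [measurable] = pos_kernelD(1)[OF k] pos_kernelD(1)[OF h] pos_kernelD(1)[OF l]
  have "AE x in M. AE y in M. AE z in M. ennreal (kernel_comp M h l z y) = nn_comp M h l z y"
    using AE_nn_comp_swap[OF h l] by simp
  with kernel_comp_nn_comp[OF k h] kernel_comp_nn_comp[OF pos_kernel_comp[OF k h] l]
     kernel_comp_nn_comp[OF k pos_kernel_comp[OF h l]] AE_space
  have "AE x in M. AE y in M.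
    kernel_comp M (kernel_comp M k h) l x y = kernel_comp M k (kernel_comp M h l) x y"
  proof eventually_elim
    case (elim x)
    note x = \<open>x \<in> space M\<close>
    note kh = elim(1)
    from elim(2,3,5) AE_space show ?case
    proof eventually_elim
      case (elim y)
      note [measurable] = x \<open>y \<in> space M\<close>
      have "nn_comp M (kernel_comp M k h) l x y = (\<integral>\<^sup>+z. nn_comp M k h x z * ennreal (l z y) \<partial>M)"
        unfolding nn_comp_def[of M "kernel_comp M k h"]
        by (intro nn_integral_cong_AE) (use kh in auto)
      also have "\<dots> = act M k (act M h (\<lambda>z. ennreal (l z y))) x"
        by (rule act_nn_comp) (use x in measurable)
      also have "\<dots> = (\<integral>\<^sup>+z. ennreal (k x z) * nn_comp M h l z y \<partial>M)"
        by (simp add: act_def nn_comp_def)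
      also have "\<dots> = nn_comp M k (kernel_comp M h l) x y"
        unfolding nn_comp_def[of M k] by (intro nn_integral_cong_AE) (use elim(3) in auto)
      finally have "ennreal (kernel_comp M (kernel_comp M k h) l x y)
        = ennreal (kernel_comp M k (kernel_comp M h l) x y)" using elim by simp
      then show ?case
        using pos_kernelD(2)[OF pos_kernel_comp[OF k pos_kernel_comp[OF h l]]]
          pos_kernelD(2)[OF pos_kernel_comp[OF pos_kernel_comp[OF k h] l]] by simp
    qed
  qed
  then show ?thesis by (simp add: ae_eq_def)
qed

end

section \<open>Powers of kernels\<close>

lemma kernel_power_1 [simp]: "kernel_power M k (Suc 0) = k" "kernel_power M k 0 = k"
  by (auto simp: kernel_power_def)

lemma kernel_power_Suc: "1 \<le> m \<Longrightarrow> kernel_power M k (Suc m) = kernel_comp M k (kernel_power M k m)"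
  by (cases m) (auto simp: kernel_power_def)

context sigma_finite_measure
begin

lemma pos_kernel_power:
  assumes "pos_kernel M k"
  shows "pos_kernel M (kernel_power M k m)"
proof -
  have "pos_kernel M ((kernel_comp M k ^^ n) k)" for n
    by (induction n) (auto simp: assms intro: pos_kernel_comp)
  then show ?thesis by (simp add: kernel_power_def)
qed

lemma kernel_power_add:
  assumes k: "pos_kernel M k" and "1 \<le> m" "1 \<le> n"
  shows "ae_eq M (kernel_power M k (m + n)) (kernel_comp M (kernel_power M k m) (kernel_power M k n))"
  using \<open>1 \<le> m\<close>
proof (induction m rule: dec_induct)
  case base
  then show ?case using \<open>1 \<le> n\<close> by (simp add: kernel_power_Suc ae_eq_refl)
next
  case (step m)
  let ?p = "kernel_power M k"
  have "ae_eq M (kernel_comp M k (?p (m + n))) (kernel_comp M k (kernel_comp M (?p m) (?p n)))"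
    by (intro kernel_comp_cong k pos_kernel_power pos_kernel_comp ae_eq_refl step.IH)
  moreover have "ae_eq M (kernel_comp M k (kernel_comp M (?p m) (?p n)))
    (kernel_comp M (kernel_comp M k (?p m)) (?p n))"
    by (intro ae_eq_sym[OF kernel_comp_assoc] k pos_kernel_power)
  ultimately show ?case using step.hyps by (auto simp: kernel_power_Suc intro: ae_eq_trans)
qed

lemma kernel_power_mult:
  assumes k: "pos_kernel M k" and p: "1 \<le> p" and "1 \<le> j"
  shows "ae_eq M (kernel_power M (kernel_power M k p) j) (kernel_power M k (p * j))"
  using \<open>1 \<le> j\<close>
proof (induction j rule: dec_induct)
  case base
  then show ?case by (simp add: ae_eq_refl)
next
  case (step j)
  let ?p = "kernel_power M k"
  have "ae_eq M (kernel_comp M (?p p) (kernel_power M (?p p) j)) (kernel_comp M (?p p) (?p (p * j)))"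
    by (intro kernel_comp_cong k pos_kernel_power pos_kernel_comp ae_eq_refl step.IH)
  moreover have "ae_eq M (kernel_comp M (?p p) (?p (p * j))) (?p (p + p * j))"
    by (intro ae_eq_sym[OF kernel_power_add] k p) (use p step.hyps in auto)
  ultimately show ?case using step.hyps by (auto simp: kernel_power_Suc intro: ae_eq_trans)
qed

lemma kernel_power_mono:
  assumes k: "pos_kernel M k" and h: "pos_kernel M h" and "ae_le M k h"
  shows "ae_le M (kernel_power M k j) (kernel_power M h j)"
proof (cases "j = 0")
  case False
  then have "1 \<le> j" by simp
  then show ?thesis
  proof (induction j rule: dec_induct)
    case (step j)
    then show ?case
      by (simp add: kernel_power_Suc) (intro kernel_comp_mono k h pos_kernel_power assms)
  qed (use assms in simp)
qed (use assms in simp)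

end

lemma kernel_power_scale:
  assumes "1 \<le> j"
  shows "kernel_power M (\<lambda>x y. c * k x y) j = (\<lambda>x y. c ^ j * kernel_power M k j x y)"
  using assms
proof (induction j rule: dec_induct)
  case (step j)
  then show ?case
    by (simp add: kernel_power_Suc fun_eq_iff kernel_comp_def mult.assoc mult.left_commute[of _ "c ^ j"])
qed simp

section \<open>Weighted geometric symmetrisation\<close>

text \<open>Exponents with sum greater than \<open>1\<close> are admissible for measures under which an integral dominates
  the values of its integrand.\<close>

definition counting :: "'a measure \<Rightarrow> bool" where
  "counting M \<longleftrightarrow> M = count_space (space M)"

lemma counting_transfer:
  assumes "counting M" "P (count_space (space M))"
  shows "P M"
  using assms unfolding counting_def by metis

lemma sets_counting: "counting M \<Longrightarrow> sets M = Pow (space M)"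
  by (erule counting_transfer[where P="\<lambda>N. sets N = Pow (space N)"]) simp

lemma AE_counting: "counting M \<Longrightarrow> (AE x in M. Q x) \<longleftrightarrow> (\<forall>x\<in>space M. Q x)"
  by (erule counting_transfer[where P="\<lambda>N. (AE x in N. Q x) \<longleftrightarrow> (\<forall>x\<in>space N. Q x)"])
    (simp add: AE_count_space)

lemma emeasure_counting:
  assumes "counting M" "z \<in> space M"
  shows "emeasure M {z} = 1"
  using counting_transfer[where P="\<lambda>N. \<forall>z\<in>space N. emeasure N {z} = 1", OF assms(1)] assms(2)
  by simp

lemma counting_le_nn_integral:
  assumes "counting M" "z \<in> space M"
  shows "f z \<le> (\<integral>\<^sup>+x. f x \<partial>M)"
  using counting_transfer[where P="\<lambda>N. \<forall>z\<in>space N. f z \<le> (\<integral>\<^sup>+x. f x \<partial>N)", OF assms(1)]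
    assms(2) by (simp add: nn_integral_ge_point)

lemma rpow_nonneg [simp]: "0 \<le> x \<Longrightarrow> 0 \<le> rpow x a"
  by (simp add: rpow_def)

lemma rpow_mono: "0 \<le> x \<Longrightarrow> x \<le> y \<Longrightarrow> 0 \<le> a \<Longrightarrow> rpow x a \<le> rpow y a"
  by (simp add: rpow_def powr_mono2)

lemma rpow_mult: "0 \<le> x \<Longrightarrow> 0 \<le> y \<Longrightarrow> rpow (x * y) a = rpow x a * rpow y a"
  by (simp add: rpow_def powr_mult)

lemma rpow_add: "0 \<le> x \<Longrightarrow> 0 \<le> a \<Longrightarrow> 0 \<le> b \<Longrightarrow> rpow x (a + b) = rpow x a * rpow x b"
  by (auto simp: rpow_def powr_add)

lemma measurable_rpow [measurable (raw)]:
  "f \<in> borel_measurable M \<Longrightarrow> (\<lambda>x. rpow (f x) a) \<in> borel_measurable M"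
  unfolding rpow_def by (cases "a = 0") simp_all

text \<open>For exponents with sum \<open>s\<close> this is Young's inequality for \<open>a / s\<close> and \<open>b / s\<close>; lowering the
  exponents from \<open>a, b\<close> to \<open>a / s, b / s\<close> increases powers of numbers in the unit interval.\<close>

lemma rpow_young:
  assumes pq: "0 \<le> p" "0 \<le> q" and ab: "0 \<le> a" "0 \<le> b"
    and H: "a + b = 1 \<or> (1 \<le> a + b \<and> p \<le> 1 \<and> q \<le> 1)"
  shows "rpow p a * rpow q b \<le> a / (a + b) * p + b / (a + b) * q"
proof -
  have one: "x powr c \<le> x" if "0 \<le> x" "c = 1 \<or> (1 \<le> c \<and> x \<le> 1)" for x c :: real
    using that powr_mono'[of 1 c x] by auto
  consider "a = 0" | "b = 0" | "0 < a" "0 < b" using ab by linarith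
  then show ?thesis
  proof cases
    case 1
    then show ?thesis using H one[of q b] pq ab by (auto simp: rpow_def)
  next
    case 2
    then show ?thesis using H one[of p a] pq ab by (auto simp: rpow_def)
  next
    case 3
    let ?s = "a + b"
    show ?thesis
    proof (cases "p = 0 \<or> q = 0")
      case True
      then show ?thesis using 3 pq ab by (auto simp: rpow_def)
    next
      case False
      then have pos: "0 < p" "0 < q" using pq by auto
      have le: "a / ?s \<le> a" "b / ?s \<le> b" using H 3 by (auto simp: divide_le_eq mult_le_cancel_left1)
      have "p powr a \<le> p powr (a / ?s)" "q powr b \<le> q powr (b / ?s)"
        using H le pos powr_mono'[of "a / ?s" a p] powr_mono'[of "b / ?s" b q] by auto
      then have "p powr a * q powr b \<le> p powr (a / ?s) * q powr (b / ?s)"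
        by (intro mult_mono) auto
      also have "\<dots> \<le> a / ?s * p + b / ?s * q"
        by (rule Youngs_inequality_0) (use 3 pos in \<open>auto simp flip: add_divide_distrib\<close>)
      finally show ?thesis using 3 by (simp add: rpow_def)
    qed
  qed
qed

text \<open>Divided by their integrals, if these do not vanish, both functions have integral \<open>1\<close>, and Young's inequality can be
  integrated.  If \<open>a + b > 1\<close>, the quotients must be at most \<open>1\<close> pointwise, which a counting measure
  guarantees.\<close>

lemma nn_integral_holder:
  assumes [measurable]: "u \<in> borel_measurable M" "v \<in> borel_measurable M"
    and uv: "\<And>z. 0 \<le> u z" "\<And>z. 0 \<le> v z" and ab: "0 \<le> a" "0 \<le> b"
    and A: "(\<integral>\<^sup>+z. ennreal (u z) \<partial>M) = ennreal A" "0 \<le> A"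
    and B: "(\<integral>\<^sup>+z. ennreal (v z) \<partial>M) = ennreal B" "0 \<le> B"
    and H: "a + b = 1 \<or> (1 \<le> a + b \<and> counting M)"
  shows "(\<integral>\<^sup>+z. ennreal (rpow (u z) a * rpow (v z) b) \<partial>M) \<le> ennreal (rpow A a * rpow B b)"
proof -
  let ?s = "a + b"
  have s: "1 \<le> ?s" using H by auto
  have zero: "AE z in M. w z = 0" if "(\<integral>\<^sup>+z. ennreal (w z) \<partial>M) = ennreal 0" "\<And>z. 0 \<le> w z"
    and [measurable]: "w \<in> borel_measurable M" for w :: "'a \<Rightarrow> real"
    using that by (subst (asm) ennreal_0, subst (asm) nn_integral_0_iff_AE)
      (auto elim!: eventually_mono simp: antisym)
  show ?thesis
  proof (cases "(0 < a \<and> A = 0) \<or> (0 < b \<and> B = 0)")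
    case True
    then have "AE z in M. rpow (u z) a * rpow (v z) b = 0"
      using zero[of u] zero[of v] A B uv by (auto elim!: eventually_mono simp: rpow_def)
    then have "(\<integral>\<^sup>+z. ennreal (rpow (u z) a * rpow (v z) b) \<partial>M) = (\<integral>\<^sup>+z. 0 \<partial>M)"
      by (intro nn_integral_cong_AE) (auto elim!: eventually_mono)
    then show ?thesis by simp
  next
    case False
    (* An integral that vanishes here has exponent 0, so that replacing it by 1 changes no power. *)
    define A' where "A' = (if A = 0 then 1 else A)"
    define B' where "B' = (if B = 0 then 1 else B)"
    have pos: "0 < A'" "0 < B'" "A \<le> A'" "B \<le> B'" using A B by (auto simp: A'_def B'_def)
    have eq: "rpow A a = rpow A' a" "rpow B b = rpow B' b"
      using False ab by (auto simp: A'_def B'_def rpow_def)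
    have pt: "rpow (u z) a * rpow (v z) b
        \<le> rpow A a * rpow B b * (a / ?s * (u z / A') + b / ?s * (v z / B'))"
      if z: "z \<in> space M" for z
    proof -
      have "u z \<le> A' \<and> v z \<le> B'" if d: "counting M"
      proof -
        have "ennreal (u z) \<le> ennreal A" "ennreal (v z) \<le> ennreal B"
          using counting_le_nn_integral[OF d z, of u] counting_le_nn_integral[OF d z, of v] A B by simp_all
        then show ?thesis using A B pos by simp
      qed
      then have "rpow (u z / A') a * rpow (v z / B') b \<le> a / ?s * (u z / A') + b / ?s * (v z / B')"
        using H uv pos ab by (intro rpow_young) auto
      then have "rpow A' a * rpow B' b * (rpow (u z / A') a * rpow (v z / B') b)
         \<le> rpow A' a * rpow B' b * (a / ?s * (u z / A') + b / ?s * (v z / B'))"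
        using pos by (intro mult_left_mono) auto
      moreover have "rpow (u z) a = rpow A' a * rpow (u z / A') a"
        "rpow (v z) b = rpow B' b * rpow (v z / B') b"
        using uv pos by (auto simp flip: rpow_mult)
      ultimately show ?thesis by (simp add: eq ac_simps)
    qed
    let ?C = "rpow A a * rpow B b"
    have C: "0 \<le> ?C" using A B by simp
    define c d where "c = ?C * (a / ?s / A')" and "d = ?C * (b / ?s / B')"
    have cd: "0 \<le> c" "0 \<le> d" using C pos ab by (auto simp: c_def d_def)
    have "(\<integral>\<^sup>+z. ennreal (rpow (u z) a * rpow (v z) b) \<partial>M)
       \<le> (\<integral>\<^sup>+z. ennreal c * ennreal (u z) + ennreal d * ennreal (v z) \<partial>M)"
    proof (rule nn_integral_mono)
      fix z assume "z \<in> space M"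
      have "ennreal c * ennreal (u z) + ennreal d * ennreal (v z) = ennreal (c * u z + d * v z)"
        using uv cd by (simp add: ennreal_mult ennreal_plus)
      then show "ennreal (rpow (u z) a * rpow (v z) b) \<le> ennreal c * ennreal (u z) + ennreal d * ennreal (v z)"
        using pt[OF \<open>z \<in> space M\<close>] by (simp add: c_def d_def ennreal_leI distrib_left)
    qed
    also have "\<dots> = ennreal c * ennreal A + ennreal d * ennreal B"
      using A B by (simp add: nn_integral_add nn_integral_cmult)
    also have "\<dots> = ennreal (c * A + d * B)"
      using A B cd by (simp add: ennreal_mult ennreal_plus)
    also have "c * A + d * B = ?C * (a / ?s * (A / A') + b / ?s * (B / B'))"
      by (simp add: c_def d_def distrib_left)
    also have "\<dots> \<le> ennreal (?C * 1)"
    proof (intro ennreal_leI mult_left_mono C)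
      have "a / ?s * (A / A') + b / ?s * (B / B') \<le> a / ?s * 1 + b / ?s * 1"
        using pos ab by (intro add_mono mult_left_mono) auto
      also have "\<dots> = 1" using s by (simp flip: add_divide_distrib)
      finally show "a / ?s * (A / A') + b / ?s * (B / B') \<le> 1" .
    qed
    finally show ?thesis by simp
  qed
qed

lemma S2_eq: "S2 a b k x y = rpow (k x y) a * rpow (k y x) b"
  by (simp add: S2_def hadamard_prod_def hadamard_power_def kernel_adjoint_def)

lemma measurable_S2 [measurable (raw)]:
  assumes k: "measurable_kernel M k"
    and "X \<in> N \<rightarrow>\<^sub>M M" "Y \<in> N \<rightarrow>\<^sub>M M"
  shows "(\<lambda>w. S2 a b k (X w) (Y w)) \<in> N \<rightarrow>\<^sub>M borel"
  using measurable_kernel_at[OF k assms(2,3)] measurable_kernel_at[OF k assms(3,2)]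
  unfolding S2_eq by measurable

context sigma_finite_measure
begin

interpretation P: pair_sigma_finite M M ..

lemma S2_mono:
  assumes k: "pos_kernel M k" "pos_kernel M h" "ae_le M k h" and ab: "0 \<le> a" "0 \<le> b"
  shows "ae_le M (S2 a b k) (S2 a b h)"
  unfolding ae_le_def
  by (rule AE_AE_elim2[OF k(3)[unfolded ae_le_def]
      ae_le_adjoint[OF pos_kernelD(1)[OF k(1)] pos_kernelD(1)[OF k(2)] k(3), unfolded ae_le_def]])
    (auto simp: S2_eq kernel_adjoint_def ab pos_kernelD[OF k(1)] pos_kernelD[OF k(2)] intro!: mult_mono rpow_mono)

lemma S2_cong:
  assumes "pos_kernel M k" "pos_kernel M h" "ae_eq M k h" "0 \<le> a" "0 \<le> b"
  shows "ae_eq M (S2 a b k) (S2 a b h)"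
  using assms by (intro ae_le_antisym S2_mono) (auto intro: ae_eq_imp_le ae_eq_sym)

text \<open>The inequality between the weighted geometric and arithmetic means.\<close>

lemma S2_le_mean:
  assumes k: "pos_kernel M k" and "0 \<le> a" "0 \<le> b" "a + b = 1"
  shows "S2 a b k x y \<le> a * k x y + b * kernel_adjoint k x y"
  using rpow_young[of "k x y" "k y x" a b] assms pos_kernelD[OF k]
  by (simp add: S2_eq kernel_adjoint_def)

lemma pos_kernel_S2:
  assumes k: "pos_kernel M k" and "0 \<le> a" "0 \<le> b" "a + b = 1"
  shows "pos_kernel M (S2 a b k)"
proof (rule pos_kernel_mono[OF pos_kernel_combine[OF k pos_kernel_adjoint[OF k], of a b]])
  show "ae_le M (S2 a b k) (\<lambda>x y. a * k x y + b * kernel_adjoint k x y)"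
    using S2_le_mean[OF assms] by (simp add: ae_le_def)
  note [measurable] = pos_kernelD(1)[OF k]
  show "(\<lambda>(x, y). S2 a b k x y) \<in> borel_measurable (M \<Otimes>\<^sub>M M)" by measurable
qed (use assms pos_kernelD[OF k] in \<open>auto simp: S2_eq\<close>)

text \<open>The factors of the integrand regroup as \<open>k x z * h z y\<close> with exponent \<open>a\<close> and \<open>h y z * k z x\<close> with
  exponent \<open>b\<close>, to which Hoelder's inequality applies.  The second product belongs to the composition
  in the opposite order.\<close>

lemma S2_comp_le:
  assumes k: "pos_kernel M k" and h: "pos_kernel M h" and ab: "0 \<le> a" "0 \<le> b"
    and H: "a + b = 1 \<or> (1 \<le> a + b \<and> counting M)"
  shows "AE x in M. AE y in M. kernel_comp M (S2 a b k) (S2 a b h) x y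
     \<le> rpow (kernel_comp M k h x y) a * rpow (kernel_comp M h k y x) b"
proof -
  note [measurable] = pos_kernelD(1)[OF k] pos_kernelD(1)[OF h]
  note pos = pos_kernelD(2)[OF k] pos_kernelD(2)[OF h]
    pos_kernelD(2)[OF pos_kernel_comp[OF k h]] pos_kernelD(2)[OF pos_kernel_comp[OF h k]]
  from kernel_comp_nn_comp[OF k h] AE_nn_comp_swap[OF h k] AE_space
  show ?thesis
  proof eventually_elim
    case (elim x)
    then have [measurable]: "x \<in> space M" by simp
    from elim(1,2) AE_space show ?case
    proof eventually_elim
      case (elim y)
      then have [measurable]: "y \<in> space M" by simp
      let ?R = "rpow (kernel_comp M k h x y) a * rpow (kernel_comp M h k y x) b"
      have "(\<integral>\<^sup>+z. ennreal (rpow (k x z * h z y) a * rpow (h y z * k z x) b) \<partial>M) \<le> ennreal ?R"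
        by (rule nn_integral_holder)
          (use H ab pos elim in \<open>auto simp: nn_comp_def ennreal_mult'\<close>)
      also have "(\<integral>\<^sup>+z. ennreal (rpow (k x z * h z y) a * rpow (h y z * k z x) b) \<partial>M)
         = (\<integral>\<^sup>+z. ennreal (S2 a b k x z * S2 a b h z y) \<partial>M)"
        by (intro nn_integral_cong) (simp add: S2_eq rpow_mult pos ac_simps)
      finally have "enn2real (\<integral>\<^sup>+z. ennreal (S2 a b k x z * S2 a b h z y) \<partial>M) \<le> ?R"
        using pos by (intro enn2real_leI) auto
      moreover have "kernel_comp M (S2 a b k) (S2 a b h) x y
         = enn2real (\<integral>\<^sup>+z. ennreal (S2 a b k x z * S2 a b h z y) \<partial>M)"
        unfolding kernel_comp_def by (rule integral_eq_nn_integral) (auto simp: S2_eq pos)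
      ultimately show ?case by simp
    qed
  qed
qed

lemma S2_square_le:
  assumes "pos_kernel M k" "0 \<le> a" "0 \<le> b" "a + b = 1 \<or> (1 \<le> a + b \<and> counting M)"
  shows "ae_le M (kernel_comp M (S2 a b k) (S2 a b k)) (S2 a b (kernel_comp M k k))"
  using S2_comp_le[OF assms(1,1,2-4)] by (simp add: ae_le_def S2_eq)

text \<open>In the induction step \<open>S2_comp_le\<close> produces the products of \<open>k\<close> and its \<open>j\<close>-th power in both orders;
  they agree because powers commute.\<close>

lemma S2_power_le:
  assumes k: "pos_kernel M k" and ab: "0 \<le> a" "0 \<le> b"
    and H: "a + b = 1 \<or> (1 \<le> a + b \<and> counting M)"
    and S: "\<And>h. pos_kernel M h \<Longrightarrow> pos_kernel M (S2 a b h)" and "1 \<le> j"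
  shows "ae_le M (kernel_power M (S2 a b k) j) (S2 a b (kernel_power M k j))"
  using \<open>1 \<le> j\<close>
proof (induction j rule: dec_induct)
  case base
  then show ?case by (simp add: ae_le_refl)
next
  case (step j)
  let ?p = "kernel_power M k"
  note [measurable] = pos_kernelD(1)[OF k] pos_kernelD(1)[OF pos_kernel_power[OF k]]
  have "ae_eq M (kernel_comp M (?p j) k) (?p (Suc j))"
    using ae_eq_sym[OF kernel_power_add[OF k, of j 1]] step.hyps by simp
  then have "ae_le M (kernel_comp M (?p j) k) (?p (Suc j))" by (rule ae_eq_imp_le)
  then have "ae_le M (kernel_adjoint (kernel_comp M (?p j) k)) (kernel_adjoint (?p (Suc j)))"
    by (intro ae_le_adjoint) measurable
  note elim = AE_AE_elim2[OF S2_comp_le[OF k pos_kernel_power[OF k, of j] ab H] this[unfolded ae_le_def],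
      where R="\<lambda>x y. kernel_comp M (S2 a b k) (S2 a b (?p j)) x y \<le> S2 a b (?p (Suc j)) x y"]
  have "ae_le M (kernel_comp M (S2 a b k) (S2 a b (?p j))) (S2 a b (?p (Suc j)))"
    unfolding ae_le_def
  proof (rule elim)
    fix x y
    assume 1: "kernel_comp M (S2 a b k) (S2 a b (?p j)) x y
        \<le> rpow (kernel_comp M k (?p j) x y) a * rpow (kernel_comp M (?p j) k y x) b"
      and 2: "kernel_adjoint (kernel_comp M (?p j) k) x y \<le> kernel_adjoint (?p (Suc j)) x y"
    have "rpow (kernel_comp M (?p j) k y x) b \<le> rpow (?p (Suc j) y x) b"
      using 2 ab pos_kernelD(2)[OF pos_kernel_comp[OF pos_kernel_power[OF k] k]]
      by (intro rpow_mono) (auto simp: kernel_adjoint_def)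
    then have "rpow (kernel_comp M k (?p j) x y) a * rpow (kernel_comp M (?p j) k y x) b
       \<le> rpow (kernel_comp M k (?p j) x y) a * rpow (?p (Suc j) y x) b"
      using pos_kernelD(2)[OF pos_kernel_comp[OF k pos_kernel_power[OF k]]]
      by (intro mult_left_mono) auto
    then show "kernel_comp M (S2 a b k) (S2 a b (?p j)) x y \<le> S2 a b (?p (Suc j)) x y"
      using 1 step.hyps by (simp add: S2_eq kernel_power_Suc)
  qed
  with kernel_comp_mono[OF S[OF k] S[OF k] ae_le_refl pos_kernel_power[OF S[OF k]]
      S[OF pos_kernel_power[OF k]] step.IH]
  have "ae_le M (kernel_comp M (S2 a b k) (kernel_power M (S2 a b k) j)) (S2 a b (?p (Suc j)))"
    by (rule ae_le_trans)
  then show ?case using step.hyps by (simp add: kernel_power_Suc)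
qed

end

text \<open>With \<open>s = a + b\<close>, each exponent \<open>c\<close> splits into \<open>c / s\<close> and \<open>c (s - 1) / s\<close>; the factors with the
  latter exponents are estimated by powers of \<open>m\<close>.\<close>

lemma S2_le_S1:
  assumes ab: "0 \<le> a" "0 \<le> b" "1 \<le> a + b"
    and k: "0 \<le> k x y" "k x y \<le> m" "0 \<le> k y x" "k y x \<le> m"
  shows "S2 a b k x y \<le> rpow m (a + b - 1) * S1 (a / (a + b)) k x y"
proof -
  define s where "s = a + b"
  have s: "1 \<le> s" using ab by (simp add: s_def)
  have split: "rpow z c \<le> rpow z (c / s) * rpow m (c * (s - 1) / s)"
    if z: "0 \<le> z" "z \<le> m" and c: "0 \<le> c" for z c
  proof -
    have "c / s + c * (s - 1) / s = c" using s by (simp add: field_simps)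
    then have "rpow z c = rpow z (c / s) * rpow z (c * (s - 1) / s)"
      using rpow_add[of z "c / s" "c * (s - 1) / s"] z c s by simp
    also have "\<dots> \<le> rpow z (c / s) * rpow m (c * (s - 1) / s)"
      using z c s by (intro mult_left_mono rpow_mono) auto
    finally show ?thesis .
  qed
  have "a * (s - 1) / s + b * (s - 1) / s = s * (s - 1) / s"
    unfolding add_divide_distrib[symmetric] distrib_right[symmetric] by (simp only: s_def)
  also have "\<dots> = s - 1" using s by simp
  finally have m: "rpow m (s - 1) = rpow m (a * (s - 1) / s) * rpow m (b * (s - 1) / s)"
    using rpow_add[of m "a * (s - 1) / s" "b * (s - 1) / s"] ab k s by simp
  have "a / s + b / s = 1" using s unfolding add_divide_distrib[symmetric] s_def[symmetric] by simp
  then have bs: "1 - a / s = b / s" by linarith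
  have "S2 a b k x y \<le> (rpow (k x y) (a / s) * rpow m (a * (s - 1) / s))
      * (rpow (k y x) (b / s) * rpow m (b * (s - 1) / s))"
    unfolding S2_eq using ab k s by (intro mult_mono split) auto
  also have "\<dots> = rpow m (s - 1) * S1 (a / s) k x y"
    unfolding m S1_def S2_eq bs by (simp only: ac_simps)
  finally show ?thesis by (simp only: s_def)
qed

section \<open>The size of a positive kernel modulo a cone\<close>

text \<open>Here \<open>\<delta>\<close> bounds the form up to an error controlled by elements of \<open>U\<close>.  Since \<open>u\<close> and \<open>v\<close> play
  symmetric roles, transposing the kernel only exchanges them.\<close>

definition dominated :: "'a measure \<Rightarrow> ('a \<Rightarrow> ennreal) set \<Rightarrow> 'a kernel \<Rightarrow> real \<Rightarrow> bool" where
  "dominated M U k \<delta> \<longleftrightarrow> 0 \<le> \<delta> \<and> (\<exists>u\<in>U. \<exists>v\<in>U. \<forall>f\<in>nn_ball M. \<forall>g\<in>nn_ball M.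
     form M k f g \<le> ennreal \<delta> + (\<integral>\<^sup>+x. f x * v x \<partial>M) + (\<integral>\<^sup>+x. g x * u x \<partial>M))"

definition kernel_size :: "'a measure \<Rightarrow> ('a \<Rightarrow> ennreal) set \<Rightarrow> 'a kernel \<Rightarrow> real" where
  "kernel_size M U k = Inf {\<delta>. dominated M U k \<delta>}"

definition nn_cone :: "'a measure \<Rightarrow> ('a \<Rightarrow> ennreal) set \<Rightarrow> bool" where
  "nn_cone M U \<longleftrightarrow> U \<subseteq> borel_measurable M \<and> (\<lambda>_. 0) \<in> U \<and>
     (\<forall>u\<in>U. \<forall>v\<in>U. \<forall>a\<ge>0. \<forall>b\<ge>0. (\<lambda>x. ennreal a * u x + ennreal b * v x) \<in> U)"

definition zero_cone :: "('a \<Rightarrow> ennreal) set" where "zero_cone = {\<lambda>_. 0}"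

definition nn_L2 :: "'a measure \<Rightarrow> ('a \<Rightarrow> ennreal) set" where
  "nn_L2 M = {u \<in> borel_measurable M. (\<integral>\<^sup>+x. (u x)\<^sup>2 \<partial>M) < \<infinity>}"

lemma nn_cone_zero: "nn_cone M zero_cone"
  unfolding nn_cone_def zero_cone_def by simp

lemma nn_cone_L2: "nn_cone M (nn_L2 M)"
proof -
  have "(\<lambda>x. ennreal a * u x + ennreal b * v x) \<in> nn_L2 M"
    if u: "u \<in> nn_L2 M" and v: "v \<in> nn_L2 M" and ab: "0 \<le> a" "0 \<le> b" for u v a b
  proof -
    have [measurable]: "u \<in> borel_measurable M" "v \<in> borel_measurable M"
      using u v by (auto simp: nn_L2_def)
    obtain s where s: "(\<integral>\<^sup>+x. (u x)\<^sup>2 \<partial>M) = ennreal s" "0 \<le> s"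
      using u by (cases "\<integral>\<^sup>+x. (u x)\<^sup>2 \<partial>M") (auto simp: nn_L2_def)
    obtain t where t: "(\<integral>\<^sup>+x. (v x)\<^sup>2 \<partial>M) = ennreal t" "0 \<le> t"
      using v by (cases "\<integral>\<^sup>+x. (v x)\<^sup>2 \<partial>M") (auto simp: nn_L2_def)
    have "(\<integral>\<^sup>+x. (ennreal a * u x + ennreal b * v x)\<^sup>2 \<partial>M) \<le> ennreal ((a * sqrt s + b * sqrt t)\<^sup>2)"
      by (intro nn_minkowski nn_scale) (use s t ab in auto)
    also have "\<dots> < \<infinity>" by simp
    finally show ?thesis by (simp add: nn_L2_def)
  qed
  moreover have "nn_L2 M \<subseteq> borel_measurable M" "(\<lambda>_. 0) \<in> nn_L2 M"
    by (auto simp: nn_L2_def)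
  ultimately show ?thesis unfolding nn_cone_def by blast
qed

lemma kernel_size_nonneg:
  "0 \<le> kernel_size M U k" if "dominated M U k \<delta>"
  unfolding kernel_size_def using that by (intro cInf_greatest) (auto simp: dominated_def)

lemma kernel_size_le: "dominated M U k \<delta> \<Longrightarrow> kernel_size M U k \<le> \<delta>"
  unfolding kernel_size_def by (intro cInf_lower bdd_belowI[of _ 0]) (auto simp: dominated_def)

lemma kernel_size_approx:
  assumes "dominated M U k \<delta>" "kernel_size M U k < c"
  shows "\<exists>\<delta><c. dominated M U k \<delta>"
  using assms cInf_lessD[of "{\<delta>. dominated M U k \<delta>}" c] unfolding kernel_size_def by blast

context sigma_finite_measure
begin

lemma dominated_exists:
  assumes "pos_kernel M k" "nn_cone M U"
  shows "\<exists>\<delta>. dominated M U k \<delta>"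
proof -
  obtain C where C: "0 \<le> C" "\<forall>f\<in>nn_ball M. \<forall>g\<in>nn_ball M. form M k f g \<le> ennreal C"
    using assms by (auto simp: pos_kernel_def)
  moreover have "(\<lambda>_. 0) \<in> U" using assms(2) by (simp add: nn_cone_def)
  ultimately have "dominated M U k C" unfolding dominated_def
    by (intro conjI bexI[of _ "\<lambda>_. 0"]) auto
  then show ?thesis ..
qed

text \<open>An affine estimate by every admissible \<open>\<delta>\<close> passes to the infimum.\<close>

lemma kernel_size_le_affine:
  assumes "pos_kernel M h" "nn_cone M U"
    and "\<And>\<delta>. dominated M U h \<delta> \<Longrightarrow> kernel_size M U k \<le> c * \<delta> + d" "0 \<le> c"
  shows "kernel_size M U k \<le> c * kernel_size M U h + d"
proof (rule field_le_epsilon)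
  fix e :: real assume e: "0 < e"
  obtain \<delta>\<^sub>0 where d0: "dominated M U h \<delta>\<^sub>0" using dominated_exists[OF assms(1,2)] by blast
  have "kernel_size M U h < kernel_size M U h + e / (c + 1)" using e assms(4) by simp
  then obtain \<delta> where \<delta>: "dominated M U h \<delta>" "\<delta> < kernel_size M U h + e / (c + 1)"
    using kernel_size_approx[OF d0] by blast
  have "kernel_size M U k \<le> c * \<delta> + d" by (rule assms(3)[OF \<delta>(1)])
  also have "\<dots> \<le> c * (kernel_size M U h + e / (c + 1)) + d"
    using \<delta> assms(4) by (intro add_right_mono mult_left_mono) auto
  also have "\<dots> \<le> c * kernel_size M U h + d + e"
  proof -
    have "c * (e / (c + 1)) \<le> e" using assms(4) e by (simp add: divide_le_eq)
    then show ?thesis by (simp add: distrib_left)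
  qed
  finally show "kernel_size M U k \<le> c * kernel_size M U h + d + e" .
qed

lemma pos_kernel_size_nonneg:
  assumes "pos_kernel M k" "nn_cone M U"
  shows "0 \<le> kernel_size M U k"
  using dominated_exists[OF assms] kernel_size_nonneg by blast

lemma dominated_mono:
  assumes "ae_le M k h" "dominated M U h \<delta>"
  shows "dominated M U k \<delta>"
proof -
  obtain u v where uv: "u \<in> U" "v \<in> U" "\<And>f g. f \<in> nn_ball M \<Longrightarrow> g \<in> nn_ball M \<Longrightarrow>
     form M h f g \<le> ennreal \<delta> + (\<integral>\<^sup>+x. f x * v x \<partial>M) + (\<integral>\<^sup>+x. g x * u x \<partial>M)"
    using assms(2) unfolding dominated_def by blast
  have "form M k f g \<le> ennreal \<delta> + (\<integral>\<^sup>+x. f x * v x \<partial>M) + (\<integral>\<^sup>+x. g x * u x \<partial>M)"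
    if "f \<in> nn_ball M" "g \<in> nn_ball M" for f g
    by (rule order_trans[OF form_mono[OF assms(1)] uv(3)[OF that]])
  then show ?thesis using uv assms(2) unfolding dominated_def by blast
qed

lemma kernel_size_mono:
  assumes "pos_kernel M h" "nn_cone M U" "ae_le M k h"
  shows "kernel_size M U k \<le> kernel_size M U h"
proof -
  have "kernel_size M U k \<le> 1 * kernel_size M U h + 0"
    by (rule kernel_size_le_affine[OF assms(1,2)])
      (use kernel_size_le[OF dominated_mono[OF assms(3)]] in simp_all)
  then show ?thesis by simp
qed

lemma dominated_adjoint:
  assumes k: "pos_kernel M k" and \<delta>: "dominated M U k \<delta>"
  shows "dominated M U (kernel_adjoint k) \<delta>"
proof -
  obtain u v where uv: "u \<in> U" "v \<in> U" "\<And>f g. f \<in> nn_ball M \<Longrightarrow> g \<in> nn_ball M \<Longrightarrow>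
     form M k f g \<le> ennreal \<delta> + (\<integral>\<^sup>+x. f x * v x \<partial>M) + (\<integral>\<^sup>+x. g x * u x \<partial>M)"
    using \<delta> unfolding dominated_def by blast
  have "form M (kernel_adjoint k) f g \<le> ennreal \<delta> + (\<integral>\<^sup>+x. f x * u x \<partial>M) + (\<integral>\<^sup>+x. g x * v x \<partial>M)"
    if "f \<in> nn_ball M" "g \<in> nn_ball M" for f g
    using uv(3)[OF that(2,1)] form_swap[OF pos_kernelD(1)[OF k], of f g] that
    by (simp add: nn_ball_def ac_simps)
  then show ?thesis using uv \<delta> unfolding dominated_def by blast
qed

lemma kernel_size_adjoint:
  assumes k: "pos_kernel M k" and U: "nn_cone M U"
  shows "kernel_size M U (kernel_adjoint k) \<le> kernel_size M U k"
proof -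
  have "kernel_size M U (kernel_adjoint k) \<le> 1 * kernel_size M U k + 0"
    by (rule kernel_size_le_affine[OF k U])
      (use kernel_size_le[OF dominated_adjoint[OF k]] in simp_all)
  then show ?thesis by simp
qed

lemma dominated_combine:
  assumes k: "pos_kernel M k" and h: "pos_kernel M h" and U: "nn_cone M U" and ab: "0 \<le> a" "0 \<le> b"
    and \<delta>: "dominated M U k \<delta>" "dominated M U h \<eta>"
  shows "dominated M U (\<lambda>x y. a * k x y + b * h x y) (a * \<delta> + b * \<eta>)"
proof -
  obtain u v where uv: "u \<in> U" "v \<in> U" "\<And>f g. f \<in> nn_ball M \<Longrightarrow> g \<in> nn_ball M \<Longrightarrow>
     form M k f g \<le> ennreal \<delta> + (\<integral>\<^sup>+x. f x * v x \<partial>M) + (\<integral>\<^sup>+x. g x * u x \<partial>M)"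
    using \<delta> unfolding dominated_def by blast
  obtain u' v' where uv': "u' \<in> U" "v' \<in> U" "\<And>f g. f \<in> nn_ball M \<Longrightarrow> g \<in> nn_ball M \<Longrightarrow>
     form M h f g \<le> ennreal \<eta> + (\<integral>\<^sup>+x. f x * v' x \<partial>M) + (\<integral>\<^sup>+x. g x * u' x \<partial>M)"
    using \<delta> unfolding dominated_def by blast
  have [measurable]: "u \<in> borel_measurable M" "v \<in> borel_measurable M"
     "u' \<in> borel_measurable M" "v' \<in> borel_measurable M"
    using U uv uv' by (auto simp: nn_cone_def)
  have "form M (\<lambda>x y. a * k x y + b * h x y) f g \<le> ennreal (a * \<delta> + b * \<eta>)
     + (\<integral>\<^sup>+x. f x * (ennreal a * v x + ennreal b * v' x) \<partial>M)
     + (\<integral>\<^sup>+x. g x * (ennreal a * u x + ennreal b * u' x) \<partial>M)"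
    if f: "f \<in> nn_ball M" and g: "g \<in> nn_ball M" for f g
  proof -
    have [measurable]: "f \<in> borel_measurable M" "g \<in> borel_measurable M"
      using f g by (auto simp: nn_ball_def)
    have lin: "(\<integral>\<^sup>+x. f x * (ennreal a * v x + ennreal b * v' x) \<partial>M)
      = ennreal a * (\<integral>\<^sup>+x. f x * v x \<partial>M) + ennreal b * (\<integral>\<^sup>+x. f x * v' x \<partial>M)"
      if [measurable]: "f \<in> borel_measurable M" "v \<in> borel_measurable M" "v' \<in> borel_measurable M" for f v v'
    proof -
      have "f x * (ennreal a * v x + ennreal b * v' x) = ennreal a * (f x * v x) + ennreal b * (f x * v' x)"
        for x by (simp only: distrib_left mult.left_commute)
      then show ?thesis by (simp add: nn_integral_add nn_integral_cmult)
    qed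
    have "form M (\<lambda>x y. a * k x y + b * h x y) f g = ennreal a * form M k f g + ennreal b * form M h f g"
      using ab pos_kernelD[OF k] pos_kernelD[OF h] by (intro form_combine) auto
    also have "\<dots> \<le> ennreal a * (ennreal \<delta> + (\<integral>\<^sup>+x. f x * v x \<partial>M) + (\<integral>\<^sup>+x. g x * u x \<partial>M))
       + ennreal b * (ennreal \<eta> + (\<integral>\<^sup>+x. f x * v' x \<partial>M) + (\<integral>\<^sup>+x. g x * u' x \<partial>M))"
      by (intro add_mono mult_left_mono uv uv' f g) auto
    also have "\<dots> = ennreal (a * \<delta> + b * \<eta>)
     + (\<integral>\<^sup>+x. f x * (ennreal a * v x + ennreal b * v' x) \<partial>M)
     + (\<integral>\<^sup>+x. g x * (ennreal a * u x + ennreal b * u' x) \<partial>M)"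
    proof -
      have "ennreal (a * \<delta> + b * \<eta>) = ennreal a * ennreal \<delta> + ennreal b * ennreal \<eta>"
        using ab \<delta> by (simp add: dominated_def ennreal_mult)
      moreover have "(\<integral>\<^sup>+x. f x * (ennreal a * v x + ennreal b * v' x) \<partial>M)
          = ennreal a * (\<integral>\<^sup>+x. f x * v x \<partial>M) + ennreal b * (\<integral>\<^sup>+x. f x * v' x \<partial>M)"
        "(\<integral>\<^sup>+x. g x * (ennreal a * u x + ennreal b * u' x) \<partial>M)
          = ennreal a * (\<integral>\<^sup>+x. g x * u x \<partial>M) + ennreal b * (\<integral>\<^sup>+x. g x * u' x \<partial>M)"
        by (rule lin; measurable)+
      ultimately show ?thesis by (simp only: distrib_left ac_simps)
    qed
    finally show ?thesis .
  qed
  moreover have "(\<lambda>x. ennreal a * v x + ennreal b * v' x) \<in> U" "(\<lambda>x. ennreal a * u x + ennreal b * u' x) \<in> U"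
    using U uv uv' ab by (auto simp: nn_cone_def)
  ultimately show ?thesis using \<delta> ab unfolding dominated_def
    by (intro conjI bexI[of _ "\<lambda>x. ennreal a * v x + ennreal b * v' x"]
      bexI[of _ "\<lambda>x. ennreal a * u x + ennreal b * u' x"]) auto
qed

lemma kernel_size_combine:
  assumes k: "pos_kernel M k" and h: "pos_kernel M h" and U: "nn_cone M U" and ab: "0 \<le> a" "0 \<le> b"
  shows "kernel_size M U (\<lambda>x y. a * k x y + b * h x y) \<le> a * kernel_size M U k + b * kernel_size M U h"
proof -
  have "kernel_size M U (\<lambda>x y. a * k x y + b * h x y) \<le> b * kernel_size M U h + a * \<delta>"
    if "dominated M U k \<delta>" for \<delta>
    by (rule kernel_size_le_affine[OF h U])
      (use kernel_size_le[OF dominated_combine[OF k h U ab that]] ab in \<open>auto simp: add.commute\<close>)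
  then have "kernel_size M U (\<lambda>x y. a * k x y + b * h x y) \<le> a * kernel_size M U k + b * kernel_size M U h"
    by (intro kernel_size_le_affine[OF k U]) (use ab in \<open>auto simp: add.commute\<close>)
  then show ?thesis .
qed

lemma kernel_size_scale:
  assumes k: "pos_kernel M k" and U: "nn_cone M U" and "0 \<le> c"
  shows "kernel_size M U (\<lambda>x y. c * k x y) \<le> c * kernel_size M U k"
  using kernel_size_combine[OF k k U assms(3), of 0] by simp

text \<open>The symmetrised kernel lies below a convex combination of \<open>k\<close> and its transpose, and these have the
  same size.\<close>

lemma kernel_size_S2_le:
  assumes k: "pos_kernel M k" and U: "nn_cone M U" and ab: "0 \<le> a" "0 \<le> b" "a + b = 1"
  shows "kernel_size M U (S2 a b k) \<le> kernel_size M U k"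
proof -
  have "kernel_size M U (S2 a b k) \<le> kernel_size M U (\<lambda>x y. a * k x y + b * kernel_adjoint k x y)"
    by (intro kernel_size_mono pos_kernel_combine pos_kernel_adjoint k U ab)
      (auto simp: ae_le_def S2_le_mean[OF k ab])
  also have "\<dots> \<le> a * kernel_size M U k + b * kernel_size M U (kernel_adjoint k)"
    by (intro kernel_size_combine pos_kernel_adjoint k U ab)
  also have "\<dots> \<le> a * kernel_size M U k + b * kernel_size M U k"
    by (intro add_left_mono mult_left_mono kernel_size_adjoint k U ab)
  also have "\<dots> = kernel_size M U k" using ab by (simp flip: distrib_right)
  finally show ?thesis .
qed

lemma form_le_size:
  assumes k: "pos_kernel M k" and f: "f \<in> nn_ball M" and g: "g \<in> nn_ball M"
  shows "form M k f g \<le> ennreal (kernel_size M zero_cone k)"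
proof (rule ennreal_le_epsilon)
  fix e :: real assume "0 < e"
  obtain \<delta>\<^sub>0 where d0: "dominated M zero_cone k \<delta>\<^sub>0" using dominated_exists[OF k nn_cone_zero] by blast
  obtain \<delta> where "dominated M zero_cone k \<delta>" "\<delta> < kernel_size M zero_cone k + e"
    using kernel_size_approx[OF d0, of "kernel_size M zero_cone k + e"] \<open>0 < e\<close> by auto
  then have "form M k f g \<le> ennreal \<delta>" using f g by (auto simp: dominated_def zero_cone_def)
  also have "\<dots> \<le> ennreal (kernel_size M zero_cone k + e)"
    using \<open>\<delta> < _\<close> by (intro ennreal_leI) auto
  also have "\<dots> = ennreal (kernel_size M zero_cone k) + ennreal e"
    using \<open>0 < e\<close> pos_kernel_size_nonneg[OF k nn_cone_zero] by simp
  finally show "form M k f g \<le> ennreal (kernel_size M zero_cone k) + ennreal e" .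
qed

lemma kernel_size_zero_leI:
  assumes "0 \<le> c" "\<And>f g. f \<in> nn_ball M \<Longrightarrow> g \<in> nn_ball M \<Longrightarrow> form M k f g \<le> ennreal c"
  shows "kernel_size M zero_cone k \<le> c"
  using assms by (intro kernel_size_le) (auto simp: dominated_def zero_cone_def)

lemma kernel_size_comp:
  assumes k: "pos_kernel M k" and h: "pos_kernel M h"
  shows "kernel_size M zero_cone (kernel_comp M k h)
    \<le> kernel_size M zero_cone k * kernel_size M zero_cone h"
  by (intro kernel_size_zero_leI form_comp_le form_le_size k h mult_nonneg_nonneg
      pos_kernel_size_nonneg nn_cone_zero)

text \<open>The form evaluates a matrix entry on indicators of points, which lie in the unit ball.\<close>

lemma entry_le_size:
  assumes k: "pos_kernel M k" and d: "counting M" and xy: "x \<in> space M" "y \<in> space M"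
  shows "k x y \<le> kernel_size M zero_cone k"
proof -
  have ball: "indicator {z} \<in> nn_ball M" if z: "z \<in> space M" for z
  proof -
    have [measurable]: "{z} \<in> sets M" using sets_counting[OF d] z by auto
    have "(\<integral>\<^sup>+w. (indicator {z} w)\<^sup>2 \<partial>M) = (\<integral>\<^sup>+w. indicator {z} w \<partial>M)"
      by (intro nn_integral_cong) (auto simp: indicator_def)
    then show ?thesis using emeasure_counting[OF d z] by (simp add: nn_ball_def)
  qed
  have "ennreal (k x y) = ennreal (k x y) * indicator {y} y" by simp
  also have "\<dots> \<le> act M k (indicator {y}) x"
    unfolding act_def by (rule counting_le_nn_integral[OF d xy(2)])
  also have "\<dots> = act M k (indicator {y}) x * indicator {x} x" by simp
  also have "\<dots> \<le> form M k (indicator {y}) (indicator {x})"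
    unfolding form_def by (rule counting_le_nn_integral[OF d xy(1)])
  also have "\<dots> \<le> ennreal (kernel_size M zero_cone k)"
    by (intro form_le_size k ball xy)
  finally show ?thesis using pos_kernel_size_nonneg[OF k nn_cone_zero] by simp
qed

lemma ae_le_counting: "counting M \<Longrightarrow> ae_le M k h \<longleftrightarrow> (\<forall>x\<in>space M. \<forall>y\<in>space M. k x y \<le> h x y)"
  by (simp add: ae_le_def AE_counting)

lemma S2_le_scaled_S1:
  assumes k: "pos_kernel M k" and d: "counting M" and ab: "0 \<le> a" "0 \<le> b" "1 \<le> a + b"
    and m: "\<And>x y. x \<in> space M \<Longrightarrow> y \<in> space M \<Longrightarrow> k x y \<le> m"
  shows "ae_le M (S2 a b k) (\<lambda>x y. rpow m (a + b - 1) * S1 (a / (a + b)) k x y)"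
  unfolding ae_le_counting[OF d] by (intro ballI S2_le_S1 ab m pos_kernelD[OF k])

lemma pos_kernel_S1:
  assumes k: "pos_kernel M k" and "0 \<le> a" "a \<le> 1"
  shows "pos_kernel M (S1 a k)"
  unfolding S1_def using assms by (intro pos_kernel_S2) auto

lemma ratio_bounds: "0 \<le> a \<Longrightarrow> 0 \<le> b \<Longrightarrow> 1 \<le> a + b \<Longrightarrow> 0 \<le> a / (a + b) \<and> a / (a + b) \<le> (1::real)"
  by (auto simp: divide_le_eq)

lemma pos_kernel_S2_counting:
  assumes k: "pos_kernel M k" and ab: "0 \<le> a" "0 \<le> b"
    and H: "a + b = 1 \<or> (1 \<le> a + b \<and> counting M)"
  shows "pos_kernel M (S2 a b k)"
proof (cases "a + b = 1")
  case True
  then show ?thesis using pos_kernel_S2[OF k ab] by simp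
next
  case False
  then have d: "counting M" and s: "1 \<le> a + b" using H by auto
  let ?m = "kernel_size M zero_cone k"
  have m: "0 \<le> ?m" by (rule pos_kernel_size_nonneg[OF k nn_cone_zero])
  have S: "pos_kernel M (S1 (a / (a + b)) k)"
    using ratio_bounds[OF ab s] by (intro pos_kernel_S1 k) auto
  have "pos_kernel M (\<lambda>x y. rpow ?m (a + b - 1) * S1 (a / (a + b)) k x y + 0 * S1 (a / (a + b)) k x y)"
    by (intro pos_kernel_combine S) (use m in auto)
  then have *: "pos_kernel M (\<lambda>x y. rpow ?m (a + b - 1) * S1 (a / (a + b)) k x y)" by simp
  note [measurable] = pos_kernelD(1)[OF k]
  show ?thesis
    by (rule pos_kernel_mono[OF * _ _ S2_le_scaled_S1[OF k d ab s]])
      (use entry_le_size[OF k d] pos_kernelD(2)[OF k] in \<open>auto simp: S2_eq\<close>)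
qed

text \<open>The entries are at most the norm \<open>m\<close>, so the kernel is at most \<open>m\<close> to the power \<open>a + b - 1\<close> times a
  symmetrised kernel with exponents of sum \<open>1\<close>, whose norm is at most \<open>m\<close>.\<close>

lemma kernel_size_S2_counting:
  assumes k: "pos_kernel M k" and d: "counting M" and ab: "0 \<le> a" "0 \<le> b" and s: "1 \<le> a + b"
  shows "kernel_size M zero_cone (S2 a b k) \<le> kernel_size M zero_cone k powr (a + b)"
proof -
  let ?m = "kernel_size M zero_cone k"
  have m: "0 \<le> ?m" by (rule pos_kernel_size_nonneg[OF k nn_cone_zero])
  have r: "0 \<le> a / (a + b)" "0 \<le> 1 - a / (a + b)" using ratio_bounds[OF ab s] by auto
  have S: "pos_kernel M (S1 (a / (a + b)) k)"
    using ratio_bounds[OF ab s] by (intro pos_kernel_S1 k) auto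
  have "pos_kernel M (\<lambda>x y. rpow ?m (a + b - 1) * S1 (a / (a + b)) k x y + 0 * S1 (a / (a + b)) k x y)"
    by (intro pos_kernel_combine S) (use m in auto)
  then have "kernel_size M zero_cone (S2 a b k)
     \<le> kernel_size M zero_cone (\<lambda>x y. rpow ?m (a + b - 1) * S1 (a / (a + b)) k x y)"
    by (intro kernel_size_mono nn_cone_zero S2_le_scaled_S1 k d ab s entry_le_size) auto
  also have "\<dots> \<le> rpow ?m (a + b - 1) * kernel_size M zero_cone (S1 (a / (a + b)) k)"
    using m by (intro kernel_size_scale S nn_cone_zero) auto
  also have "\<dots> \<le> rpow ?m (a + b - 1) * ?m"
    using m kernel_size_S2_le[OF k nn_cone_zero r] by (intro mult_left_mono) (auto simp: S1_def)
  also have "\<dots> = ?m powr (a + b)"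
  proof (cases "?m = 0")
    case False
    have "?m powr (a + b - 1 + 1) = ?m powr (a + b - 1) * ?m powr 1" by (rule powr_add)
    then show ?thesis using False m by (simp add: rpow_def)
  qed simp
  finally show ?thesis .
qed

end

section \<open>Growth rates\<close>

text \<open>All comparisons of radii use only that the radius is the growth rate of the sizes of the powers.\<close>

locale kernel_radius = sigma_finite_measure M for M :: "'a measure" +
  fixes U :: "('a \<Rightarrow> ennreal) set" and \<rho> :: "'a kernel \<Rightarrow> real"
  assumes cone: "nn_cone M U"
    and radius_limit: "pos_kernel M k \<Longrightarrow>
      (\<lambda>j. root j (kernel_size M U (kernel_power M k j))) \<longlonglongrightarrow> \<rho> k"
begin

lemma size_power_nonneg: "pos_kernel M k \<Longrightarrow> 0 \<le> kernel_size M U (kernel_power M k j)"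
  by (intro pos_kernel_size_nonneg pos_kernel_power cone)

lemma radius_nonneg:
  assumes "pos_kernel M k"
  shows "0 \<le> \<rho> k"
  by (rule LIMSEQ_le_const[OF radius_limit[OF assms]])
    (use size_power_nonneg[OF assms] in \<open>auto intro!: exI[of _ 1]\<close>)

lemma radius_le_of_size:
  assumes k: "pos_kernel M k" and lim: "b \<longlonglongrightarrow> L"
    and "\<And>j. 1 \<le> j \<Longrightarrow> root j (kernel_size M U (kernel_power M k j)) \<le> b j"
  shows "\<rho> k \<le> L"
  by (rule LIMSEQ_le[OF radius_limit[OF k] lim]) (use assms(3) in \<open>auto intro!: exI[of _ 1]\<close>)

lemma radius_mono:
  assumes k: "pos_kernel M k" and h: "pos_kernel M h" and "ae_le M k h"
  shows "\<rho> k \<le> \<rho> h"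
proof (rule radius_le_of_size[OF k radius_limit[OF h]])
  fix j :: nat assume "1 \<le> j"
  have "kernel_size M U (kernel_power M k j) \<le> kernel_size M U (kernel_power M h j)"
    by (intro kernel_size_mono pos_kernel_power kernel_power_mono cone assms)
  then show "root j (kernel_size M U (kernel_power M k j)) \<le> root j (kernel_size M U (kernel_power M h j))"
    using \<open>1 \<le> j\<close> by simp
qed

lemma radius_cong: "pos_kernel M k \<Longrightarrow> pos_kernel M h \<Longrightarrow> ae_eq M k h \<Longrightarrow> \<rho> k = \<rho> h"
  by (intro antisym radius_mono ae_eq_imp_le) (auto intro: ae_eq_sym)

lemma radius_scale_le:
  assumes k: "pos_kernel M k" and ck: "pos_kernel M (\<lambda>x y. c * k x y)" and c: "0 \<le> c"
  shows "\<rho> (\<lambda>x y. c * k x y) \<le> c * \<rho> k"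
proof (rule radius_le_of_size[OF ck])
  show "(\<lambda>j. c * root j (kernel_size M U (kernel_power M k j))) \<longlonglongrightarrow> c * \<rho> k"
    by (intro tendsto_mult tendsto_const radius_limit k)
  fix j :: nat assume j: "1 \<le> j"
  have "kernel_size M U (kernel_power M (\<lambda>x y. c * k x y) j) \<le> c ^ j * kernel_size M U (kernel_power M k j)"
    unfolding kernel_power_scale[OF j] using c
    by (intro kernel_size_scale pos_kernel_power k cone) auto
  then have "root j (kernel_size M U (kernel_power M (\<lambda>x y. c * k x y) j))
      \<le> root j (c ^ j * kernel_size M U (kernel_power M k j))"
    using j by simp
  also have "\<dots> = c * root j (kernel_size M U (kernel_power M k j))"
    using j c by (simp add: real_root_mult real_root_power_cancel)
  finally show "root j (kernel_size M U (kernel_power M (\<lambda>x y. c * k x y) j))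
      \<le> c * root j (kernel_size M U (kernel_power M k j))" .
qed

text \<open>The powers of \<open>kernel_power M k p\<close> are a subsequence of the powers of \<open>k\<close>.\<close>

lemma radius_power:
  assumes k: "pos_kernel M k" and p: "1 \<le> p"
  shows "\<rho> (kernel_power M k p) = \<rho> k ^ p"
proof -
  let ?s = "\<lambda>j. kernel_size M U (kernel_power M k j)"
  have "strict_mono (\<lambda>j. p * j)" using p by (intro strict_monoI) simp
  then have "(\<lambda>j. root (p * j) (?s (p * j))) \<longlonglongrightarrow> \<rho> k"
    using LIMSEQ_subseq_LIMSEQ[OF radius_limit[OF k]] by (simp add: o_def)
  then have "(\<lambda>j. root (p * j) (?s (p * j)) ^ p) \<longlonglongrightarrow> \<rho> k ^ p"
    by (rule tendsto_power)
  moreover have "\<forall>\<^sub>F j in sequentially. root (p * j) (?s (p * j)) ^ p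
      = root j (kernel_size M U (kernel_power M (kernel_power M k p) j))"
  proof (rule eventually_sequentiallyI[of 1])
    fix j :: nat assume j: "1 \<le> j"
    have eq: "ae_eq M (kernel_power M (kernel_power M k p) j) (kernel_power M k (p * j))"
      by (rule kernel_power_mult[OF k p j])
    have "kernel_size M U (kernel_power M (kernel_power M k p) j) = ?s (p * j)"
      by (intro antisym kernel_size_mono ae_eq_imp_le eq ae_eq_sym[OF eq] pos_kernel_power k cone)
    moreover have "root (p * j) (?s (p * j)) ^ p = root j (?s (p * j))"
      using p j size_power_nonneg[OF k] by (simp add: real_root_mult_exp real_root_pow_pos2)
    ultimately show "root (p * j) (?s (p * j)) ^ p
      = root j (kernel_size M U (kernel_power M (kernel_power M k p) j))" by simp
  qed
  ultimately have "(\<lambda>j. root j (kernel_size M U (kernel_power M (kernel_power M k p) j))) \<longlonglongrightarrow> \<rho> k ^ p"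
    by (rule Lim_transform_eventually)
  then show ?thesis
    using radius_limit[OF pos_kernel_power[OF k]] by (rule LIMSEQ_unique[symmetric])
qed

lemma radius_S2_le:
  assumes k: "pos_kernel M k" and ab: "0 \<le> a" "0 \<le> b" "a + b = 1"
  shows "\<rho> (S2 a b k) \<le> \<rho> k"
proof (rule radius_le_of_size[OF pos_kernel_S2[OF k ab] radius_limit[OF k]])
  fix j :: nat assume j: "1 \<le> j"
  have "kernel_size M U (kernel_power M (S2 a b k) j) \<le> kernel_size M U (S2 a b (kernel_power M k j))"
    by (intro kernel_size_mono pos_kernel_S2 S2_power_le pos_kernel_power k ab cone j)
      (use ab in auto)
  also have "\<dots> \<le> kernel_size M U (kernel_power M k j)"
    by (intro kernel_size_S2_le pos_kernel_power k ab cone)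
  finally show "root j (kernel_size M U (kernel_power M (S2 a b k) j))
      \<le> root j (kernel_size M U (kernel_power M k j))" using j by simp
qed

lemma radius_S2_square_le:
  assumes k: "pos_kernel M k" and ab: "0 \<le> a" "0 \<le> b" "a + b = 1 \<or> (1 \<le> a + b \<and> counting M)"
  shows "\<rho> (S2 a b k) ^ 2 \<le> \<rho> (S2 a b (kernel_comp M k k))"
proof -
  note S = pos_kernel_S2_counting[OF _ ab]
  have "\<rho> (S2 a b k) ^ 2 = \<rho> (kernel_power M (S2 a b k) (Suc 1))"
    using radius_power[OF S[OF k], of 2] by (simp add: numeral_2_eq_2)
  also have "\<dots> = \<rho> (kernel_comp M (S2 a b k) (S2 a b k))"
    by (subst kernel_power_Suc) auto
  also have "\<dots> \<le> \<rho> (S2 a b (kernel_comp M k k))"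
    by (intro radius_mono S pos_kernel_comp S2_square_le k ab)
  finally show ?thesis .
qed

definition sym_radius :: "real \<Rightarrow> real \<Rightarrow> 'a kernel \<Rightarrow> nat \<Rightarrow> real" where
  "sym_radius a b k m = \<rho> (S2 a b (kernel_power M k (2 ^ m))) powr (1 / 2 ^ m)"

lemma power_powr_inverse: "0 \<le> x \<Longrightarrow> 0 < n \<Longrightarrow> (x ^ n) powr (1 / real n) = (x::real)"
  by (cases "x = 0") (auto simp: powr_powr simp flip: powr_realpow)

lemma sym_radius_0: "pos_kernel M (S2 a b k) \<Longrightarrow> sym_radius a b k 0 = \<rho> (S2 a b k)"
  using radius_nonneg by (simp add: sym_radius_def)

lemma sym_radius_Suc:
  assumes k: "pos_kernel M k" and ab: "0 \<le> a" "0 \<le> b" "a + b = 1 \<or> (1 \<le> a + b \<and> counting M)"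
  shows "sym_radius a b k m \<le> sym_radius a b k (Suc m)"
proof -
  note S = pos_kernel_S2_counting[OF _ ab]
  let ?p = "kernel_power M k"
  let ?x = "\<rho> (S2 a b (?p (2 ^ m)))"
  have x: "0 \<le> ?x" by (intro radius_nonneg S pos_kernel_power k)
  have "ae_eq M (kernel_comp M (?p (2 ^ m)) (?p (2 ^ m))) (?p (2 ^ m + 2 ^ m))"
    by (intro ae_eq_sym[OF kernel_power_add] k) auto
  then have "ae_eq M (kernel_comp M (?p (2 ^ m)) (?p (2 ^ m))) (?p (2 ^ Suc m))"
    by (simp add: mult_2)
  then have "ae_eq M (S2 a b (kernel_comp M (?p (2 ^ m)) (?p (2 ^ m)))) (S2 a b (?p (2 ^ Suc m)))"
    by (intro S2_cong pos_kernel_comp pos_kernel_power k ab(1,2))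
  then have "\<rho> (S2 a b (kernel_comp M (?p (2 ^ m)) (?p (2 ^ m)))) = \<rho> (S2 a b (?p (2 ^ Suc m)))"
    by (intro radius_cong S pos_kernel_comp pos_kernel_power k)
  then have le: "?x ^ 2 \<le> \<rho> (S2 a b (?p (2 ^ Suc m)))"
    using radius_S2_square_le[OF pos_kernel_power[OF k] ab, of "2 ^ m"] by simp
  have "sym_radius a b k m = ((?x ^ 2) powr (1 / 2)) powr (1 / 2 ^ m)"
  proof -
    have "(?x ^ 2) powr (1 / 2) = ?x" using x by (simp add: powr_half_sqrt)
    then show ?thesis by (simp only: sym_radius_def)
  qed
  also have "\<dots> = (?x ^ 2) powr (1 / 2 ^ Suc m)" by (simp only: powr_powr) simp
  also have "\<dots> \<le> sym_radius a b k (Suc m)"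
    unfolding sym_radius_def using le by (intro powr_mono2) auto
  finally show ?thesis .
qed

lemma powr_le_radius:
  assumes k: "pos_kernel M k" and x: "0 \<le> x" "x \<le> \<rho> (kernel_power M k (2 ^ n))"
  shows "x powr (1 / 2 ^ n) \<le> \<rho> k"
proof -
  have "x powr (1 / 2 ^ n) \<le> (\<rho> k ^ 2 ^ n) powr (1 / 2 ^ n)"
    using x radius_power[OF k, of "2 ^ n"] by (intro powr_mono2) auto
  also have "\<dots> = \<rho> k"
    using power_powr_inverse[OF radius_nonneg[OF k], of "2 ^ n"] by simp
  finally show ?thesis .
qed

lemma sym_radius_le:
  assumes k: "pos_kernel M k" and ab: "0 \<le> a" "0 \<le> b" "a + b = 1"
  shows "sym_radius a b k n \<le> \<rho> k"
  unfolding sym_radius_def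
  by (intro powr_le_radius k radius_nonneg pos_kernel_S2 radius_S2_le pos_kernel_power ab)

lemma sym_radius_le_scaled:
  assumes k: "pos_kernel M k" and d: "counting M" and ab: "0 \<le> a" "0 \<le> b" "1 \<le> a + b"
    and m: "0 \<le> m" "\<And>x y. x \<in> space M \<Longrightarrow> y \<in> space M \<Longrightarrow> kernel_power M k (2 ^ n) x y \<le> m"
  shows "sym_radius a b k n \<le> rpow m ((a + b - 1) / 2 ^ n)
    * \<rho> (S1 (a / (a + b)) (kernel_power M k (2 ^ n))) powr (1 / 2 ^ n)"
proof -
  let ?h = "kernel_power M k (2 ^ n)" and ?c = "rpow m (a + b - 1)"
  have h: "pos_kernel M ?h" by (intro pos_kernel_power k)
  have S1: "pos_kernel M (S1 (a / (a + b)) ?h)"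
    using ratio_bounds[OF ab] by (intro pos_kernel_S1 h) auto
  have "pos_kernel M (\<lambda>x y. ?c * S1 (a / (a + b)) ?h x y + 0 * S1 (a / (a + b)) ?h x y)"
    by (intro pos_kernel_combine S1) (use m in auto)
  then have cS: "pos_kernel M (\<lambda>x y. ?c * S1 (a / (a + b)) ?h x y)" by simp
  have S2: "pos_kernel M (S2 a b ?h)" using ab d by (intro pos_kernel_S2_counting h) auto
  have "\<rho> (S2 a b ?h) \<le> \<rho> (\<lambda>x y. ?c * S1 (a / (a + b)) ?h x y)"
    by (rule radius_mono[OF S2 cS S2_le_scaled_S1[OF h d ab m(2)]])
  also have "\<dots> \<le> ?c * \<rho> (S1 (a / (a + b)) ?h)"
    by (intro radius_scale_le S1 cS) (use m in auto)
  finally have "sym_radius a b k n \<le> (?c * \<rho> (S1 (a / (a + b)) ?h)) powr (1 / 2 ^ n)"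
    unfolding sym_radius_def using radius_nonneg[OF S2] by (intro powr_mono2) auto
  also have "\<dots> = ?c powr (1 / 2 ^ n) * \<rho> (S1 (a / (a + b)) ?h) powr (1 / 2 ^ n)"
    by (rule powr_mult)
  also have "?c powr (1 / 2 ^ n) = rpow m ((a + b - 1) / 2 ^ n)"
    by (auto simp: rpow_def powr_powr)
  finally show ?thesis .
qed

lemma scaled_sym_radius_le:
  assumes k: "pos_kernel M k" and ab: "0 \<le> a" "0 \<le> b" "1 \<le> a + b"
  shows "\<rho> (S1 (a / (a + b)) (kernel_power M k (2 ^ n))) powr (1 / 2 ^ n) \<le> \<rho> k"
  using sym_radius_le[OF k, of "a / (a + b)" "1 - a / (a + b)" n] ratio_bounds[OF ab]
  by (simp add: sym_radius_def S1_def)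

lemma sym_radius_le_powr:
  assumes U: "U = zero_cone"
    and k: "pos_kernel M k" and d: "counting M" and ab: "0 \<le> a" "0 \<le> b" "1 \<le> a + b"
  shows "sym_radius a b k n \<le> \<rho> k powr (a + b)"
proof -
  have H: "a + b = 1 \<or> (1 \<le> a + b \<and> counting M)" using ab d by simp
  note S = pos_kernel_S2_counting[OF _ ab(1,2) H]
  have main: "\<rho> (S2 a b h) \<le> \<rho> h powr (a + b)" if h: "pos_kernel M h" for h
  proof (rule radius_le_of_size[OF S[OF h]])
    show "(\<lambda>j. root j (kernel_size M U (kernel_power M h j)) powr (a + b)) \<longlonglongrightarrow> \<rho> h powr (a + b)"
      by (rule tendsto_powr'[OF radius_limit[OF h] tendsto_const]) 
        (use ab size_power_nonneg[OF h] in \<open>auto intro!: always_eventually real_root_ge_zero\<close>)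
    fix j :: nat assume j: "1 \<le> j"
    let ?s = "kernel_size M U (kernel_power M h j)"
    have "kernel_size M U (kernel_power M (S2 a b h) j) \<le> kernel_size M U (S2 a b (kernel_power M h j))"
      by (intro kernel_size_mono S S2_power_le pos_kernel_power h ab cone j H)
    also have "\<dots> \<le> ?s powr (a + b)"
      unfolding U by (intro kernel_size_S2_counting pos_kernel_power h d ab)
    finally have "root j (kernel_size M U (kernel_power M (S2 a b h) j)) \<le> root j (?s powr (a + b))"
      using j by simp
    also have "\<dots> = root j ?s powr (a + b)"
      using j size_power_nonneg[OF h, of j] by (simp add: root_powr_inverse powr_powr mult.commute)
    finally show "root j (kernel_size M U (kernel_power M (S2 a b h) j)) \<le> root j ?s powr (a + b)" .
  qed
  let ?h = "kernel_power M k (2 ^ n)"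
  have "sym_radius a b k n \<le> (\<rho> ?h powr (a + b)) powr (1 / 2 ^ n)"
    unfolding sym_radius_def
    by (intro powr_mono2 main pos_kernel_power k radius_nonneg S) auto
  also have "\<dots> = (\<rho> ?h powr (1 / 2 ^ n)) powr (a + b)"
    by (simp add: powr_powr mult.commute)
  also have "\<dots> \<le> \<rho> k powr (a + b)"
    using ab by (intro powr_mono2 powr_le_radius k radius_nonneg pos_kernel_power) auto
  finally show ?thesis .
qed

end

section \<open>The space of square integrable functions\<close>

lemma L2_iff: "f \<in> L2 M \<longleftrightarrow> f \<in> borel_measurable M \<and> (\<integral>\<^sup>+x. (ennreal (norm (f x)))\<^sup>2 \<partial>M) < \<infinity>"
  by (auto simp: L2_def integrable_iff_bounded ennreal_power)

lemma L2_measurable [measurable_dest]: "f \<in> L2 M \<Longrightarrow> f \<in> borel_measurable M"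
  by (simp add: L2_def)

lemma L2_norm_nonneg [simp]: "0 \<le> L2_norm M f"
  by (simp add: L2_norm_def)

lemma L2_norm_nn:
  assumes "f \<in> L2 M"
  shows "(\<integral>\<^sup>+x. (ennreal (norm (f x)))\<^sup>2 \<partial>M) = ennreal ((L2_norm M f)\<^sup>2)"
proof -
  have "(\<integral>\<^sup>+x. (ennreal (norm (f x)))\<^sup>2 \<partial>M) = (\<integral>\<^sup>+x. ennreal ((norm (f x))\<^sup>2) \<partial>M)"
    by (simp add: ennreal_power)
  also have "\<dots> = ennreal (LINT x|M. (norm (f x))\<^sup>2)"
    using assms by (intro nn_integral_eq_integral) (auto simp: L2_def)
  finally show ?thesis by (simp add: L2_norm_def)
qed

lemma L2_norm_le_iff:
  assumes "f \<in> L2 M" "0 \<le> c"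
  shows "L2_norm M f \<le> c \<longleftrightarrow> (\<integral>\<^sup>+x. (ennreal (norm (f x)))\<^sup>2 \<partial>M) \<le> ennreal (c\<^sup>2)"
  using assms by (simp add: L2_norm_nn)

lemma L2I:
  assumes "f \<in> borel_measurable M" "(\<integral>\<^sup>+x. (ennreal (norm (f x)))\<^sup>2 \<partial>M) \<le> ennreal (c\<^sup>2)" "0 \<le> c"
  shows "f \<in> L2 M" "L2_norm M f \<le> c"
proof -
  show "f \<in> L2 M" using assms by (simp add: L2_iff le_less_trans)
  then show "L2_norm M f \<le> c" using assms by (simp add: L2_norm_le_iff)
qed

lemma
  assumes f: "f \<in> L2 M" and g: "g \<in> L2 M"
  shows L2_add: "(\<lambda>x. f x + g x) \<in> L2 M"
    and L2_norm_add: "L2_norm M (\<lambda>x. f x + g x) \<le> L2_norm M f + L2_norm M g"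
proof -
  note [measurable] = f g
  have "(\<integral>\<^sup>+x. (ennreal (norm (f x + g x)))\<^sup>2 \<partial>M) \<le> (\<integral>\<^sup>+x. (ennreal (norm (f x)) + ennreal (norm (g x)))\<^sup>2 \<partial>M)"
    by (intro nn_integral_mono power_mono) (simp_all add: norm_triangle_ineq flip: ennreal_plus)
  also have "\<dots> \<le> ennreal ((L2_norm M f + L2_norm M g)\<^sup>2)"
    by (intro nn_minkowski) (auto simp: L2_norm_nn f g)
  finally have *: "(\<integral>\<^sup>+x. (ennreal (norm (f x + g x)))\<^sup>2 \<partial>M) \<le> ennreal ((L2_norm M f + L2_norm M g)\<^sup>2)" .
  show "(\<lambda>x. f x + g x) \<in> L2 M" "L2_norm M (\<lambda>x. f x + g x) \<le> L2_norm M f + L2_norm M g"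
    by (rule L2I[OF _ *]; auto)+
qed

lemma
  assumes f: "f \<in> L2 M"
  shows L2_scale: "(\<lambda>x. c * f x) \<in> L2 M"
    and L2_norm_scale: "L2_norm M (\<lambda>x. c * f x) = norm c * L2_norm M f"
proof -
  show "(\<lambda>x. c * f x) \<in> L2 M" using f by (auto simp: L2_def norm_mult power_mult_distrib)
  show "L2_norm M (\<lambda>x. c * f x) = norm c * L2_norm M f"
    by (simp add: L2_norm_def norm_mult power_mult_distrib real_sqrt_mult)
qed

lemma L2_zero [simp]: "(\<lambda>_. 0) \<in> L2 M" "L2_norm M (\<lambda>_. 0) = 0"
  by (auto simp: L2_def L2_norm_def)

lemma L2_diff: "f \<in> L2 M \<Longrightarrow> g \<in> L2 M \<Longrightarrow> (\<lambda>x. f x - g x) \<in> L2 M"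
  using L2_add[OF _ L2_scale[of g M "-1"], of f] by simp

lemma L2_norm_diff:
  "f \<in> L2 M \<Longrightarrow> g \<in> L2 M \<Longrightarrow> L2_norm M (\<lambda>x. f x - g x) \<le> L2_norm M f + L2_norm M g"
  using L2_norm_add[OF _ L2_scale[of g M "-1"], of f] L2_norm_scale[of g M "-1"] by simp

lemma L2_sum: "(\<And>i. i \<in> I \<Longrightarrow> f i \<in> L2 M) \<Longrightarrow> (\<lambda>x. \<Sum>i\<in>I. f i x) \<in> L2 M"
  by (induction I rule: infinite_finite_induct) (auto intro: L2_add)

lemma L2_norm_mono_AE:
  assumes "f \<in> L2 M" "g \<in> L2 M" "AE x in M. norm (f x) \<le> norm (g x)"
  shows "L2_norm M f \<le> L2_norm M g"
proof -
  have "(\<integral>\<^sup>+x. (ennreal (norm (f x)))\<^sup>2 \<partial>M) \<le> (\<integral>\<^sup>+x. (ennreal (norm (g x)))\<^sup>2 \<partial>M)"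
    by (rule nn_integral_mono_AE) (use assms(3) in \<open>auto elim!: eventually_mono intro!: power_mono ennreal_leI\<close>)
  then show ?thesis using assms by (simp add: L2_norm_nn)
qed

lemma L2_norm_cong_AE:
  "f \<in> L2 M \<Longrightarrow> g \<in> L2 M \<Longrightarrow> AE x in M. f x = g x \<Longrightarrow> L2_norm M f = L2_norm M g"
  by (intro antisym L2_norm_mono_AE) (auto elim!: eventually_mono)

lemma L2_norm_eq_0:
  assumes "f \<in> L2 M" "L2_norm M f = 0"
  shows "AE x in M. f x = 0"
proof -
  have "AE x in M. ennreal (norm (f x)) = 0"
    by (rule nn_zero_norm) (use assms in \<open>auto simp: L2_norm_nn\<close>)
  then show ?thesis by (auto elim!: eventually_mono)
qed

section \<open>Bounded operators\<close>

lemma bounded_operatorD: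
  assumes "bounded_operator M T"
  shows "f \<in> L2 M \<Longrightarrow> T f \<in> L2 M"
    and "f \<in> L2 M \<Longrightarrow> g \<in> L2 M \<Longrightarrow> AE x in M. T (\<lambda>y. a * f y + g y) x = a * T f x + T g x"
  using assms by (auto simp: bounded_operator_def)

lemma bounded_operator_bound:
  assumes "bounded_operator M T"
  obtains C where "0 < C" "\<And>f. f \<in> L2 M \<Longrightarrow> L2_norm M (T f) \<le> C * L2_norm M f"
proof -
  obtain C where C: "\<And>f. f \<in> L2 M \<Longrightarrow> L2_norm M (T f) \<le> C * L2_norm M f"
    using assms unfolding bounded_operator_def by blast
  have "L2_norm M (T f) \<le> (\<bar>C\<bar> + 1) * L2_norm M f" if "f \<in> L2 M" for f
    by (rule order_trans[OF C[OF that]]) (intro mult_right_mono, auto)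
  moreover have "0 < \<bar>C\<bar> + 1" by simp
  ultimately show ?thesis using that by blast
qed

lemma bounded_operator_diff:
  assumes T: "bounded_operator M T" and f: "f \<in> L2 M" and g: "g \<in> L2 M"
  shows "AE x in M. T (\<lambda>y. f y - g y) x = T f x - T g x"
  using bounded_operatorD(2)[OF T g f, of "-1"] by simp

lemma bounded_operator_add:
  assumes T: "bounded_operator M T" and f: "f \<in> L2 M" and g: "g \<in> L2 M"
  shows "AE x in M. T (\<lambda>y. f y + g y) x = T f x + T g x"
  using bounded_operatorD(2)[OF T f g, of 1] by simp

text \<open>Boundedness annihilates functions of norm \<open>0\<close>, so the values depend on classes modulo null sets only.\<close>

lemma bounded_operator_cong:
  assumes T: "bounded_operator M T" and f: "f \<in> L2 M" and g: "g \<in> L2 M"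
    and "AE x in M. f x = g x"
  shows "AE x in M. T f x = T g x"
proof -
  obtain C where C: "0 < C" "\<And>f. f \<in> L2 M \<Longrightarrow> L2_norm M (T f) \<le> C * L2_norm M f"
    using bounded_operator_bound[OF T] by blast
  have d: "(\<lambda>y. f y - g y) \<in> L2 M" by (rule L2_diff[OF f g])
  have "L2_norm M (\<lambda>y. f y - g y) = L2_norm M (\<lambda>_. 0)"
    by (rule L2_norm_cong_AE[OF d]) (use assms(4) in auto)
  then have "L2_norm M (T (\<lambda>y. f y - g y)) = 0"
    using C(2)[OF d] L2_norm_nonneg[of M "T (\<lambda>y. f y - g y)"] by simp
  then have "AE x in M. T (\<lambda>y. f y - g y) x = 0"
    by (intro L2_norm_eq_0 bounded_operatorD(1)[OF T] d)
  with bounded_operator_diff[OF T f g] show ?thesis by eventually_elim simp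
qed

lemma bounded_operator_zero:
  assumes T: "bounded_operator M T"
  shows "AE x in M. T (\<lambda>_. 0) x = 0"
  using bounded_operator_diff[OF T L2_zero(1) L2_zero(1)] by simp

lemma bounded_operator_scale:
  assumes T: "bounded_operator M T" and f: "f \<in> L2 M"
  shows "AE x in M. T (\<lambda>y. a * f y) x = a * T f x"
  using bounded_operatorD(2)[OF T f L2_zero(1), of a] bounded_operator_zero[OF T]
  by eventually_elim simp

lemma bounded_operator_sum:
  assumes T: "bounded_operator M T" and f: "\<And>i::nat. f i \<in> L2 M"
  shows "AE x in M. T (\<lambda>y. \<Sum>i<n. f i y) x = (\<Sum>i<n. T (f i) x)"
proof (induction n)
  case 0
  then show ?case using bounded_operator_zero[OF T] by simp
next
  case (Suc n)
  have "(\<lambda>y. \<Sum>i<n. f i y) \<in> L2 M" by (intro L2_sum f)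
  from bounded_operator_add[OF T this f[of n]] Suc
  have "AE x in M. T (\<lambda>y. (\<Sum>i<n. f i y) + f n y) x = (\<Sum>i<n. T (f i) x) + T (f n) x"
    by eventually_elim simp
  then show ?case by simp
qed

lemma bounded_operator_compose:
  assumes T: "bounded_operator M T" and S: "bounded_operator M S"
  shows "bounded_operator M (T \<circ> S)"
  unfolding bounded_operator_def
proof (intro conjI ballI allI)
  fix f assume f: "f \<in> L2 M"
  then show "(T \<circ> S) f \<in> L2 M" using bounded_operatorD(1)[OF T] bounded_operatorD(1)[OF S] by simp
  fix g a assume g: "g \<in> L2 M"
  have fg: "(\<lambda>y. a * f y + g y) \<in> L2 M" "(\<lambda>y. a * S f y + S g y) \<in> L2 M"
    by (intro L2_add L2_scale f g bounded_operatorD(1)[OF S])+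
  have "AE x in M. T (S (\<lambda>y. a * f y + g y)) x = T (\<lambda>y. a * S f y + S g y) x"
    by (rule bounded_operator_cong[OF T bounded_operatorD(1)[OF S fg(1)] fg(2) bounded_operatorD(2)[OF S f g]])
  moreover have "AE x in M. T (\<lambda>y. a * S f y + S g y) x = a * T (S f) x + T (S g) x"
    by (rule bounded_operatorD(2)[OF T bounded_operatorD(1)[OF S f] bounded_operatorD(1)[OF S g]])
  ultimately show "AE x in M. (T \<circ> S) (\<lambda>y. a * f y + g y) x = a * (T \<circ> S) f x + (T \<circ> S) g x"
    by eventually_elim simp
next
  obtain C where C: "0 < C" "\<And>f. f \<in> L2 M \<Longrightarrow> L2_norm M (T f) \<le> C * L2_norm M f"
    using bounded_operator_bound[OF T] by blast
  obtain D where D: "0 < D" "\<And>f. f \<in> L2 M \<Longrightarrow> L2_norm M (S f) \<le> D * L2_norm M f"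
    using bounded_operator_bound[OF S] by blast
  have "L2_norm M ((T \<circ> S) f) \<le> (C * D) * L2_norm M f" if f: "f \<in> L2 M" for f
  proof -
    have "L2_norm M (T (S f)) \<le> C * L2_norm M (S f)" by (intro C bounded_operatorD(1)[OF S] f)
    also have "\<dots> \<le> C * (D * L2_norm M f)" using C D f by (intro mult_left_mono) auto
    finally show ?thesis by (simp add: mult.assoc)
  qed
  then show "\<exists>C. \<forall>f\<in>L2 M. L2_norm M ((T \<circ> S) f) \<le> C * L2_norm M f" by blast
qed

lemma bounded_operator_id: "bounded_operator M id"
  by (auto simp: bounded_operator_def intro!: exI[of _ 1])

lemma bounded_operator_funpow: "bounded_operator M T \<Longrightarrow> bounded_operator M (T ^^ n)"
proof (induction n)
  case 0
  then show ?case using bounded_operator_id[of M] by (simp add: id_def)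
next
  case (Suc n)
  then show ?case using bounded_operator_compose[of M T "T ^^ n"] by (simp only: funpow.simps)
qed

lemma spectrum_cong_subset:
  assumes T: "\<And>f. f \<in> L2 M \<Longrightarrow> T f \<in> L2 M" "\<And>f. f \<in> L2 M \<Longrightarrow> T' f \<in> L2 M"
    and eq: "\<And>f. f \<in> L2 M \<Longrightarrow> AE x in M. T f x = T' f x"
  shows "spectrum M T' \<subseteq> spectrum M T"
proof (rule ccontr)
  assume "\<not> spectrum M T' \<subseteq> spectrum M T"
  then obtain z where z: "z \<in> spectrum M T'" "z \<notin> spectrum M T" by blast
  then obtain S where S: "bounded_operator M S"
    "\<And>f. f \<in> L2 M \<Longrightarrow> AE x in M. S (\<lambda>y. z * f y - T f y) x = f x"
    "\<And>f. f \<in> L2 M \<Longrightarrow> AE x in M. z * S f x - T (S f) x = f x"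
    unfolding spectrum_def by auto
  have "AE x in M. S (\<lambda>y. z * f y - T' f y) x = f x" if f: "f \<in> L2 M" for f
  proof -
    have "AE x in M. S (\<lambda>y. z * f y - T f y) x = S (\<lambda>y. z * f y - T' f y) x"
      by (intro bounded_operator_cong[OF S(1)] L2_diff L2_scale f T) (use eq[OF f] in auto)
    with S(2)[OF f] show ?thesis by eventually_elim simp
  qed
  moreover have "AE x in M. z * S f x - T' (S f) x = f x" if f: "f \<in> L2 M" for f
    using S(3)[OF f] eq[OF bounded_operatorD(1)[OF S(1) f]] by eventually_elim simp
  ultimately show False using z(1) S(1) unfolding spectrum_def by blast
qed

lemma spectrum_cong:
  assumes T: "\<And>f. f \<in> L2 M \<Longrightarrow> T f \<in> L2 M" "\<And>f. f \<in> L2 M \<Longrightarrow> T' f \<in> L2 M"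
    and eq: "\<And>f. f \<in> L2 M \<Longrightarrow> AE x in M. T f x = T' f x"
  shows "spectrum M T = spectrum M T'"
proof (rule antisym)
  have eq': "AE x in M. T' f x = T f x" if "f \<in> L2 M" for f
    using eq[OF that] by eventually_elim simp
  show "spectrum M T \<subseteq> spectrum M T'" by (rule spectrum_cong_subset[OF T(2,1) eq'])
  show "spectrum M T' \<subseteq> spectrum M T" by (rule spectrum_cong_subset[OF T eq])
qed

section \<open>The measure of noncompactness\<close>

definition finitely_covered :: "'a measure \<Rightarrow> 'a operator \<Rightarrow> real \<Rightarrow> bool" where
  "finitely_covered M T \<delta> \<longleftrightarrow> \<delta> > 0 \<and> (\<exists>F. finite F \<and> F \<subseteq> L2 M \<and>
     (\<forall>f\<in>L2 M. L2_norm M f \<le> 1 \<longrightarrow> (\<exists>g\<in>F. L2_norm M (\<lambda>x. T f x - g x) \<le> \<delta>)))"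

lemma noncompactness_eq: "noncompactness M T = Inf {\<delta>. finitely_covered M T \<delta>}"
  by (simp add: noncompactness_def finitely_covered_def)

lemma noncompactness_le: "finitely_covered M T \<delta> \<Longrightarrow> noncompactness M T \<le> \<delta>"
  unfolding noncompactness_eq
  by (intro cInf_lower bdd_belowI[of _ 0]) (auto simp: finitely_covered_def less_imp_le)

lemma finitely_covered_exists:
  assumes "bounded_operator M T"
  shows "\<exists>\<delta>. finitely_covered M T \<delta>"
proof -
  obtain C where C: "0 < C" "\<And>f. f \<in> L2 M \<Longrightarrow> L2_norm M (T f) \<le> C * L2_norm M f"
    using bounded_operator_bound[OF assms] by blast
  have "L2_norm M (T f) \<le> C" if "f \<in> L2 M" "L2_norm M f \<le> 1" for f
    using C(2)[OF that(1)] that(2) C(1) by (meson mult_left_le less_imp_le order_trans)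
  then have "finitely_covered M T C" unfolding finitely_covered_def
    using C by (intro conjI exI[of _ "{\<lambda>_. 0}"]) auto
  then show ?thesis ..
qed

lemma noncompactness_nonneg: "bounded_operator M T \<Longrightarrow> 0 \<le> noncompactness M T"
  unfolding noncompactness_eq using finitely_covered_exists[of M T]
  by (intro cInf_greatest) (auto simp: finitely_covered_def)

lemma finitely_covered_approx:
  assumes "bounded_operator M T" "noncompactness M T < c"
  shows "\<exists>\<delta><c. finitely_covered M T \<delta>"
  using finitely_covered_exists[OF assms(1)] assms(2) cInf_lessD[of "{\<delta>. finitely_covered M T \<delta>}" c]
  unfolding noncompactness_eq by blast

lemma finitely_covered_cong:
  assumes T: "\<And>f. f \<in> L2 M \<Longrightarrow> T f \<in> L2 M" "\<And>f. f \<in> L2 M \<Longrightarrow> T' f \<in> L2 M"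
    and eq: "\<And>f. f \<in> L2 M \<Longrightarrow> AE x in M. T f x = T' f x" and fin: "finitely_covered M T \<delta>"
  shows "finitely_covered M T' \<delta>"
proof -
  have "L2_norm M (\<lambda>x. T' f x - g x) = L2_norm M (\<lambda>x. T f x - g x)" if "f \<in> L2 M" "g \<in> L2 M" for f g
    by (intro L2_norm_cong_AE L2_diff T that) (use eq[OF that(1)] in auto)
  then show ?thesis using fin unfolding finitely_covered_def by (metis subsetD)
qed

lemma noncompactness_cong:
  assumes T: "\<And>f. f \<in> L2 M \<Longrightarrow> T f \<in> L2 M" "\<And>f. f \<in> L2 M \<Longrightarrow> T' f \<in> L2 M"
    and eq: "\<And>f. f \<in> L2 M \<Longrightarrow> AE x in M. T f x = T' f x"
  shows "noncompactness M T = noncompactness M T'"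
proof -
  have eq': "AE x in M. T' f x = T f x" if "f \<in> L2 M" for f
    using eq[OF that] by eventually_elim simp
  have "finitely_covered M T \<delta> \<longleftrightarrow> finitely_covered M T' \<delta>" for \<delta>
    using finitely_covered_cong[OF T eq] finitely_covered_cong[OF T(2,1) eq'] by (rule iffI)
  then show ?thesis by (simp add: noncompactness_eq)
qed

text \<open>If \<open>g\<close> approximates \<open>S f\<close> up to \<open>\<eta>\<close>, then \<open>(S f - g) / \<eta>\<close> lies in the unit ball, so its image under
  \<open>T\<close> is approximated by some \<open>h\<close> up to \<open>\<delta>\<close>; hence \<open>T g + \<eta> h\<close> approximates \<open>T (S f)\<close>.\<close>

lemma finitely_covered_compose:
  assumes T: "bounded_operator M T" and S: "bounded_operator M S"
    and \<delta>: "finitely_covered M T \<delta>" and \<eta>: "finitely_covered M S \<eta>"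
  shows "finitely_covered M (T \<circ> S) (\<delta> * \<eta>)"
proof -
  obtain F where F: "finite F" "F \<subseteq> L2 M"
    "\<And>f. f \<in> L2 M \<Longrightarrow> L2_norm M f \<le> 1 \<Longrightarrow> \<exists>g\<in>F. L2_norm M (\<lambda>x. T f x - g x) \<le> \<delta>"
    using \<delta> by (auto simp: finitely_covered_def)
  obtain G where G: "finite G" "G \<subseteq> L2 M"
    "\<And>f. f \<in> L2 M \<Longrightarrow> L2_norm M f \<le> 1 \<Longrightarrow> \<exists>g\<in>G. L2_norm M (\<lambda>x. S f x - g x) \<le> \<eta>"
    using \<eta> by (auto simp: finitely_covered_def)
  have pos: "0 < \<delta>" "0 < \<eta>" using \<delta> \<eta> by (auto simp: finitely_covered_def)
  let ?H = "(\<lambda>(g, h) x. T g x + of_real \<eta> * h x) ` (G \<times> F)"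
  have "\<exists>g\<in>?H. L2_norm M (\<lambda>x. (T \<circ> S) f x - g x) \<le> \<delta> * \<eta>"
    if f: "f \<in> L2 M" "L2_norm M f \<le> 1" for f
  proof -
    obtain g where g: "g \<in> G" "L2_norm M (\<lambda>x. S f x - g x) \<le> \<eta>" using G(3)[OF f] by blast
    then have g2: "g \<in> L2 M" using G by auto
    have Sf: "S f \<in> L2 M" by (rule bounded_operatorD(1)[OF S f(1)])
    define p where "p = (\<lambda>x. of_real (1 / \<eta>) * (S f x - g x))"
    have p: "p \<in> L2 M" unfolding p_def by (intro L2_scale L2_diff Sf g2)
    have "L2_norm M p = 1 / \<eta> * L2_norm M (\<lambda>x. S f x - g x)"
      unfolding p_def using pos by (subst L2_norm_scale) (auto intro: L2_diff Sf g2 simp: norm_divide)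
    then have "L2_norm M p \<le> 1" using g pos by (simp add: divide_le_eq)
    then obtain h where h: "h \<in> F" "L2_norm M (\<lambda>x. T p x - h x) \<le> \<delta>" using F(3)[OF p] by blast
    then have h2: "h \<in> L2 M" using F by auto
    have Tp: "T p \<in> L2 M" and Tg: "T g \<in> L2 M" and TSf: "T (S f) \<in> L2 M"
      by (intro bounded_operatorD(1)[OF T] p g2 Sf)+
    have "(\<lambda>y. of_real \<eta> * p y + g y) = S f" using pos by (auto simp: p_def fun_eq_iff)
    then have eq: "AE x in M. T (S f) x = of_real \<eta> * T p x + T g x"
      using bounded_operatorD(2)[OF T p g2, of "of_real \<eta>"] by simp
    have "L2_norm M (\<lambda>x. (T \<circ> S) f x - (T g x + of_real \<eta> * h x))
      = L2_norm M (\<lambda>x. of_real \<eta> * (T p x - h x))"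
    proof (rule L2_norm_cong_AE)
      show "(\<lambda>x. (T \<circ> S) f x - (T g x + of_real \<eta> * h x)) \<in> L2 M"
        unfolding o_apply by (intro L2_diff L2_add L2_scale TSf Tg h2)
      show "(\<lambda>x. of_real \<eta> * (T p x - h x)) \<in> L2 M" by (intro L2_diff L2_scale Tp h2)
      show "AE x in M. (T \<circ> S) f x - (T g x + of_real \<eta> * h x) = of_real \<eta> * (T p x - h x)"
        using eq by eventually_elim (simp add: algebra_simps)
    qed
    also have "\<dots> = \<eta> * L2_norm M (\<lambda>x. T p x - h x)"
      using pos by (subst L2_norm_scale) (auto intro!: L2_diff Tp h2)
    also have "\<dots> \<le> \<delta> * \<eta>" using h pos by simp
    finally have "L2_norm M (\<lambda>x. (T \<circ> S) f x - (T g x + of_real \<eta> * h x)) \<le> \<delta> * \<eta>" .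
    then show ?thesis using g h by (intro bexI[of _ "\<lambda>x. T g x + of_real \<eta> * h x"]) auto
  qed
  moreover have "?H \<subseteq> L2 M" using F G by (auto intro!: L2_add L2_scale bounded_operatorD(1)[OF T])
  ultimately show ?thesis unfolding finitely_covered_def using pos F G
    by (intro conjI exI[of _ ?H]) auto
qed

lemma noncompactness_compose:
  assumes T: "bounded_operator M T" and S: "bounded_operator M S"
  shows "noncompactness M (T \<circ> S) \<le> noncompactness M T * noncompactness M S"
proof -
  let ?t = "noncompactness M T" and ?s = "noncompactness M S"
  have le: "noncompactness M (T \<circ> S) \<le> (?t + e) * (?s + e)" if e: "0 < e" for e
  proof -
    obtain \<delta> where \<delta>: "\<delta> < ?t + e" "finitely_covered M T \<delta>"
      using finitely_covered_approx[OF T, of "?t + e"] e by auto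
    obtain \<eta> where \<eta>: "\<eta> < ?s + e" "finitely_covered M S \<eta>"
      using finitely_covered_approx[OF S, of "?s + e"] e by auto
    have "noncompactness M (T \<circ> S) \<le> \<delta> * \<eta>"
      by (intro noncompactness_le finitely_covered_compose T S \<delta> \<eta>)
    also have "\<dots> \<le> (?t + e) * (?s + e)"
      using \<delta> \<eta> by (intro mult_mono) (auto simp: finitely_covered_def)
    finally show ?thesis .
  qed
  have "((\<lambda>e. (?t + e) * (?s + e)) \<longlongrightarrow> (?t + 0) * (?s + 0)) (at_right 0)"
    by (intro tendsto_intros)
  then have "noncompactness M (T \<circ> S) \<le> (?t + 0) * (?s + 0)"
    by (rule tendsto_lowerbound) (use le in \<open>auto simp: eventually_at_right_less eventually_at_filter\<close>)
  then show ?thesis by simp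
qed

section \<open>Submultiplicative sequences\<close>

text \<open>Fekete's lemma: the limit is the infimum \<open>L\<close> of the roots.  Given \<open>d > L\<close>, choose \<open>m\<close> with
  \<open>a m \<le> d\<^sup>m\<close> and divide \<open>n\<close> by \<open>m\<close> with a remainder between \<open>1\<close> and \<open>m\<close>; this gives a bound of
  \<open>a n\<close> by a constant times \<open>d\<^sup>n\<close>.\<close>

lemma root_submultiplicative:
  fixes a :: "nat \<Rightarrow> real"
  assumes nonneg: "\<And>n. 0 \<le> a n"
    and sub: "\<And>m n. 1 \<le> m \<Longrightarrow> 1 \<le> n \<Longrightarrow> a (m + n) \<le> a m * a n"
  obtains L where "(\<lambda>n. root n (a n)) \<longlonglongrightarrow> L" "0 \<le> L" "\<And>n. 1 \<le> n \<Longrightarrow> L ^ n \<le> a n"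
proof -
  define L where "L = (INF n\<in>{1..}. root n (a n))"
  have bdd: "bdd_below ((\<lambda>n. root n (a n)) ` {1..})"
    using nonneg by (intro bdd_belowI[of _ 0]) auto
  have L_le: "L \<le> root n (a n)" if "1 \<le> n" for n
    unfolding L_def using that by (intro cINF_lower bdd) auto
  have L0: "0 \<le> L" unfolding L_def using nonneg by (intro cINF_greatest) auto
  have pow: "L ^ n \<le> a n" if "1 \<le> n" for n
    using power_mono[OF L_le[OF that] L0, of n] nonneg that by (simp add: real_root_pow_pos2)
  have upper: "\<forall>\<^sub>F n in sequentially. root n (a n) < c" if c: "L < c" for c
  proof -
    obtain d where d: "L < d" "d < c" using c dense by blast
    then have d0: "0 < d" using L0 by linarith
    obtain m where m: "1 \<le> m" "root m (a m) < d"
      using d(1) unfolding L_def by (subst (asm) cINF_less_iff[OF _ bdd]) auto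
    have am: "a m \<le> d ^ m"
      using power_mono[of "root m (a m)" d m] m nonneg[of m] by (simp add: real_root_pow_pos2)
    (* The sum covers all remainders; the summand 1 makes the root of B tend to 1. *)
    define B where "B = 1 + (\<Sum>r\<in>{1..m}. a r / d ^ r)"
    have B: "1 \<le> B" "a r \<le> B * d ^ r" if "r \<in> {1..m}" for r
    proof -
      have "0 \<le> (\<Sum>r\<in>{1..m}. a r / d ^ r)" using nonneg d0 by (intro sum_nonneg) auto
      then show "1 \<le> B" by (simp add: B_def)
      have "a r / d ^ r \<le> (\<Sum>r\<in>{1..m}. a r / d ^ r)"
        using that nonneg d0 by (intro member_le_sum) auto
      then have "a r / d ^ r \<le> B" by (simp add: B_def)
      then show "a r \<le> B * d ^ r" using d0 by (simp add: divide_le_eq)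
    qed
    have step: "a (q * m + r) \<le> B * d ^ (q * m + r)" if r: "r \<in> {1..m}" for q r
    proof (induction q)
      case 0
      then show ?case using B(2)[OF r] by simp
    next
      case (Suc q)
      have "a (Suc q * m + r) = a (m + (q * m + r))" by (simp add: ac_simps)
      also have "\<dots> \<le> a m * a (q * m + r)" using r m by (intro sub) auto
      also have "\<dots> \<le> d ^ m * (B * d ^ (q * m + r))"
        using am Suc nonneg d0 by (intro mult_mono) auto
      also have "\<dots> = B * d ^ (Suc q * m + r)" by (simp add: power_add ac_simps)
      finally show ?case .
    qed
    have bound: "a n \<le> B * d ^ n" if "1 \<le> n" for n
    proof -
      have "n = (n - 1) div m * m + ((n - 1) mod m + 1)" using that by simp
      moreover have "(n - 1) mod m + 1 \<in> {1..m}" using m by (auto simp: Suc_le_eq)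
      ultimately show ?thesis using step by metis
    qed
    have "1 \<le> B" using B(1)[of 1] m by auto
    have "(\<lambda>n. root n B * d) \<longlonglongrightarrow> 1 * d"
      using \<open>1 \<le> B\<close> by (intro tendsto_mult tendsto_const LIMSEQ_root_const) auto
    then have "\<forall>\<^sub>F n in sequentially. root n B * d < c"
      using d by (intro order_tendstoD(2)) auto
    then show ?thesis using eventually_ge_at_top[of 1]
    proof eventually_elim
      case (elim n)
      have "root n (a n) \<le> root n (B * d ^ n)" using elim bound[of n] by simp
      also have "\<dots> = root n B * d" using elim d0 by (simp add: real_root_mult real_root_power_cancel)
      finally show ?case using elim by simp
    qed
  qed
  have "(\<lambda>n. root n (a n)) \<longlonglongrightarrow> L"
  proof (rule order_tendstoI)
    fix c assume "c < L"
    then show "\<forall>\<^sub>F n in sequentially. c < root n (a n)"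
      using L_le by (intro eventually_sequentiallyI[of 1]) (meson less_le_trans)
  qed (rule upper)
  then show ?thesis using L0 pow that by blast
qed

lemma noncompactness_limit:
  assumes T: "bounded_operator M T"
  shows "(\<lambda>j. root j (noncompactness M (T ^^ j))) \<longlonglongrightarrow> ess_spectral_radius M T"
proof -
  obtain L where "(\<lambda>j. root j (noncompactness M (T ^^ j))) \<longlonglongrightarrow> L"
    by (rule root_submultiplicative[of "\<lambda>j. noncompactness M (T ^^ j)"])
      (use T in \<open>auto simp: funpow_add intro!: noncompactness_nonneg noncompactness_compose bounded_operator_funpow\<close>)
  then show ?thesis unfolding ess_spectral_radius_def by (simp add: limI)
qed

section \<open>Operators with a positive kernel\<close>

abbreviation nn_abs :: "('a \<Rightarrow> complex) \<Rightarrow> 'a \<Rightarrow> ennreal" where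
  "nn_abs f \<equiv> \<lambda>x. ennreal (norm (f x))"

lemma nn_abs_L2: "f \<in> L2 M \<Longrightarrow> nn_abs f \<in> nn_L2 M"
  by (auto simp: L2_iff nn_L2_def)

context sigma_finite_measure
begin

interpretation P: pair_sigma_finite M M ..

lemma measurable_kernel_op [measurable (raw)]:
  assumes [measurable]: "measurable_kernel M k"
    "f \<in> borel_measurable M" "X \<in> N \<rightarrow>\<^sub>M M"
  shows "(\<lambda>w. kernel_op M k f (X w)) \<in> borel_measurable N"
  unfolding kernel_op_def by measurable

lemma kernel_op_norm_le:
  assumes "\<And>x y. 0 \<le> k x y"
  shows "nn_abs (kernel_op M k f) x \<le> act M k (nn_abs f) x"
proof -
  have eq: "act M k (nn_abs f) x = (\<integral>\<^sup>+y. ennreal (norm (complex_of_real (k x y) * f y)) \<partial>M)"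
    unfolding act_def by (intro nn_integral_cong) (simp add: norm_mult assms ennreal_mult')
  show ?thesis
  proof (cases "integrable M (\<lambda>y. complex_of_real (k x y) * f y)")
    case True
    then show ?thesis unfolding eq kernel_op_def by (rule integral_norm_bound_ennreal)
  next
    case False
    then show ?thesis by (simp add: kernel_op_def not_integrable_integral_eq)
  qed
qed

lemma kernel_op_integrable:
  assumes k: "pos_kernel M k" and f: "f \<in> L2 M"
  shows "AE x in M. integrable M (\<lambda>y. complex_of_real (k x y) * f y)"
proof -
  note [measurable] = pos_kernelD(1)[OF k] L2_measurable[OF f]
  have "(\<integral>\<^sup>+x. (act M k (nn_abs f) x)\<^sup>2 \<partial>M) < \<infinity>"
    by (intro pos_kernel_act_finite k) (use f in \<open>auto simp: L2_iff\<close>)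
  then have "AE x in M. act M k (nn_abs f) x < \<infinity>" by (intro L2_finite_AE) auto
  with AE_space show ?thesis
  proof eventually_elim
    case (elim x)
    then have [measurable]: "x \<in> space M" by simp
    have "(\<integral>\<^sup>+y. ennreal (norm (complex_of_real (k x y) * f y)) \<partial>M) = act M k (nn_abs f) x"
      unfolding act_def by (intro nn_integral_cong) (simp add: norm_mult pos_kernelD[OF k] ennreal_mult')
    then show ?case using elim by (intro integrableI_bounded) auto
  qed
qed

lemma kernel_op_L2:
  assumes k: "pos_kernel M k" and f: "f \<in> L2 M"
  shows "kernel_op M k f \<in> L2 M"
proof -
  note [measurable] = pos_kernelD(1)[OF k] L2_measurable[OF f]
  have "(\<integral>\<^sup>+x. (nn_abs (kernel_op M k f) x)\<^sup>2 \<partial>M) \<le> (\<integral>\<^sup>+x. (act M k (nn_abs f) x)\<^sup>2 \<partial>M)"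
    by (intro nn_integral_mono power_mono kernel_op_norm_le pos_kernelD[OF k]) auto
  also have "\<dots> < \<infinity>" by (intro pos_kernel_act_finite k) (use f in \<open>auto simp: L2_iff\<close>)
  finally show ?thesis by (simp add: L2_iff)
qed

lemma kernel_op_norm_bound:
  assumes k: "pos_kernel M k" and f: "f \<in> L2 M"
  shows "L2_norm M (kernel_op M k f) \<le> kernel_size M zero_cone k * L2_norm M f"
proof -
  note [measurable] = pos_kernelD(1)[OF k] L2_measurable[OF f]
  have s: "0 \<le> kernel_size M zero_cone k" by (rule pos_kernel_size_nonneg[OF k nn_cone_zero])
  have "(\<integral>\<^sup>+x. (nn_abs (kernel_op M k f) x)\<^sup>2 \<partial>M) \<le> (\<integral>\<^sup>+x. (act M k (nn_abs f) x)\<^sup>2 \<partial>M)"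
    by (intro nn_integral_mono power_mono kernel_op_norm_le pos_kernelD[OF k]) auto
  also have "\<dots> \<le> ennreal ((kernel_size M zero_cone k * L2_norm M f)\<^sup>2)"
    by (rule act_L2[OF pos_kernelD(1)[OF k] form_le_size[OF k] s]) (auto simp: L2_norm_nn f)
  finally show ?thesis using s by (subst L2_norm_le_iff) (auto intro: kernel_op_L2 k f)
qed

lemma bounded_kernel_op:
  assumes k: "pos_kernel M k"
  shows "bounded_operator M (kernel_op M k)"
  unfolding bounded_operator_def
proof (intro conjI ballI allI exI)
  fix f assume f: "f \<in> L2 M"
  show "kernel_op M k f \<in> L2 M" by (rule kernel_op_L2[OF k f])
  show "L2_norm M (kernel_op M k f) \<le> kernel_size M zero_cone k * L2_norm M f"
    by (rule kernel_op_norm_bound[OF k f])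
  fix g a assume g: "g \<in> L2 M"
  from kernel_op_integrable[OF k f] kernel_op_integrable[OF k g]
  show "AE x in M. kernel_op M k (\<lambda>y. a * f y + g y) x = a * kernel_op M k f x + kernel_op M k g x"
  proof eventually_elim
    case (elim x)
    have "kernel_op M k (\<lambda>y. a * f y + g y) x
       = (LINT y|M. a * (complex_of_real (k x y) * f y) + complex_of_real (k x y) * g y)"
      unfolding kernel_op_def by (intro Bochner_Integration.integral_cong) (auto simp: algebra_simps)
    also have "\<dots> = a * kernel_op M k f x + kernel_op M k g x"
      unfolding kernel_op_def using elim by simp
    finally show ?case .
  qed
qed

text \<open>Fubini's theorem applies at almost every point because the iterated integral of the moduli is the
  value of the nonnegative operators at \<open>nn_abs f\<close>, which is square integrable.\<close>

lemma kernel_op_comp: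
  assumes k: "pos_kernel M k" and h: "pos_kernel M h" and f: "f \<in> L2 M"
  shows "AE x in M. kernel_op M (kernel_comp M k h) f x = kernel_op M k (kernel_op M h f) x"
proof -
  note [measurable] = pos_kernelD(1)[OF k] pos_kernelD(1)[OF h] L2_measurable[OF f]
  have "(\<integral>\<^sup>+x. (act M k (act M h (nn_abs f)) x)\<^sup>2 \<partial>M) < \<infinity>"
    by (intro pos_kernel_act_finite k h) (use f in \<open>auto simp: L2_iff\<close>)
  then have "AE x in M. act M k (act M h (nn_abs f)) x < \<infinity>" by (intro L2_finite_AE) auto
  with AE_space show ?thesis
  proof eventually_elim
    case (elim x)
    then have [measurable]: "x \<in> space M" by simp
    let ?F = "\<lambda>z y. complex_of_real (k x z) * (complex_of_real (h z y) * f y)"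
    have "(\<integral>\<^sup>+p. ennreal (norm (case_prod ?F p)) \<partial>(M \<Otimes>\<^sub>M M)) = (\<integral>\<^sup>+z. \<integral>\<^sup>+y. ennreal (norm (?F z y)) \<partial>M \<partial>M)"
      by (subst nn_integral_fst[symmetric]) auto
    also have "\<dots> = act M k (act M h (nn_abs f)) x"
      unfolding act_def
    proof (intro nn_integral_cong)
      fix z assume [measurable]: "z \<in> space M"
      have "(\<integral>\<^sup>+y. ennreal (norm (?F z y)) \<partial>M) = (\<integral>\<^sup>+y. ennreal (k x z) * (ennreal (h z y) * nn_abs f y) \<partial>M)"
        by (intro nn_integral_cong) (simp add: norm_mult pos_kernelD[OF k] pos_kernelD[OF h] ennreal_mult')
      then show "(\<integral>\<^sup>+y. ennreal (norm (?F z y)) \<partial>M) = ennreal (k x z) * (\<integral>\<^sup>+y. ennreal (h z y) * nn_abs f y \<partial>M)"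
        by (simp add: nn_integral_cmult)
    qed
    also have "\<dots> < \<infinity>" using elim by simp
    finally have int: "integrable (M \<Otimes>\<^sub>M M) (case_prod ?F)" by (intro integrableI_bounded) auto
    have "kernel_op M (kernel_comp M k h) f x = (LINT y|M. LINT z|M. ?F z y)"
      unfolding kernel_op_def kernel_comp_def
    proof (intro Bochner_Integration.integral_cong refl)
      fix y
      have "complex_of_real (LINT z|M. k x z * h z y) * f y = (LINT z|M. complex_of_real (k x z * h z y)) * f y"
        by (simp only: integral_complex_of_real)
      also have "\<dots> = (LINT z|M. complex_of_real (k x z * h z y) * f y)"
        by (rule integral_mult_left_zero[symmetric])
      finally show "complex_of_real (LINT z|M. k x z * h z y) * f y = (LINT z|M. ?F z y)"
        by (simp add: mult.assoc)
    qed
    also have "\<dots> = (LINT z|M. LINT y|M. ?F z y)" by (rule P.Fubini_integral[OF int])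
    also have "\<dots> = kernel_op M k (kernel_op M h f) x"
      unfolding kernel_op_def by (intro Bochner_Integration.integral_cong refl integral_mult_right_zero)
    finally show ?case .
  qed
qed

lemma kernel_op_power:
  assumes k: "pos_kernel M k" and "1 \<le> j" and f: "f \<in> L2 M"
  shows "AE x in M. (kernel_op M k ^^ j) f x = kernel_op M (kernel_power M k j) f x"
  using \<open>1 \<le> j\<close>
proof (induction j rule: dec_induct)
  case base
  then show ?case by simp
next
  case (step j)
  let ?T = "kernel_op M k"
  have "AE x in M. ?T ((?T ^^ j) f) x = ?T (kernel_op M (kernel_power M k j) f) x"
    by (rule bounded_operator_cong[OF bounded_kernel_op[OF k]
          bounded_operatorD(1)[OF bounded_operator_funpow[OF bounded_kernel_op[OF k]] f]
          kernel_op_L2[OF pos_kernel_power[OF k] f] step.IH])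
  with kernel_op_comp[OF k pos_kernel_power[OF k] f, of j] show ?case
    by eventually_elim (use step.hyps in \<open>simp add: kernel_power_Suc\<close>)
qed

lemma kernel_op_power_bound:
  assumes k: "pos_kernel M k" and "1 \<le> j" and f: "f \<in> L2 M"
  shows "L2_norm M ((kernel_op M k ^^ j) f) \<le> kernel_size M zero_cone (kernel_power M k j) * L2_norm M f"
proof -
  have "L2_norm M ((kernel_op M k ^^ j) f) = L2_norm M (kernel_op M (kernel_power M k j) f)"
    by (rule L2_norm_cong_AE[OF bounded_operatorD(1)[OF bounded_operator_funpow[OF bounded_kernel_op[OF k]] f]
          kernel_op_L2[OF pos_kernel_power[OF k] f] kernel_op_power[OF assms]])
  also have "\<dots> \<le> kernel_size M zero_cone (kernel_power M k j) * L2_norm M f"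
    by (intro kernel_op_norm_bound pos_kernel_power k f)
  finally show ?thesis .
qed

lemma nn_ball_complex:
  assumes f: "f \<in> nn_ball M"
  shows "(\<lambda>x. complex_of_real (enn2real (f x))) \<in> L2 M"
    "L2_norm M (\<lambda>x. complex_of_real (enn2real (f x))) \<le> 1"
    "AE x in M. ennreal (enn2real (f x)) = f x"
proof -
  have [measurable]: "f \<in> borel_measurable M" and le: "(\<integral>\<^sup>+x. (f x)\<^sup>2 \<partial>M) \<le> 1"
    using f by (auto simp: nn_ball_def)
  have "AE x in M. f x < \<infinity>" by (rule L2_finite_AE) (use le in \<open>auto intro: le_less_trans\<close>)
  then show eq: "AE x in M. ennreal (enn2real (f x)) = f x" by eventually_elim simp
  have "(\<integral>\<^sup>+x. (nn_abs (\<lambda>x. complex_of_real (enn2real (f x))) x)\<^sup>2 \<partial>M) = (\<integral>\<^sup>+x. (f x)\<^sup>2 \<partial>M)"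
    by (intro nn_integral_cong_AE) (use eq in \<open>auto elim!: eventually_mono\<close>)
  then have *: "(\<integral>\<^sup>+x. (nn_abs (\<lambda>x. complex_of_real (enn2real (f x))) x)\<^sup>2 \<partial>M) \<le> ennreal (1\<^sup>2)"
    using le by simp
  show "(\<lambda>x. complex_of_real (enn2real (f x))) \<in> L2 M"
    "L2_norm M (\<lambda>x. complex_of_real (enn2real (f x))) \<le> 1"
    by (rule L2I[OF _ *]; simp)+
qed

text \<open>There is no cancellation on nonnegative functions; hence the forms of the kernel can be computed
  from the complex operator.\<close>

lemma kernel_op_real:
  assumes k: "pos_kernel M k" and \<phi>: "(\<lambda>x. complex_of_real (\<phi> x)) \<in> L2 M" "\<And>x. 0 \<le> \<phi> x"
  shows "AE x in M. kernel_op M k (\<lambda>x. complex_of_real (\<phi> x)) x \<in> \<real>\<^sub>\<ge>\<^sub>0 \<and>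
     nn_abs (kernel_op M k (\<lambda>x. complex_of_real (\<phi> x))) x = act M k (\<lambda>x. ennreal (\<phi> x)) x"
  using kernel_op_integrable[OF k \<phi>(1)]
proof eventually_elim
  case (elim x)
  have e: "kernel_op M k (\<lambda>x. complex_of_real (\<phi> x)) x = complex_of_real (LINT y|M. k x y * \<phi> y)"
    unfolding kernel_op_def by (simp flip: of_real_mult)
  have int: "integrable M (\<lambda>y. k x y * \<phi> y)"
    using integrable_Re[OF elim] by simp
  have n: "0 \<le> (LINT y|M. k x y * \<phi> y)"
    by (intro integral_nonneg_AE) (use \<phi> pos_kernelD[OF k] in auto)
  have "act M k (\<lambda>x. ennreal (\<phi> x)) x = (\<integral>\<^sup>+y. ennreal (k x y * \<phi> y) \<partial>M)"
    unfolding act_def by (intro nn_integral_cong) (simp add: ennreal_mult' pos_kernelD[OF k])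
  also have "\<dots> = ennreal (LINT y|M. k x y * \<phi> y)"
    by (intro nn_integral_eq_integral int) (use \<phi> pos_kernelD[OF k] in auto)
  finally show ?case using n by (simp add: e)
qed

end

section \<open>Kernel operators are compact on order intervals\<close>

definition order_interval :: "'a measure \<Rightarrow> ('a \<Rightarrow> real) \<Rightarrow> ('a \<Rightarrow> complex) set" where
  "order_interval M w = {h \<in> borel_measurable M. \<forall>x. norm (h x) \<le> w x}"

text \<open>The square of a mixed norm, integrating in \<open>y\<close> against \<open>w\<close> and then taking the \<open>L\<^sup>2\<close> norm in \<open>x\<close>.
  It bounds the operator on the order interval of \<open>w\<close> uniformly (\<open>interval_norm\<close>), and truncations
  of a kernel converge in it although they need not converge in operator norm.\<close>

definition mixed_norm2 :: "'a measure \<Rightarrow> ('a \<Rightarrow> real) \<Rightarrow> 'a kernel \<Rightarrow> ennreal" where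
  "mixed_norm2 M w s = (\<integral>\<^sup>+x. (\<integral>\<^sup>+y. ennreal \<bar>s x y\<bar> * ennreal (w y) \<partial>M)\<^sup>2 \<partial>M)"

definition mixed_finite :: "'a measure \<Rightarrow> ('a \<Rightarrow> real) \<Rightarrow> 'a kernel \<Rightarrow> bool" where
  "mixed_finite M w s \<longleftrightarrow> measurable_kernel M s \<and> mixed_norm2 M w s < \<infinity>"

definition interval_compact :: "'a measure \<Rightarrow> ('a \<Rightarrow> real) \<Rightarrow> 'a kernel \<Rightarrow> bool" where
  "interval_compact M w s \<longleftrightarrow> (\<forall>\<epsilon>>0. \<exists>F. finite F \<and> F \<subseteq> L2 M \<and>
     (\<forall>h\<in>order_interval M w. \<exists>g\<in>F. L2_norm M (\<lambda>x. kernel_op M s h x - g x) \<le> \<epsilon>))"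

lemma order_interval_measurable [measurable_dest]: "h \<in> order_interval M w \<Longrightarrow> h \<in> borel_measurable M"
  by (simp add: order_interval_def)

lemma mixed_finite_measurable [measurable_dest]:
  "mixed_finite M w s \<Longrightarrow> measurable_kernel M s"
  by (simp add: mixed_finite_def)

context sigma_finite_measure
begin

interpretation P: pair_sigma_finite M M ..

lemma mixed_norm2_mono:
  "(\<And>x y. \<bar>s x y\<bar> \<le> \<bar>t x y\<bar>) \<Longrightarrow> mixed_norm2 M w s \<le> mixed_norm2 M w t"
  unfolding mixed_norm2_def
  by (intro nn_integral_mono power_mono mult_right_mono ennreal_leI) auto

lemma mixed_finite_AE:
  assumes s: "mixed_finite M w s" and [measurable]: "w \<in> borel_measurable M"
  shows "AE x in M. (\<integral>\<^sup>+y. ennreal \<bar>s x y\<bar> * ennreal (w y) \<partial>M) < \<infinity>"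
proof -
  note [measurable] = mixed_finite_measurable[OF s]
  show ?thesis by (rule L2_finite_AE) (use s in \<open>auto simp: mixed_finite_def mixed_norm2_def\<close>)
qed

lemma
  assumes s: "mixed_finite M w s" and w[measurable]: "w \<in> borel_measurable M"
    and h: "h \<in> order_interval M w"
  shows interval_integrable: "AE x in M. integrable M (\<lambda>y. complex_of_real (s x y) * h y)"
    and interval_L2: "kernel_op M s h \<in> L2 M"
    and interval_norm: "ennreal ((L2_norm M (kernel_op M s h))\<^sup>2) \<le> mixed_norm2 M w s"
proof -
  note [measurable] = mixed_finite_measurable[OF s] order_interval_measurable[OF h]
  have bound: "(\<integral>\<^sup>+y. ennreal (norm (complex_of_real (s x y) * h y)) \<partial>M)
     \<le> (\<integral>\<^sup>+y. ennreal \<bar>s x y\<bar> * ennreal (w y) \<partial>M)" for x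
    using h by (intro nn_integral_mono)
      (auto simp: norm_mult ennreal_mult' order_interval_def intro!: mult_left_mono ennreal_leI)
  from mixed_finite_AE[OF s w] AE_space
  show "AE x in M. integrable M (\<lambda>y. complex_of_real (s x y) * h y)"
  proof eventually_elim
    case (elim x)
    then have [measurable]: "x \<in> space M" by simp
    show ?case by (rule integrableI_bounded) (use elim le_less_trans[OF bound] in auto)
  qed
  have "nn_abs (kernel_op M s h) x \<le> (\<integral>\<^sup>+y. ennreal \<bar>s x y\<bar> * ennreal (w y) \<partial>M)" for x
  proof (cases "integrable M (\<lambda>y. complex_of_real (s x y) * h y)")
    case True
    then show ?thesis unfolding kernel_op_def
      by (intro order_trans[OF integral_norm_bound_ennreal bound])
  next
    case False
    then show ?thesis by (simp add: kernel_op_def not_integrable_integral_eq)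
  qed
  then have *: "(\<integral>\<^sup>+x. (nn_abs (kernel_op M s h) x)\<^sup>2 \<partial>M) \<le> mixed_norm2 M w s"
    unfolding mixed_norm2_def by (intro nn_integral_mono power_mono) auto
  then show L2: "kernel_op M s h \<in> L2 M"
    using s by (simp add: L2_iff mixed_finite_def le_less_trans)
  show "ennreal ((L2_norm M (kernel_op M s h))\<^sup>2) \<le> mixed_norm2 M w s"
    using * by (simp add: L2_norm_nn[OF L2])
qed

lemma mixed_finite_combine:
  assumes s: "mixed_finite M w s" and t: "mixed_finite M w t" and [measurable]: "w \<in> borel_measurable M"
  shows "mixed_finite M w (\<lambda>x y. a * s x y + b * t x y)"
proof -
  note [measurable] = mixed_finite_measurable[OF s] mixed_finite_measurable[OF t]
  let ?S = "\<lambda>x. \<integral>\<^sup>+y. ennreal \<bar>s x y\<bar> * ennreal (w y) \<partial>M"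
  let ?T = "\<lambda>x. \<integral>\<^sup>+y. ennreal \<bar>t x y\<bar> * ennreal (w y) \<partial>M"
  have "(\<integral>\<^sup>+y. ennreal \<bar>a * s x y + b * t x y\<bar> * ennreal (w y) \<partial>M) \<le> ennreal \<bar>a\<bar> * ?S x + ennreal \<bar>b\<bar> * ?T x"
    if [measurable]: "x \<in> space M" for x
  proof -
    have "(\<integral>\<^sup>+y. ennreal \<bar>a * s x y + b * t x y\<bar> * ennreal (w y) \<partial>M)
       \<le> (\<integral>\<^sup>+y. ennreal \<bar>a\<bar> * (ennreal \<bar>s x y\<bar> * ennreal (w y)) + ennreal \<bar>b\<bar> * (ennreal \<bar>t x y\<bar> * ennreal (w y)) \<partial>M)"
    proof (rule nn_integral_mono)
      fix y
      have "ennreal \<bar>a * s x y + b * t x y\<bar> \<le> ennreal (\<bar>a\<bar> * \<bar>s x y\<bar> + \<bar>b\<bar> * \<bar>t x y\<bar>)"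
        by (intro ennreal_leI) (metis abs_mult abs_triangle_ineq)
      also have "\<dots> = ennreal \<bar>a\<bar> * ennreal \<bar>s x y\<bar> + ennreal \<bar>b\<bar> * ennreal \<bar>t x y\<bar>"
        by (simp add: ennreal_mult)
      finally show "ennreal \<bar>a * s x y + b * t x y\<bar> * ennreal (w y)
        \<le> ennreal \<bar>a\<bar> * (ennreal \<bar>s x y\<bar> * ennreal (w y)) + ennreal \<bar>b\<bar> * (ennreal \<bar>t x y\<bar> * ennreal (w y))"
        by (auto dest: mult_right_mono[where c="ennreal (w y)"] simp: distrib_right mult.assoc)
    qed
    also have "\<dots> = ennreal \<bar>a\<bar> * ?S x + ennreal \<bar>b\<bar> * ?T x"
      by (simp add: nn_integral_add nn_integral_cmult)
    finally show ?thesis .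
  qed
  then have "mixed_norm2 M w (\<lambda>x y. a * s x y + b * t x y)
     \<le> (\<integral>\<^sup>+x. (ennreal \<bar>a\<bar> * ?S x + ennreal \<bar>b\<bar> * ?T x)\<^sup>2 \<partial>M)"
    unfolding mixed_norm2_def by (intro nn_integral_mono power_mono) auto
  also have "\<dots> < \<infinity>"
  proof -
    have "?S \<in> nn_L2 M" "?T \<in> nn_L2 M"
      using s t by (auto simp: nn_L2_def mixed_finite_def mixed_norm2_def)
    then have "(\<lambda>x. ennreal \<bar>a\<bar> * ?S x + ennreal \<bar>b\<bar> * ?T x) \<in> nn_L2 M"
      using nn_cone_L2[of M] unfolding nn_cone_def by (meson abs_ge_zero)
    then show ?thesis by (simp add: nn_L2_def)
  qed
  finally show ?thesis by (simp add: mixed_finite_def)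
qed

lemma interval_linear:
  assumes s: "mixed_finite M w s" and t: "mixed_finite M w t" and w: "w \<in> borel_measurable M"
    and h: "h \<in> order_interval M w"
  shows "AE x in M. kernel_op M (\<lambda>x y. a * s x y + b * t x y) h x
    = complex_of_real a * kernel_op M s h x + complex_of_real b * kernel_op M t h x"
  using interval_integrable[OF s w h] interval_integrable[OF t w h]
proof eventually_elim
  case (elim x)
  have "kernel_op M (\<lambda>x y. a * s x y + b * t x y) h x
    = (LINT y|M. complex_of_real a * (complex_of_real (s x y) * h y) + complex_of_real b * (complex_of_real (t x y) * h y))"
    unfolding kernel_op_def by (intro Bochner_Integration.integral_cong) (auto simp: algebra_simps)
  then show ?case using elim by (simp add: kernel_op_def)
qed

lemma interval_compact_combine:
  assumes s: "mixed_finite M w s" and t: "mixed_finite M w t" and w: "w \<in> borel_measurable M"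
    and sc: "interval_compact M w s" and tc: "interval_compact M w t"
  shows "interval_compact M w (\<lambda>x y. a * s x y + b * t x y)"
  unfolding interval_compact_def
proof (intro allI impI)
  fix \<epsilon> :: real assume "0 < \<epsilon>"
  define e where "e = \<epsilon> / (\<bar>a\<bar> + \<bar>b\<bar> + 1)"
  have e: "0 < e" "\<bar>a\<bar> * e + \<bar>b\<bar> * e \<le> \<epsilon>"
  proof -
    show "0 < e" using \<open>0 < \<epsilon>\<close> by (simp add: e_def add_nonneg_pos)
    have "\<bar>a\<bar> * e + \<bar>b\<bar> * e \<le> (\<bar>a\<bar> + \<bar>b\<bar> + 1) * e" using \<open>0 < e\<close> by (simp add: distrib_right)
    also have "\<dots> = \<epsilon>" unfolding e_def by (simp add: add_nonneg_pos less_imp_neq[symmetric])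
    finally show "\<bar>a\<bar> * e + \<bar>b\<bar> * e \<le> \<epsilon>" .
  qed
  obtain F where F: "finite F" "F \<subseteq> L2 M"
    "\<And>h. h \<in> order_interval M w \<Longrightarrow> \<exists>g\<in>F. L2_norm M (\<lambda>x. kernel_op M s h x - g x) \<le> e"
    using sc[unfolded interval_compact_def, rule_format, OF e(1)] by blast
  obtain G where G: "finite G" "G \<subseteq> L2 M"
    "\<And>h. h \<in> order_interval M w \<Longrightarrow> \<exists>g\<in>G. L2_norm M (\<lambda>x. kernel_op M t h x - g x) \<le> e"
    using tc[unfolded interval_compact_def, rule_format, OF e(1)] by blast
  let ?c = "\<lambda>f g x. complex_of_real a * f x + complex_of_real b * g x :: complex"
  let ?H = "(\<lambda>(f, g). ?c f g) ` (F \<times> G)"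
  have "\<exists>g\<in>?H. L2_norm M (\<lambda>x. kernel_op M (\<lambda>x y. a * s x y + b * t x y) h x - g x) \<le> \<epsilon>"
    if h: "h \<in> order_interval M w" for h
  proof -
    obtain f where f: "f \<in> F" "L2_norm M (\<lambda>x. kernel_op M s h x - f x) \<le> e" using F(3)[OF h] by blast
    obtain g where g: "g \<in> G" "L2_norm M (\<lambda>x. kernel_op M t h x - g x) \<le> e" using G(3)[OF h] by blast
    have fg: "f \<in> L2 M" "g \<in> L2 M" using f g F G by auto
    let ?s = "\<lambda>x. kernel_op M s h x - f x" and ?t = "\<lambda>x. kernel_op M t h x - g x"
    have L: "?s \<in> L2 M" "?t \<in> L2 M"
      by (intro L2_diff interval_L2[OF s w h] interval_L2[OF t w h] fg)+
    have "L2_norm M (\<lambda>x. kernel_op M (\<lambda>x y. a * s x y + b * t x y) h x - ?c f g x)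
      = L2_norm M (\<lambda>x. complex_of_real a * ?s x + complex_of_real b * ?t x)"
    proof (rule L2_norm_cong_AE)
      show "(\<lambda>x. kernel_op M (\<lambda>x y. a * s x y + b * t x y) h x - ?c f g x) \<in> L2 M"
        by (intro L2_diff L2_add L2_scale fg interval_L2[OF mixed_finite_combine[OF s t w] w h])
      show "(\<lambda>x. complex_of_real a * ?s x + complex_of_real b * ?t x) \<in> L2 M"
        by (intro L2_add L2_scale L)
      show "AE x in M. kernel_op M (\<lambda>x y. a * s x y + b * t x y) h x - ?c f g x
         = complex_of_real a * ?s x + complex_of_real b * ?t x"
        using interval_linear[OF s t w h, of a b] by eventually_elim (simp add: algebra_simps)
    qed
    also have "\<dots> \<le> L2_norm M (\<lambda>x. complex_of_real a * ?s x) + L2_norm M (\<lambda>x. complex_of_real b * ?t x)"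
      by (intro L2_norm_add L2_scale L)
    also have "\<dots> = \<bar>a\<bar> * L2_norm M ?s + \<bar>b\<bar> * L2_norm M ?t"
      by (simp add: L2_norm_scale[OF L(1)] L2_norm_scale[OF L(2)])
    also have "\<dots> \<le> \<bar>a\<bar> * e + \<bar>b\<bar> * e" using f g by (intro add_mono mult_left_mono) auto
    also have "\<dots> \<le> \<epsilon>" by (rule e)
    finally show ?thesis using f g by (intro bexI[of _ "?c f g"]) auto
  qed
  moreover have "?H \<subseteq> L2 M" using F G by (auto intro!: L2_add L2_scale)
  ultimately show "\<exists>F. finite F \<and> F \<subseteq> L2 M \<and> (\<forall>h\<in>order_interval M w.
     \<exists>g\<in>F. L2_norm M (\<lambda>x. kernel_op M (\<lambda>x y. a * s x y + b * t x y) h x - g x) \<le> \<epsilon>)"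
    using F G by (intro exI[of _ ?H]) auto
qed

text \<open>Totally bounded images are stable under uniform approximation on the order interval.\<close>

lemma interval_compact_limit:
  assumes s: "mixed_finite M w s" and w: "w \<in> borel_measurable M"
    and t: "\<And>n::nat. mixed_finite M w (t n)" "\<And>n. interval_compact M w (t n)"
    and lim: "(\<lambda>n. mixed_norm2 M w (\<lambda>x y. s x y - t n x y)) \<longlonglongrightarrow> 0"
  shows "interval_compact M w s"
  unfolding interval_compact_def
proof (intro allI impI)
  fix \<epsilon> :: real assume \<epsilon>: "0 < \<epsilon>"
  have "\<forall>\<^sub>F n in sequentially. mixed_norm2 M w (\<lambda>x y. s x y - t n x y) < ennreal ((\<epsilon> / 2)\<^sup>2)"
    using \<epsilon> by (intro order_tendstoD(2)[OF lim]) simp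
  then obtain n where n: "mixed_norm2 M w (\<lambda>x y. s x y - t n x y) < ennreal ((\<epsilon> / 2)\<^sup>2)"
    using eventually_happens'[OF sequentially_bot] by blast
  obtain F where F: "finite F" "F \<subseteq> L2 M"
    "\<And>h. h \<in> order_interval M w \<Longrightarrow> \<exists>g\<in>F. L2_norm M (\<lambda>x. kernel_op M (t n) h x - g x) \<le> \<epsilon> / 2"
    using t(2)[of n, unfolded interval_compact_def, rule_format, OF half_gt_zero[OF \<epsilon>]] by blast
  have d: "mixed_finite M w (\<lambda>x y. s x y - t n x y)"
    using mixed_finite_combine[OF s t(1)[of n] w, of 1 "-1"] by simp
  have "\<exists>g\<in>F. L2_norm M (\<lambda>x. kernel_op M s h x - g x) \<le> \<epsilon>" if h: "h \<in> order_interval M w" for h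
  proof -
    obtain g where g: "g \<in> F" "L2_norm M (\<lambda>x. kernel_op M (t n) h x - g x) \<le> \<epsilon> / 2" using F(3)[OF h] by blast
    have gL: "g \<in> L2 M" using g F by auto
    let ?d = "kernel_op M (\<lambda>x y. s x y - t n x y) h" and ?t = "\<lambda>x. kernel_op M (t n) h x - g x"
    have L: "?d \<in> L2 M" "?t \<in> L2 M"
      by (intro interval_L2[OF d w h] L2_diff interval_L2[OF t(1) w h] gL)+
    have "ennreal ((L2_norm M ?d)\<^sup>2) < ennreal ((\<epsilon> / 2)\<^sup>2)"
      by (rule le_less_trans[OF interval_norm[OF d w h] n])
    then have "(L2_norm M ?d)\<^sup>2 < (\<epsilon> / 2)\<^sup>2" by (subst (asm) ennreal_less_iff) simp_all
    then have dn: "L2_norm M ?d \<le> \<epsilon> / 2"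
      by (rule power2_le_imp_le[OF less_imp_le]) (use \<epsilon> in simp)
    have "L2_norm M (\<lambda>x. kernel_op M s h x - g x) = L2_norm M (\<lambda>x. ?d x + ?t x)"
    proof (rule L2_norm_cong_AE)
      show "(\<lambda>x. kernel_op M s h x - g x) \<in> L2 M" by (intro L2_diff interval_L2[OF s w h] gL)
      show "(\<lambda>x. ?d x + ?t x) \<in> L2 M" by (intro L2_add L)
      show "AE x in M. kernel_op M s h x - g x = ?d x + ?t x"
        using interval_linear[OF s t(1)[of n] w h, of 1 "-1"] by eventually_elim simp
    qed
    also have "\<dots> \<le> L2_norm M ?d + L2_norm M ?t" by (intro L2_norm_add L)
    also have "\<dots> \<le> \<epsilon>" using dn g by simp
    finally show ?thesis using g by blast
  qed
  then show "\<exists>F. finite F \<and> F \<subseteq> L2 M \<and> (\<forall>h\<in>order_interval M w.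
     \<exists>g\<in>F. L2_norm M (\<lambda>x. kernel_op M s h x - g x) \<le> \<epsilon>)"
    using F by (intro exI[of _ F] conjI ballI)
qed

lemma mixed_norm2_monotone_limit:
  assumes s: "mixed_finite M w s" and w[measurable]: "w \<in> borel_measurable M"
    and t[measurable]: "\<And>n::nat. measurable_kernel M (t n)"
    and le: "\<And>n x y. x \<in> space M \<Longrightarrow> y \<in> space M \<Longrightarrow> 0 \<le> t n x y \<and> t n x y \<le> s x y"
    and lim: "\<And>x y. x \<in> space M \<Longrightarrow> y \<in> space M \<Longrightarrow> (\<lambda>n. t n x y) \<longlonglongrightarrow> s x y"
  shows "(\<lambda>n. mixed_norm2 M w (\<lambda>x y. s x y - t n x y)) \<longlonglongrightarrow> 0"
proof -
  note [measurable] = mixed_finite_measurable[OF s]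
  have dom: "ennreal \<bar>s x y - t n x y\<bar> * ennreal (w y) \<le> ennreal \<bar>s x y\<bar> * ennreal (w y)"
    if "x \<in> space M" "y \<in> space M" for n x y
    using le[OF that, of n] by (intro mult_right_mono ennreal_leI) auto
  have "(\<lambda>n. \<integral>\<^sup>+x. (\<integral>\<^sup>+y. ennreal \<bar>s x y - t n x y\<bar> * ennreal (w y) \<partial>M)\<^sup>2 \<partial>M) \<longlonglongrightarrow> (\<integral>\<^sup>+x. 0 \<partial>M)"
  proof (rule nn_integral_dominated_convergence)
    show "AE x in M. (\<integral>\<^sup>+y. ennreal \<bar>s x y - t n x y\<bar> * ennreal (w y) \<partial>M)\<^sup>2
       \<le> (\<integral>\<^sup>+y. ennreal \<bar>s x y\<bar> * ennreal (w y) \<partial>M)\<^sup>2" for n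
      by (intro AE_I2 power_mono nn_integral_mono dom) auto
    show "(\<integral>\<^sup>+x. (\<integral>\<^sup>+y. ennreal \<bar>s x y\<bar> * ennreal (w y) \<partial>M)\<^sup>2 \<partial>M) < \<infinity>"
      using s by (simp add: mixed_finite_def mixed_norm2_def)
    from mixed_finite_AE[OF s w] AE_space
    show "AE x in M. (\<lambda>n. (\<integral>\<^sup>+y. ennreal \<bar>s x y - t n x y\<bar> * ennreal (w y) \<partial>M)\<^sup>2) \<longlonglongrightarrow> 0"
    proof eventually_elim
      case (elim x)
      then have x[measurable]: "x \<in> space M" by simp
      have "(\<lambda>n. \<integral>\<^sup>+y. ennreal \<bar>s x y - t n x y\<bar> * ennreal (w y) \<partial>M) \<longlonglongrightarrow> (\<integral>\<^sup>+y. 0 \<partial>M)"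
      proof (rule nn_integral_dominated_convergence)
        show "AE y in M. ennreal \<bar>s x y - t n x y\<bar> * ennreal (w y) \<le> ennreal \<bar>s x y\<bar> * ennreal (w y)" for n
          by (intro AE_I2 dom x)
        show "(\<integral>\<^sup>+y. ennreal \<bar>s x y\<bar> * ennreal (w y) \<partial>M) < \<infinity>" using elim by simp
        show "AE y in M. (\<lambda>n. ennreal \<bar>s x y - t n x y\<bar> * ennreal (w y)) \<longlonglongrightarrow> 0"
        proof (rule AE_I2)
          fix y assume y: "y \<in> space M"
          have "(\<lambda>n. \<bar>s x y - t n x y\<bar> * w y) \<longlonglongrightarrow> \<bar>s x y - s x y\<bar> * w y"
            by (intro tendsto_intros lim x y)
          then have "(\<lambda>n. ennreal (\<bar>s x y - t n x y\<bar> * w y)) \<longlonglongrightarrow> ennreal 0"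
            by (intro tendsto_ennrealI) simp
          then show "(\<lambda>n. ennreal \<bar>s x y - t n x y\<bar> * ennreal (w y)) \<longlonglongrightarrow> 0"
            by (simp add: ennreal_mult')
        qed
      qed measurable
      then have "(\<lambda>n. (\<integral>\<^sup>+y. ennreal \<bar>s x y - t n x y\<bar> * ennreal (w y) \<partial>M) * (\<integral>\<^sup>+y. ennreal \<bar>s x y - t n x y\<bar> * ennreal (w y) \<partial>M)) \<longlonglongrightarrow> 0 * 0"
        by (intro tendsto_mult_ennreal) auto
      then show ?case by (simp add: power2_eq_square)
    qed
  qed measurable
  then show ?thesis by (simp add: mixed_norm2_def)
qed

text \<open>The operator has rank at most one: it maps \<open>h\<close> to a multiple of the indicator of \<open>A\<close>, with a coefficient
  in a fixed compact disc.\<close>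

lemma interval_compact_rectangle:
  assumes w[measurable]: "w \<in> borel_measurable M" and Y[measurable]: "Y \<in> sets M" "emeasure M Y < \<infinity>"
    and m: "0 \<le> m" "\<And>x. x \<in> Y \<Longrightarrow> w x \<le> m"
    and A[measurable]: "A \<in> sets M" "A \<subseteq> Y" and B[measurable]: "B \<in> sets M" "B \<subseteq> Y"
  shows "interval_compact M w (\<lambda>x y. indicator (A \<times> B) (x, y))"
  unfolding interval_compact_def
proof (intro allI impI)
  fix \<epsilon> :: real assume \<epsilon>: "0 < \<epsilon>"
  have Afin: "emeasure M A < \<infinity>" by (rule le_less_trans[OF emeasure_mono[OF A(2) Y(1)] Y(2)])
  define q where "q = sqrt (measure M A)"
  define e where "e = \<epsilon> / (q + 1)"
  have q: "0 \<le> q" by (simp add: q_def)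
  then have e: "0 < e" "e * q \<le> \<epsilon>" using \<epsilon> by (auto simp: e_def field_simps)
  define r where "r = m * measure M Y"
  obtain K where K: "finite K" "cball (0::complex) r \<subseteq> (\<Union>c\<in>K. ball c e)"
    using compact_cball[of "0::complex" r] e(1) unfolding compact_eq_totally_bounded by blast
  have ind: "(\<lambda>x. indicator A x * c) \<in> L2 M \<and> L2_norm M (\<lambda>x. indicator A x * c) = norm c * q" for c :: complex
  proof -
    have eq: "(norm (indicator A x * c))\<^sup>2 = (norm c)\<^sup>2 * indicator A x" for x
      by (auto simp: indicator_def)
    have "integrable M (\<lambda>x. (norm c)\<^sup>2 * indicator A x :: real)" using Afin by simp
    then show ?thesis
      by (auto simp: L2_def L2_norm_def eq q_def real_sqrt_mult)
  qed
  have "\<exists>g\<in>(\<lambda>c x. indicator A x * c) ` K.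
      L2_norm M (\<lambda>x. kernel_op M (\<lambda>x y. indicator (A \<times> B) (x, y)) h x - g x) \<le> \<epsilon>"
    if h: "h \<in> order_interval M w" for h
  proof -
    note [measurable] = order_interval_measurable[OF h]
    define c where "c = (LINT y|M. indicator B y * h y)"
    have le: "norm (indicator B y * h y) \<le> m * indicator Y y" for y
      using h m B by (auto simp: order_interval_def indicator_def norm_mult intro: order_trans)
    have int: "integrable M (\<lambda>y. m * indicator Y y)" using Y by simp
    have int': "integrable M (\<lambda>y. indicator B y * h y)"
      by (rule Bochner_Integration.integrable_bound[OF int])
        (use le m in \<open>auto intro!: AE_I2 simp: abs_mult\<close>)
    have "norm c \<le> (LINT y|M. norm (indicator B y * h y))"
      unfolding c_def by (rule integral_norm_bound)
    also have "\<dots> \<le> (LINT y|M. m * indicator Y y)"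
      by (rule integral_mono[OF integrable_norm[OF int'] int le])
    finally have "norm c \<le> (LINT y|M. m * indicator Y y)" .
    then have "c \<in> cball 0 r" using Y by (simp add: r_def)
    then obtain c' where c': "c' \<in> K" "dist c' c < e" using K by auto
    have "kernel_op M (\<lambda>x y. indicator (A \<times> B) (x, y)) h x = indicator A x * c" for x
      unfolding kernel_op_def c_def integral_mult_right_zero[symmetric]
      by (intro Bochner_Integration.integral_cong) (auto simp: indicator_def)
    then have "L2_norm M (\<lambda>x. kernel_op M (\<lambda>x y. indicator (A \<times> B) (x, y)) h x - indicator A x * c')
      = norm (c - c') * q"
      using ind[of "c - c'"] by (simp add: right_diff_distrib)
    also have "\<dots> \<le> e * q" using c' q by (intro mult_right_mono) (auto simp: dist_norm norm_minus_commute)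
    also have "\<dots> \<le> \<epsilon>" by (rule e)
    finally have "L2_norm M (\<lambda>x. kernel_op M (\<lambda>x y. indicator (A \<times> B) (x, y)) h x - indicator A x * c') \<le> \<epsilon>" .
    moreover have "(\<lambda>x. indicator A x * c') \<in> (\<lambda>c x. indicator A x * c) ` K"
      using c'(1) by (rule imageI)
    ultimately show ?thesis by (rule bexI)
  qed
  then show "\<exists>F. finite F \<and> F \<subseteq> L2 M \<and> (\<forall>h\<in>order_interval M w.
     \<exists>g\<in>F. L2_norm M (\<lambda>x. kernel_op M (\<lambda>x y. indicator (A \<times> B) (x, y)) h x - g x) \<le> \<epsilon>)"
    using K ind by (intro exI[of _ "(\<lambda>c x. indicator A x * c) ` K"]) auto
qed

lemma mixed_finite_box:
  assumes w[measurable]: "w \<in> borel_measurable M" and Y[measurable]: "Y \<in> sets M" "emeasure M Y < \<infinity>"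
    and m: "0 \<le> m" "\<And>x. x \<in> Y \<Longrightarrow> w x \<le> m"
    and E[measurable]: "E \<in> sets (M \<Otimes>\<^sub>M M)" and "E \<subseteq> Y \<times> Y"
  shows "mixed_finite M w (\<lambda>x y. indicator E (x, y))"
proof -
  have "mixed_norm2 M w (\<lambda>x y. indicator E (x, y))
      \<le> (\<integral>\<^sup>+x. ((ennreal m * emeasure M Y) * indicator Y x)\<^sup>2 \<partial>M)"
    unfolding mixed_norm2_def
  proof (intro nn_integral_mono power_mono)
    fix x
    have "(\<integral>\<^sup>+y. ennreal \<bar>indicator E (x, y)\<bar> * ennreal (w y) \<partial>M) \<le> (\<integral>\<^sup>+y. (ennreal m * indicator Y x) * indicator Y y \<partial>M)"
      using assms(7) m by (intro nn_integral_mono) (auto simp: indicator_def intro!: ennreal_leI)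
    also have "\<dots> = (ennreal m * emeasure M Y) * indicator Y x"
      by (subst nn_integral_cmult_indicator) (simp_all add: ac_simps)
    finally show "(\<integral>\<^sup>+y. ennreal \<bar>indicator E (x, y)\<bar> * ennreal (w y) \<partial>M) \<le> (ennreal m * emeasure M Y) * indicator Y x" .
  qed auto
  also have "\<dots> = (\<integral>\<^sup>+x. (ennreal m * emeasure M Y)\<^sup>2 * indicator Y x \<partial>M)"
    by (intro nn_integral_cong) (auto simp: indicator_def)
  also have "\<dots> = (ennreal m * emeasure M Y)\<^sup>2 * emeasure M Y" by (simp add: nn_integral_cmult_indicator)
  also have "\<dots> < \<infinity>" using Y by (simp add: ennreal_mult_less_top power_less_top_ennreal)
  finally show ?thesis by (simp add: mixed_finite_def)
qed

text \<open>The sets \<open>E\<close> with this property contain the rectangles and, by linearity and monotone limits, are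
  closed under complements and disjoint unions.\<close>

lemma interval_compact_box:
  assumes w[measurable]: "w \<in> borel_measurable M" and Y[measurable]: "Y \<in> sets M" "emeasure M Y < \<infinity>"
    and m: "0 \<le> m" "\<And>x. x \<in> Y \<Longrightarrow> w x \<le> m"
    and E: "E \<in> sets (M \<Otimes>\<^sub>M M)"
  shows "interval_compact M w (\<lambda>x y. indicator (E \<inter> Y \<times> Y) (x, y))"
proof -
  have fin: "mixed_finite M w (\<lambda>x y. indicator (E \<inter> Y \<times> Y) (x, y))" if [measurable]: "E \<in> sets (M \<Otimes>\<^sub>M M)" for E
    by (rule mixed_finite_box[OF w Y m]) auto
  have rect: "interval_compact M w (\<lambda>x y. indicator ((A \<times> B) \<inter> Y \<times> Y) (x, y))"
    if [measurable]: "A \<in> sets M" "B \<in> sets M" for A B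
    using interval_compact_rectangle[OF w Y m, of "A \<inter> Y" "B \<inter> Y"] by (simp add: Times_Int_Times)
  show ?thesis
    using Int_stable_pair_measure_generator[of M M] pair_measure_closed[of M M] E[unfolded sets_pair_measure]
  proof (induct rule: sigma_sets_induct_disjoint)
    case (basic E)
    then show ?case using rect by auto
  next
    case empty
    then show ?case using rect[of "{}" "{}"] by simp
  next
    case (compl E)
    then have [measurable]: "E \<in> sets (M \<Otimes>\<^sub>M M)" by (simp add: sets_pair_measure)
    have top: "interval_compact M w (\<lambda>x y. indicator ((space M \<times> space M) \<inter> Y \<times> Y) (x, y))"
      by (rule rect) auto
    have "interval_compact M w (\<lambda>x y. 1 * indicator ((space M \<times> space M) \<inter> Y \<times> Y) (x, y)
        + (-1) * indicator (E \<inter> Y \<times> Y) (x, y))"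
      by (intro interval_compact_combine fin w top compl(2)) auto
    moreover have "(\<lambda>x y. 1 * indicator ((space M \<times> space M) \<inter> Y \<times> Y) (x, y)
        + (-1) * indicator (E \<inter> Y \<times> Y) (x, y) :: real) = (\<lambda>x y. indicator ((space M \<times> space M - E) \<inter> Y \<times> Y) (x, y))"
      using sets.sets_into_space[of E "M \<Otimes>\<^sub>M M"]
      by (auto simp: fun_eq_iff indicator_def space_pair_measure)
    ultimately show ?case by simp
  next
    case (union A)
    then have [measurable]: "A i \<in> sets (M \<Otimes>\<^sub>M M)" for i by (auto simp: sets_pair_measure)
    have part: "interval_compact M w (\<lambda>x y. indicator ((\<Union>i<n. A i) \<inter> Y \<times> Y) (x, y))" for n :: nat
    proof (induction n)
      case 0
      then show ?case using rect[of "{}" "{}"] by simp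
    next
      case (Suc n)
      have "interval_compact M w (\<lambda>x y. 1 * indicator ((\<Union>i<n. A i) \<inter> Y \<times> Y) (x, y)
          + 1 * indicator (A n \<inter> Y \<times> Y) (x, y))"
        by (intro interval_compact_combine fin w Suc union(3)) auto
      moreover have "(\<lambda>x y. 1 * indicator ((\<Union>i<n. A i) \<inter> Y \<times> Y) (x, y)
          + 1 * indicator (A n \<inter> Y \<times> Y) (x, y) :: real) = (\<lambda>x y. indicator ((\<Union>i<Suc n. A i) \<inter> Y \<times> Y) (x, y))"
      proof (intro ext)
        fix x y
        have "(x, y) \<notin> A i" if "(x, y) \<in> A n" "i < n" for i
          using disjoint_family_onD[OF union(1), of i n] that by auto
        then show "1 * indicator ((\<Union>i<n. A i) \<inter> Y \<times> Y) (x, y)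
          + 1 * indicator (A n \<inter> Y \<times> Y) (x, y) = (indicator ((\<Union>i<Suc n. A i) \<inter> Y \<times> Y) (x, y) :: real)"
          by (auto simp: indicator_def less_Suc_eq)
      qed
      ultimately show ?case by simp
    qed
    show ?case
    proof (rule interval_compact_limit[OF fin w fin part mixed_norm2_monotone_limit[OF fin w]])
      fix x y
      show "(\<lambda>n. indicator ((\<Union>i<n. A i) \<inter> Y \<times> Y) (x, y) :: real) \<longlonglongrightarrow> indicator ((\<Union>i. A i) \<inter> Y \<times> Y) (x, y)"
      proof (cases "\<exists>j. (x, y) \<in> A j")
        case True
        then obtain j where j: "(x, y) \<in> A j" by blast
        have "\<forall>\<^sub>F n in sequentially. indicator ((\<Union>i<n. A i) \<inter> Y \<times> Y) (x, y)
          = (indicator ((\<Union>i. A i) \<inter> Y \<times> Y) (x, y) :: real)"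
          using j by (intro eventually_sequentiallyI[of "Suc j"]) (auto simp: indicator_def)
        then show ?thesis by (rule tendsto_eventually)
      next
        case False
        then show ?thesis by (simp add: indicator_def)
      qed
    qed (auto simp: indicator_def)
  qed
qed

text \<open>Kernels are monotone limits of simple functions.  A set of pairs is in turn exhausted by its
  intersections with squares of sets of finite measure on which \<open>w\<close> is bounded.\<close>

lemma interval_compact_nonneg:
  assumes w[measurable]: "w \<in> borel_measurable M" and nn: "\<And>x y. 0 \<le> s x y" and s: "mixed_finite M w s"
  shows "interval_compact M w s"
proof -
  obtain X :: "nat \<Rightarrow> 'a set" where X: "range X \<subseteq> sets M" "(\<Union>i. X i) = space M"
    "\<And>i. emeasure M (X i) \<noteq> \<infinity>" "incseq X"
    using sigma_finite_incseq by metis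
  then have [measurable]: "X i \<in> sets M" for i by auto
  define Y where "Y n = {x \<in> X n. w x \<le> real n}" for n
  have Y_eq: "Y n = X n \<inter> {x \<in> space M. w x \<le> real n}" for n
    using X by (auto simp: Y_def)
  have Ym[measurable]: "Y n \<in> sets M" for n unfolding Y_eq by measurable
  have Yfin: "emeasure M (Y n) < \<infinity>" for n
    using emeasure_mono[of "Y n" "X n" M] X(3)[of n] by (auto simp: Y_eq less_top intro: le_less_trans)
  have Yin: "\<forall>\<^sub>F n in sequentially. x \<in> Y n" if x: "x \<in> space M" for x
  proof -
    obtain i where i: "x \<in> X i" using X x by blast
    obtain j where j: "w x \<le> real j" using real_arch_simple by blast
    show ?thesis
    proof (rule eventually_sequentiallyI[of "max i j"])
      fix n assume n: "max i j \<le> n"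
      then have "x \<in> X n" using i X(4) by (meson incseqD max.boundedE subsetD)
      then show "x \<in> Y n" using n j by (auto simp: Y_def)
    qed
  qed
  have box: "interval_compact M w (\<lambda>x y. indicator (E \<inter> Y n \<times> Y n) (x, y))"
    "mixed_finite M w (\<lambda>x y. indicator (E \<inter> Y n \<times> Y n) (x, y))"
    if [measurable]: "E \<in> sets (M \<Otimes>\<^sub>M M)" for E n
    by (rule interval_compact_box[OF w Ym Yfin, of "real n"], auto simp: Y_def)
       (rule mixed_finite_box[OF w Ym Yfin, of "real n"], auto simp: Y_def)
  have "mixed_finite M w (\<lambda>x y. u (x, y)) \<longrightarrow> interval_compact M w (\<lambda>x y. u (x, y))"
    if "u \<in> borel_measurable (M \<Otimes>\<^sub>M M)" "\<And>p. 0 \<le> u p" for u :: "'a \<times> 'a \<Rightarrow> real"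
    using that
  proof (induction u rule: borel_measurable_induct_real)
    case (set E)
    then have [measurable]: "E \<in> sets (M \<Otimes>\<^sub>M M)" .
    show ?case
    proof
      assume fin: "mixed_finite M w (\<lambda>x y. indicator E (x, y))"
      show "interval_compact M w (\<lambda>x y. indicator E (x, y))"
      proof (rule interval_compact_limit[OF fin w box(2) box(1) mixed_norm2_monotone_limit[OF fin w]])
        fix x y assume "x \<in> space M" "y \<in> space M"
        from Yin[OF this(1)] Yin[OF this(2)]
        have "\<forall>\<^sub>F n in sequentially. indicator (E \<inter> Y n \<times> Y n) (x, y) = (indicator E (x, y) :: real)"
          by eventually_elim (auto simp: indicator_def)
        then show "(\<lambda>n. indicator (E \<inter> Y n \<times> Y n) (x, y) :: real) \<longlonglongrightarrow> indicator E (x, y)"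
          by (rule tendsto_eventually)
      qed (auto simp: indicator_def)
    qed
  next
    case (mult u c)
    show ?case
    proof
      assume fin: "mixed_finite M w (\<lambda>x y. c * u (x, y))"
      show "interval_compact M w (\<lambda>x y. c * u (x, y))"
      proof (cases "c = 0")
        case True
        then show ?thesis using box(1)[of "{}" 0] by simp
      next
        case False
        have u: "mixed_finite M w (\<lambda>x y. u (x, y))"
          using mixed_finite_combine[OF fin fin w, of "1 / c" 0] False by simp
        then have "interval_compact M w (\<lambda>x y. c * u (x, y) + 0 * u (x, y))"
          using mult by (intro interval_compact_combine u w) auto
        then show ?thesis by simp
      qed
    qed
  next
    case (add u v)
    note [measurable] = add(1,3)
    show ?case
    proof
      assume fin: "mixed_finite M w (\<lambda>x y. v (x, y) + u (x, y))"
      have "mixed_norm2 M w (\<lambda>x y. u (x, y)) \<le> mixed_norm2 M w (\<lambda>x y. v (x, y) + u (x, y))"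
        "mixed_norm2 M w (\<lambda>x y. v (x, y)) \<le> mixed_norm2 M w (\<lambda>x y. v (x, y) + u (x, y))"
        using add(2,4) by (auto intro!: mixed_norm2_mono simp: abs_of_nonneg)
      then have u: "mixed_finite M w (\<lambda>x y. u (x, y))" and v: "mixed_finite M w (\<lambda>x y. v (x, y))"
        using fin by (auto simp: mixed_finite_def le_less_trans)
      then have "interval_compact M w (\<lambda>x y. 1 * v (x, y) + 1 * u (x, y))"
        using add by (intro interval_compact_combine u v w) auto
      then show "interval_compact M w (\<lambda>x y. v (x, y) + u (x, y))" by simp
    qed
  next
    case (seq V)
    note [measurable] = seq(1)
    show ?case
    proof
      assume fin: "mixed_finite M w (\<lambda>x y. u (x, y))"
      have le: "V n (x, y) \<le> u (x, y)" if "x \<in> space M" "y \<in> space M" for n x y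
      proof (rule incseq_le)
        show "incseq (\<lambda>n. V n (x, y))" using seq(3) by (auto simp: incseq_def le_fun_def)
        show "(\<lambda>n. V n (x, y)) \<longlonglongrightarrow> u (x, y)" using that by (intro seq(4)) (simp add: space_pair_measure)
      qed
      have V: "mixed_finite M w (\<lambda>x y. V n (x, y))" for n
      proof -
        have "mixed_norm2 M w (\<lambda>x y. V n (x, y)) \<le> mixed_norm2 M w (\<lambda>x y. u (x, y))"
          unfolding mixed_norm2_def
          using le seq(2) by (intro nn_integral_mono power_mono mult_right_mono ennreal_leI)
            (auto intro: order_trans[OF le abs_ge_self])
        then show ?thesis using fin by (auto simp: mixed_finite_def le_less_trans)
      qed
      show "interval_compact M w (\<lambda>x y. u (x, y))"
      proof (rule interval_compact_limit[OF fin w V _ mixed_norm2_monotone_limit[OF fin w]])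
        show "interval_compact M w (\<lambda>x y. V n (x, y))" for n using seq(5) V by blast
        fix x y assume "x \<in> space M" "y \<in> space M"
        then show "(\<lambda>n. V n (x, y)) \<longlonglongrightarrow> u (x, y)" by (intro seq(4)) (simp add: space_pair_measure)
      qed (use le seq(2) in auto)
    qed
  qed
  from this[of "\<lambda>(x, y). s x y"] show ?thesis
    using s nn by (auto simp: mixed_finite_def split_beta')
qed

end

section \<open>The measure of noncompactness of a positive kernel operator\<close>

context sigma_finite_measure
begin

lemma form_add_right:
  assumes [measurable]: "measurable_kernel M k" "f \<in> borel_measurable M"
    "g \<in> borel_measurable M" "h \<in> borel_measurable M"
  shows "form M k f (\<lambda>x. g x + h x) = form M k f g + form M k f h"
  unfolding form_def by (simp add: distrib_left nn_integral_add)

text \<open>The sum of the moduli of the finitely many centres serves as \<open>u\<close>, and \<open>v = 0\<close>.\<close>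

lemma dominated_of_covered:
  assumes k: "pos_kernel M k" and \<delta>: "finitely_covered M (kernel_op M k) \<delta>"
  shows "dominated M (nn_L2 M) k \<delta>"
proof -
  note [measurable] = pos_kernelD(1)[OF k]
  obtain F where F: "finite F" "F \<subseteq> L2 M"
    "\<And>f. f \<in> L2 M \<Longrightarrow> L2_norm M f \<le> 1 \<Longrightarrow> \<exists>g\<in>F. L2_norm M (\<lambda>x. kernel_op M k f x - g x) \<le> \<delta>"
    and pos: "0 < \<delta>"
    using \<delta> by (auto simp: finitely_covered_def)
  define u where "u = (\<lambda>x. \<Sum>g\<in>F. nn_abs g x)"
  have "(\<lambda>x. \<Sum>g\<in>G. nn_abs g x) \<in> nn_L2 M" if "finite G" "G \<subseteq> L2 M" for G
    using that
  proof (induction G)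
    case empty
    then show ?case using nn_cone_L2[of M] by (simp add: nn_cone_def)
  next
    case (insert g G)
    then have "(\<lambda>x. ennreal 1 * nn_abs g x + ennreal 1 * (\<Sum>g\<in>G. nn_abs g x)) \<in> nn_L2 M"
      using nn_cone_L2[of M] nn_abs_L2[of g M] unfolding nn_cone_def by (meson insert_subset zero_le_one)
    then show ?case by (simp only: sum.insert[OF insert(1,2)] ennreal_1 mult_1)
  qed
  then have u: "u \<in> nn_L2 M" unfolding u_def using F by blast
  then have [measurable]: "u \<in> borel_measurable M" by (simp add: nn_L2_def)
  have "form M k f h \<le> ennreal \<delta> + (\<integral>\<^sup>+x. f x * 0 \<partial>M) + (\<integral>\<^sup>+x. h x * u x \<partial>M)"
    if f: "f \<in> nn_ball M" and h: "h \<in> nn_ball M" for f h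
  proof -
    have [measurable]: "h \<in> borel_measurable M" using h by (simp add: nn_ball_def)
    let ?f = "\<lambda>x. complex_of_real (enn2real (f x))"
    note f' = nn_ball_complex[OF f]
    obtain g where g: "g \<in> F" "L2_norm M (\<lambda>x. kernel_op M k ?f x - g x) \<le> \<delta>"
      using F(3)[OF f'(1,2)] by blast
    have gL: "g \<in> L2 M" using g F by auto
    note [measurable] = L2_measurable[OF gL] L2_measurable[OF f'(1)]
    let ?d = "\<lambda>x. kernel_op M k ?f x - g x"
    have dL: "?d \<in> L2 M" by (intro L2_diff kernel_op_L2 k f' gL)
    have act: "act M k f x = act M k (\<lambda>x. ennreal (enn2real (f x))) x" for x
      by (rule act_cong_AE) (use f'(3) in auto)
    have "form M k f h \<le> (\<integral>\<^sup>+x. nn_abs ?d x * h x + h x * nn_abs g x \<partial>M)"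
      unfolding form_def
    proof (rule nn_integral_mono_AE)
      show "AE x in M. act M k f x * h x \<le> nn_abs ?d x * h x + h x * nn_abs g x"
        using kernel_op_real[OF k f'(1) enn2real_nonneg]
      proof eventually_elim
        case (elim x)
        have "norm (kernel_op M k ?f x) \<le> norm (?d x) + norm (g x)"
          using norm_triangle_ineq[of "?d x" "g x"] by simp
        then have le: "nn_abs (kernel_op M k ?f) x \<le> ennreal (norm (?d x) + norm (g x))"
          by (rule ennreal_leI)
        have "act M k f x = nn_abs (kernel_op M k ?f) x" using elim by (simp only: act)
        also note le
        also have "ennreal (norm (?d x) + norm (g x)) = nn_abs ?d x + nn_abs g x"
          by (rule ennreal_plus) auto
        finally have "act M k f x \<le> nn_abs ?d x + nn_abs g x" .
        then have "h x * act M k f x \<le> h x * (nn_abs ?d x + nn_abs g x)"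
          by (rule mult_left_mono) simp
        then show ?case by (simp only: distrib_left mult.commute[of _ "h x"])
      qed
    qed
    also have "\<dots> = (\<integral>\<^sup>+x. nn_abs ?d x * h x \<partial>M) + (\<integral>\<^sup>+x. h x * nn_abs g x \<partial>M)"
      by (rule nn_integral_add) measurable
    also have "\<dots> \<le> ennreal (\<delta> * 1) + (\<integral>\<^sup>+x. h x * u x \<partial>M)"
    proof (intro add_mono nn_cauchy_schwarz nn_integral_mono mult_left_mono)
      show "(\<integral>\<^sup>+x. (nn_abs ?d x)\<^sup>2 \<partial>M) \<le> ennreal (\<delta>\<^sup>2)"
        using g pos by (simp flip: L2_norm_le_iff[OF dL])
      show "nn_abs g x \<le> u x" for x unfolding u_def using g F by (intro member_le_sum) auto
    qed (use h pos in \<open>auto simp: nn_ball_def\<close>)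
    finally show ?thesis by simp
  qed
  moreover have "(\<lambda>_. 0) \<in> nn_L2 M" by (simp add: nn_L2_def)
  ultimately show ?thesis unfolding dominated_def using u pos
    by (intro conjI bexI[of _ u] bexI[of _ "\<lambda>_. 0"]) auto
qed

text \<open>Let \<open>a\<close> be the image of \<open>u\<close> under the transposed operator.  A function \<open>f\<close> of the unit ball is cut
  at the height \<open>w = N\<^sup>2 (v + a)\<close>.  The lower part stays in an order interval, whose image is totally
  bounded.  On the upper part \<open>f2\<close>, where \<open>v + a\<close> is at most \<open>\<bar>f\<bar> / N\<^sup>2\<close>, the integral of
  \<open>(v + a) \<bar>f2\<bar>\<close> is at most \<open>1 / N\<^sup>2\<close>.  A test function \<open>g\<close> is cut at the height \<open>N u\<close>: below it, the
  form is at most \<open>N\<close> times the integral of \<open>a \<bar>f2\<bar>\<close>, hence at most \<open>1 / N\<close>; above it, the hypothesis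
  applies and the integral of \<open>g u\<close> is at most \<open>1 / N\<close>.  So the image of \<open>f2\<close> has norm at most
  \<open>\<delta> + 3 / N\<close>.\<close>

lemma covered_of_dominated:
  assumes k: "pos_kernel M k" and \<delta>: "dominated M (nn_L2 M) k \<delta>" and \<epsilon>: "0 < \<epsilon>"
  shows "finitely_covered M (kernel_op M k) (\<delta> + \<epsilon>)"
proof -
  note [measurable] = pos_kernelD(1)[OF k]
  have \<delta>0: "0 \<le> \<delta>" using \<delta> by (simp add: dominated_def)
  obtain u v where uv: "u \<in> nn_L2 M" "v \<in> nn_L2 M" and dom: "\<And>f g. f \<in> nn_ball M \<Longrightarrow> g \<in> nn_ball M \<Longrightarrow>
     form M k f g \<le> ennreal \<delta> + (\<integral>\<^sup>+x. f x * v x \<partial>M) + (\<integral>\<^sup>+x. g x * u x \<partial>M)"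
    using \<delta> unfolding dominated_def by blast
  have [measurable]: "u \<in> borel_measurable M" "v \<in> borel_measurable M"
    using uv by (auto simp: nn_L2_def)
  define a where "a = act M (kernel_adjoint k) u"
  have [measurable]: "a \<in> borel_measurable M" unfolding a_def by measurable
  have "a \<in> nn_L2 M"
    unfolding a_def nn_L2_def using pos_kernel_act_finite[OF pos_kernel_adjoint[OF k], of u] uv
    by (auto simp: nn_L2_def)
  then have "(\<lambda>x. ennreal 1 * v x + ennreal 1 * a x) \<in> nn_L2 M"
    using nn_cone_L2[of M] uv unfolding nn_cone_def by (meson zero_le_one)
  then have wL: "(\<lambda>x. v x + a x) \<in> nn_L2 M" by simp
  (* Chosen such that 3 / N is at most half of the admissible error. *)
  define N where "N = 6 / \<epsilon> + 1"
  have N: "1 \<le> N" "3 / N \<le> \<epsilon> / 2" using \<epsilon> by (auto simp: N_def field_simps)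
  define w where "w x = N\<^sup>2 * enn2real (v x + a x)" for x
  have w[measurable]: "w \<in> borel_measurable M" unfolding w_def by measurable
  have wnn: "0 \<le> w x" for x by (simp add: w_def)
  have wfin: "AE x in M. v x + a x < \<infinity>" by (rule L2_finite_AE) (use wL in \<open>auto simp: nn_L2_def\<close>)
  have mf: "mixed_finite M w k"
  proof -
    have "(\<integral>\<^sup>+x. (ennreal (w x))\<^sup>2 \<partial>M) = (\<integral>\<^sup>+x. ennreal (N ^ 4) * (v x + a x)\<^sup>2 \<partial>M)"
    proof (rule nn_integral_cong_AE)
      show "AE x in M. (ennreal (w x))\<^sup>2 = ennreal (N ^ 4) * (v x + a x)\<^sup>2"
        using wfin
      proof eventually_elim
        case (elim x)
        have "(ennreal (w x))\<^sup>2 = ennreal (N ^ 4) * (ennreal (enn2real (v x + a x)))\<^sup>2"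
          by (simp add: w_def ennreal_power power_mult_distrib flip: ennreal_mult power_mult)
        then show ?case using elim by simp
      qed
    qed
    also have "\<dots> < \<infinity>" using wL by (simp add: nn_integral_cmult nn_L2_def ennreal_mult_less_top)
    finally have "(\<integral>\<^sup>+x. (act M k (\<lambda>x. ennreal (w x)) x)\<^sup>2 \<partial>M) < \<infinity>"
      by (intro pos_kernel_act_finite k) auto
    then show ?thesis by (simp add: mixed_finite_def mixed_norm2_def act_def pos_kernelD[OF k])
  qed
  obtain F where F: "finite F" "F \<subseteq> L2 M"
    "\<And>h. h \<in> order_interval M w \<Longrightarrow> \<exists>g\<in>F. L2_norm M (\<lambda>x. kernel_op M k h x - g x) \<le> \<epsilon> / 2"
    using interval_compact_nonneg[OF w pos_kernelD(2)[OF k] mf, unfolded interval_compact_def,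
        rule_format, OF half_gt_zero[OF \<epsilon>]] by blast
  have "\<exists>g\<in>F. L2_norm M (\<lambda>x. kernel_op M k f x - g x) \<le> \<delta> + \<epsilon>"
    if f: "f \<in> L2 M" "L2_norm M f \<le> 1" for f
  proof -
    note fm[measurable] = L2_measurable[OF f(1)]
    define f1 where "f1 x = (if norm (f x) \<le> w x then f x else 0)" for x
    define f2 where "f2 x = (if norm (f x) \<le> w x then 0 else f x)" for x
    have [measurable]: "f1 \<in> borel_measurable M" "f2 \<in> borel_measurable M"
      unfolding f1_def f2_def by measurable
    have f1: "f1 \<in> order_interval M w" using wnn by (simp add: order_interval_def f1_def)
    have fnn: "(\<integral>\<^sup>+x. (nn_abs f x)\<^sup>2 \<partial>M) \<le> 1" using f L2_norm_le_iff[OF f(1), of 1] by simp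
    have "(\<integral>\<^sup>+x. (nn_abs f2 x)\<^sup>2 \<partial>M) \<le> (\<integral>\<^sup>+x. (nn_abs f x)\<^sup>2 \<partial>M)"
      "(\<integral>\<^sup>+x. (nn_abs f1 x)\<^sup>2 \<partial>M) \<le> (\<integral>\<^sup>+x. (nn_abs f x)\<^sup>2 \<partial>M)"
      by (intro nn_integral_mono power_mono, auto simp: f2_def f1_def)+
    then have le: "(\<integral>\<^sup>+x. (nn_abs f2 x)\<^sup>2 \<partial>M) \<le> 1" "(\<integral>\<^sup>+x. (nn_abs f1 x)\<^sup>2 \<partial>M) \<le> 1"
      using fnn by (auto intro: order_trans)
    have f2L: "f2 \<in> L2 M" and f1L: "f1 \<in> L2 M" using le by (auto simp: L2_iff intro: le_less_trans)
    have f2b: "nn_abs f2 \<in> nn_ball M" using le by (simp add: nn_ball_def)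
    have small: "(\<integral>\<^sup>+x. (v x + a x) * nn_abs f2 x \<partial>M) \<le> ennreal (1 / N\<^sup>2)"
    proof -
      have "(\<integral>\<^sup>+x. (v x + a x) * nn_abs f2 x \<partial>M) \<le> (\<integral>\<^sup>+x. ennreal (1 / N\<^sup>2) * (nn_abs f x)\<^sup>2 \<partial>M)"
      proof (rule nn_integral_mono_AE)
        show "AE x in M. (v x + a x) * nn_abs f2 x \<le> ennreal (1 / N\<^sup>2) * (nn_abs f x)\<^sup>2"
          using wfin
        proof eventually_elim
          case (elim x)
          show ?case
          proof (cases "norm (f x) \<le> w x")
            case True then show ?thesis by (simp add: f2_def)
          next
            case False
            then have "enn2real (v x + a x) \<le> 1 / N\<^sup>2 * norm (f x)"
              using N by (simp add: w_def field_simps)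
            then have "ennreal (enn2real (v x + a x)) \<le> ennreal (1 / N\<^sup>2 * norm (f x))"
              by (rule ennreal_leI)
            moreover have "ennreal (enn2real (v x + a x)) = v x + a x"
              using elim by (intro ennreal_enn2real) simp
            moreover have "ennreal (1 / N\<^sup>2 * norm (f x)) = ennreal (1 / N\<^sup>2) * nn_abs f x"
              by (rule ennreal_mult) auto
            ultimately have "v x + a x \<le> ennreal (1 / N\<^sup>2) * nn_abs f x" by (simp only:)
            then have "(v x + a x) * nn_abs f x \<le> ennreal (1 / N\<^sup>2) * nn_abs f x * nn_abs f x"
              by (rule mult_right_mono) simp
            then show ?thesis using False by (simp add: f2_def power2_eq_square mult.assoc)
          qed
        qed
      qed
      also have "\<dots> = ennreal (1 / N\<^sup>2) * (\<integral>\<^sup>+x. (nn_abs f x)\<^sup>2 \<partial>M)" by (rule nn_integral_cmult) measurable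
      also have "\<dots> \<le> ennreal (1 / N\<^sup>2) * 1" by (intro mult_left_mono fnn) auto
      finally show ?thesis by simp
    qed
    have dual: "(\<integral>\<^sup>+x. act M k (nn_abs f2) x * g x \<partial>M) \<le> ennreal (\<delta> + \<epsilon> / 2)" if g: "g \<in> nn_ball M" for g
    proof -
      have [measurable]: "g \<in> borel_measurable M" using g by (simp add: nn_ball_def)
      define g1 where "g1 x = (if g x \<le> ennreal N * u x then g x else 0)" for x
      define g2 where "g2 x = (if g x \<le> ennreal N * u x then 0 else g x)" for x
      have [measurable]: "g1 \<in> borel_measurable M" "g2 \<in> borel_measurable M"
        unfolding g1_def g2_def by measurable
      have gg: "(\<integral>\<^sup>+x. (g2 x)\<^sup>2 \<partial>M) \<le> 1"
      proof -
        have "(\<integral>\<^sup>+x. (g2 x)\<^sup>2 \<partial>M) \<le> (\<integral>\<^sup>+x. (g x)\<^sup>2 \<partial>M)"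
          by (intro nn_integral_mono power_mono) (auto simp: g2_def)
        then show ?thesis using g by (auto simp: nn_ball_def)
      qed
      then have g2b: "g2 \<in> nn_ball M" by (simp add: nn_ball_def)
      have "(\<integral>\<^sup>+x. act M k (nn_abs f2) x * g x \<partial>M) = form M k (nn_abs f2) (\<lambda>x. g1 x + g2 x)"
        unfolding form_def by (intro nn_integral_cong) (auto simp: g1_def g2_def)
      also have "\<dots> = form M k (nn_abs f2) g1 + form M k (nn_abs f2) g2"
        by (rule form_add_right) measurable
      also have "form M k (nn_abs f2) g1 \<le> ennreal (N * (1 / N\<^sup>2))"
      proof -
        have "form M k (nn_abs f2) g1 \<le> (\<integral>\<^sup>+x. ennreal N * (act M k (nn_abs f2) x * u x) \<partial>M)"
          unfolding form_def
        proof (rule nn_integral_mono)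
          fix x
          have "g1 x \<le> ennreal N * u x" by (simp add: g1_def)
          then have "act M k (nn_abs f2) x * g1 x \<le> act M k (nn_abs f2) x * (ennreal N * u x)"
            by (rule mult_left_mono) simp
          then show "act M k (nn_abs f2) x * g1 x \<le> ennreal N * (act M k (nn_abs f2) x * u x)"
            by (simp only: mult.left_commute)
        qed
        also have "\<dots> = ennreal N * form M k (nn_abs f2) u"
          unfolding form_def by (rule nn_integral_cmult) measurable
        also have "form M k (nn_abs f2) u = form M (kernel_adjoint k) u (nn_abs f2)"
          by (rule form_swap[symmetric]) measurable
        also have "\<dots> = (\<integral>\<^sup>+x. a x * nn_abs f2 x \<partial>M)" by (simp add: form_def a_def)
        also have "\<dots> \<le> (\<integral>\<^sup>+x. (v x + a x) * nn_abs f2 x \<partial>M)"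
          by (intro nn_integral_mono mult_right_mono) auto
        also have "\<dots> \<le> ennreal (1 / N\<^sup>2)" by (rule small)
        finally have "form M k (nn_abs f2) g1 \<le> ennreal N * ennreal (1 / N\<^sup>2)"
          by (simp add: mult_left_mono)
        also have "\<dots> = ennreal (N * (1 / N\<^sup>2))" using N by (intro ennreal_mult[symmetric]) auto
        finally show ?thesis .
      qed
      also have "form M k (nn_abs f2) g2 \<le> ennreal \<delta> + ennreal (1 / N\<^sup>2) + ennreal (1 / N)"
      proof -
        have "form M k (nn_abs f2) g2 \<le> ennreal \<delta> + (\<integral>\<^sup>+x. nn_abs f2 x * v x \<partial>M) + (\<integral>\<^sup>+x. g2 x * u x \<partial>M)"
          by (rule dom[OF f2b g2b])
        also have "(\<integral>\<^sup>+x. nn_abs f2 x * v x \<partial>M) \<le> (\<integral>\<^sup>+x. (v x + a x) * nn_abs f2 x \<partial>M)"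
          by (intro nn_integral_mono) (auto simp: mult.commute distrib_left)
        also have "\<dots> \<le> ennreal (1 / N\<^sup>2)" by (rule small)
        also have "(\<integral>\<^sup>+x. g2 x * u x \<partial>M) \<le> (\<integral>\<^sup>+x. ennreal (1 / N) * (g2 x)\<^sup>2 \<partial>M)"
        proof (rule nn_integral_mono)
          fix x
          have "u x \<le> ennreal (1 / N) * g2 x" if "g2 x \<noteq> 0"
          proof -
            have "ennreal N * u x \<le> g2 x" using that by (auto simp: g2_def split: if_splits)
            then have "ennreal (1 / N) * (ennreal N * u x) \<le> ennreal (1 / N) * g2 x"
              by (rule mult_left_mono) simp
            then show ?thesis using N by (simp flip: ennreal_mult mult.assoc)
          qed
          then show "g2 x * u x \<le> ennreal (1 / N) * (g2 x)\<^sup>2"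
            by (cases "g2 x = 0") (auto dest: mult_left_mono[where c="g2 x"] simp: power2_eq_square mult.left_commute)
        qed
        also have "\<dots> = ennreal (1 / N) * (\<integral>\<^sup>+x. (g2 x)\<^sup>2 \<partial>M)" by (rule nn_integral_cmult) measurable
        also have "\<dots> \<le> ennreal (1 / N) * 1" by (intro mult_left_mono gg) auto
        finally show ?thesis by (simp add: add_mono)
      qed
      finally have "(\<integral>\<^sup>+x. act M k (nn_abs f2) x * g x \<partial>M)
        \<le> ennreal (N * (1 / N\<^sup>2)) + (ennreal \<delta> + ennreal (1 / N\<^sup>2) + ennreal (1 / N))"
        by (simp add: add_mono)
      also have "\<dots> = ennreal (N * (1 / N\<^sup>2) + (\<delta> + 1 / N\<^sup>2 + 1 / N))"
        using N \<delta>0 by (simp add: ennreal_plus)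
      also have "\<dots> \<le> ennreal (\<delta> + \<epsilon> / 2)"
      proof (rule ennreal_leI)
        have "N * (1 / N\<^sup>2) = 1 / N" using N by (simp add: power2_eq_square)
        moreover have "1 / N\<^sup>2 \<le> 1 / N" using N by (intro divide_left_mono) (auto simp: power2_eq_square)
        ultimately show "N * (1 / N\<^sup>2) + (\<delta> + 1 / N\<^sup>2 + 1 / N) \<le> \<delta> + \<epsilon> / 2" using N(2) by linarith
      qed
      finally show ?thesis .
    qed
    have "(\<integral>\<^sup>+x. (nn_abs (kernel_op M k f2) x)\<^sup>2 \<partial>M) \<le> (\<integral>\<^sup>+x. (act M k (nn_abs f2) x)\<^sup>2 \<partial>M)"
      by (intro nn_integral_mono power_mono kernel_op_norm_le pos_kernelD[OF k]) auto
    also have "\<dots> \<le> ennreal ((\<delta> + \<epsilon> / 2)\<^sup>2)"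
      by (rule nn_duality[OF _ dual]) (use \<delta>0 \<epsilon> in auto)
    finally have n2: "L2_norm M (kernel_op M k f2) \<le> \<delta> + \<epsilon> / 2"
      using \<delta>0 \<epsilon> by (subst L2_norm_le_iff[OF kernel_op_L2[OF k f2L]]) auto
    obtain g where g: "g \<in> F" "L2_norm M (\<lambda>x. kernel_op M k f1 x - g x) \<le> \<epsilon> / 2" using F(3)[OF f1] by blast
    have gL: "g \<in> L2 M" using g F by auto
    have L: "(\<lambda>x. kernel_op M k f1 x - g x) \<in> L2 M" by (intro L2_diff kernel_op_L2 k f1L gL)
    have f12: "(\<lambda>x. f1 x + f2 x) = f" by (auto simp: f1_def f2_def)
    have "L2_norm M (\<lambda>x. kernel_op M k f x - g x) = L2_norm M (\<lambda>x. (kernel_op M k f1 x - g x) + kernel_op M k f2 x)"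
    proof (rule L2_norm_cong_AE)
      show "(\<lambda>x. kernel_op M k f x - g x) \<in> L2 M" by (intro L2_diff kernel_op_L2 k f gL)
      show "(\<lambda>x. (kernel_op M k f1 x - g x) + kernel_op M k f2 x) \<in> L2 M"
        by (intro L2_add L kernel_op_L2 k f2L)
      show "AE x in M. kernel_op M k f x - g x = (kernel_op M k f1 x - g x) + kernel_op M k f2 x"
        using bounded_operator_add[OF bounded_kernel_op[OF k] f1L f2L] unfolding f12
        by eventually_elim simp
    qed
    also have "\<dots> \<le> L2_norm M (\<lambda>x. kernel_op M k f1 x - g x) + L2_norm M (kernel_op M k f2)"
      by (intro L2_norm_add L kernel_op_L2 k f2L)
    also have "\<dots> \<le> \<delta> + \<epsilon>" using g n2 by simp
    finally show ?thesis using g by blast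
  qed
  then show ?thesis unfolding finitely_covered_def using F \<delta>0 \<epsilon> by (intro conjI exI[of _ F]) auto
qed

lemma noncompactness_eq_kernel_size:
  assumes k: "pos_kernel M k"
  shows "noncompactness M (kernel_op M k) = kernel_size M (nn_L2 M) k"
proof (rule antisym)
  obtain \<delta>\<^sub>0 where "dominated M (nn_L2 M) k \<delta>\<^sub>0" using dominated_exists[OF k nn_cone_L2] by blast
  moreover have "noncompactness M (kernel_op M k) \<le> \<delta>" if "dominated M (nn_L2 M) k \<delta>" for \<delta>
    by (rule field_le_epsilon) (rule noncompactness_le[OF covered_of_dominated[OF k that]])
  ultimately show "noncompactness M (kernel_op M k) \<le> kernel_size M (nn_L2 M) k"
    unfolding kernel_size_def by (intro cInf_greatest) auto
  obtain \<delta>\<^sub>1 where "finitely_covered M (kernel_op M k) \<delta>\<^sub>1"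
    using finitely_covered_exists[OF bounded_kernel_op[OF k]] by blast
  then show "kernel_size M (nn_L2 M) k \<le> noncompactness M (kernel_op M k)"
    unfolding noncompactness_eq
    by (intro cInf_greatest) (auto intro!: kernel_size_le dominated_of_covered k)
qed

lemma ess_radius_limit:
  assumes k: "pos_kernel M k"
  shows "(\<lambda>j. root j (kernel_size M (nn_L2 M) (kernel_power M k j)))
    \<longlonglongrightarrow> ess_spectral_radius M (kernel_op M k)"
proof (rule Lim_transform_eventually[OF noncompactness_limit[OF bounded_kernel_op[OF k]]])
  show "\<forall>\<^sub>F j in sequentially. root j (noncompactness M (kernel_op M k ^^ j))
      = root j (kernel_size M (nn_L2 M) (kernel_power M k j))"
  proof (rule eventually_sequentiallyI[of 1])
    fix j :: nat assume j: "1 \<le> j"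
    have "noncompactness M (kernel_op M k ^^ j) = noncompactness M (kernel_op M (kernel_power M k j))"
      by (rule noncompactness_cong[OF bounded_operatorD(1)[OF bounded_operator_funpow[OF bounded_kernel_op[OF k]]]
          kernel_op_L2[OF pos_kernel_power[OF k]] kernel_op_power[OF k j]])
    then show "root j (noncompactness M (kernel_op M k ^^ j)) = root j (kernel_size M (nn_L2 M) (kernel_power M k j))"
      by (simp add: noncompactness_eq_kernel_size pos_kernel_power k)
  qed
qed

end

section \<open>Neumann series\<close>

text \<open>The Riesz-Fischer argument: the partial sums of the moduli increase and are bounded in \<open>L\<^sup>2\<close> by
  Minkowski's inequality.\<close>

lemma L2_series:
  assumes g: "\<And>n. g n \<in> L2 M" and sum: "summable (\<lambda>n. L2_norm M (g n))"
  shows "AE x in M. summable (\<lambda>n. norm (g n x))"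
    and "(\<lambda>x. \<Sum>n. g n x) \<in> L2 M"
    and "L2_norm M (\<lambda>x. \<Sum>n. g n x) \<le> (\<Sum>n. L2_norm M (g n))"
proof -
  have [measurable]: "g n \<in> borel_measurable M" for n by (rule L2_measurable[OF g])
  let ?S = "\<Sum>n. L2_norm M (g n)"
  have S: "0 \<le> ?S" by (rule suminf_nonneg[OF sum]) simp
  define P where "P n x = (\<Sum>i<n. nn_abs (g i) x)" for n x
  define Q where "Q x = (\<Sum>i. nn_abs (g i) x)" for x
  have [measurable]: "P n \<in> borel_measurable M" "Q \<in> borel_measurable M" for n
    unfolding P_def Q_def by measurable
  have "(\<integral>\<^sup>+x. (P n x)\<^sup>2 \<partial>M) \<le> ennreal ((\<Sum>i<n. L2_norm M (g i))\<^sup>2)" for n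
  proof (induction n)
    case (Suc n)
    have "(\<integral>\<^sup>+x. (P n x + nn_abs (g n) x)\<^sup>2 \<partial>M) \<le> ennreal (((\<Sum>i<n. L2_norm M (g i)) + L2_norm M (g n))\<^sup>2)"
      by (intro nn_minkowski Suc.IH sum_nonneg) (auto simp: L2_norm_nn[OF g])
    then show ?case by (simp only: P_def sum.lessThan_Suc)
  qed (simp add: P_def)
  moreover have "(\<Sum>i<n. L2_norm M (g i)) \<le> ?S" for n by (rule sum_le_suminf[OF sum]) auto
  ultimately have P: "(\<integral>\<^sup>+x. (P n x)\<^sup>2 \<partial>M) \<le> ennreal (?S\<^sup>2)" for n
    by (meson order_trans ennreal_leI power_mono sum_nonneg L2_norm_nonneg)
  have "(\<lambda>n. \<integral>\<^sup>+x. (P n x)\<^sup>2 \<partial>M) \<longlonglongrightarrow> (\<integral>\<^sup>+x. (Q x)\<^sup>2 \<partial>M)"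
  proof (rule nn_integral_LIMSEQ)
    show "incseq (\<lambda>n x. (P n x)\<^sup>2)"
      by (intro incseq_SucI le_funI power_mono) (simp_all add: P_def)
    fix x
    have "(\<lambda>n. P n x) \<longlonglongrightarrow> Q x"
      unfolding P_def Q_def by (rule summable_LIMSEQ) simp
    then have "(\<lambda>n. P n x * P n x) \<longlonglongrightarrow> Q x * Q x"
      by (intro tendsto_mult_ennreal) auto
    then show "(\<lambda>n. (P n x)\<^sup>2) \<longlonglongrightarrow> (Q x)\<^sup>2" by (simp add: power2_eq_square)
  qed measurable
  then have Q: "(\<integral>\<^sup>+x. (Q x)\<^sup>2 \<partial>M) \<le> ennreal (?S\<^sup>2)"
    by (rule LIMSEQ_le_const2) (use P in auto)
  then have "AE x in M. Q x < \<infinity>" by (intro L2_finite_AE) (auto intro: le_less_trans)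
  then show conv: "AE x in M. summable (\<lambda>n. norm (g n x))"
    by eventually_elim (auto simp: Q_def intro!: summable_suminf_not_top)
  have "AE x in M. nn_abs (\<lambda>x. \<Sum>n. g n x) x \<le> Q x"
    using conv
  proof eventually_elim
    case (elim x)
    then have "nn_abs (\<lambda>x. \<Sum>n. g n x) x \<le> ennreal (\<Sum>n. norm (g n x))"
      by (intro ennreal_leI summable_norm)
    also have "\<dots> = Q x" unfolding Q_def using elim by (intro suminf_ennreal2[symmetric]) auto
    finally show ?case .
  qed
  then have "(\<integral>\<^sup>+x. (nn_abs (\<lambda>x. \<Sum>n. g n x) x)\<^sup>2 \<partial>M) \<le> (\<integral>\<^sup>+x. (Q x)\<^sup>2 \<partial>M)"
    by (intro nn_integral_mono_AE) (auto elim!: eventually_mono intro!: power_mono)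
  then have *: "(\<integral>\<^sup>+x. (nn_abs (\<lambda>x. \<Sum>n. g n x) x)\<^sup>2 \<partial>M) \<le> ennreal (?S\<^sup>2)"
    using Q by (rule order_trans)
  show "(\<lambda>x. \<Sum>n. g n x) \<in> L2 M" "L2_norm M (\<lambda>x. \<Sum>n. g n x) \<le> ?S"
    by (rule L2I[OF _ * S]; measurable)+
qed

definition neumann :: "'a operator \<Rightarrow> complex \<Rightarrow> 'a operator" where
  "neumann T z f x = (\<Sum>n. 1 / z ^ Suc n * (T ^^ n) f x)"

locale neumann_convergent =
  fixes M :: "'a measure" and T :: "'a operator" and z :: complex and c :: "nat \<Rightarrow> real"
  assumes T: "bounded_operator M T" and z: "z \<noteq> 0"
    and c: "f \<in> L2 M \<Longrightarrow> L2_norm M ((T ^^ n) f) \<le> c n * L2_norm M f"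
    and c_summable: "summable (\<lambda>n. c n / norm z ^ Suc n)" and c_nonneg: "0 \<le> c n"
begin

lemma power_L2: "f \<in> L2 M \<Longrightarrow> (T ^^ n) f \<in> L2 M"
  by (rule bounded_operatorD(1)[OF bounded_operator_funpow[OF T]])

abbreviation summand where "summand f n \<equiv> \<lambda>x. 1 / z ^ Suc n * (T ^^ n) f x"

lemma summand_L2: "f \<in> L2 M \<Longrightarrow> summand f n \<in> L2 M"
  by (intro L2_scale power_L2)

lemma summand_norm: "f \<in> L2 M \<Longrightarrow> L2_norm M (summand f n) \<le> c n / norm z ^ Suc n * L2_norm M f"
  using c[of f n] z by (subst L2_norm_scale[OF power_L2])
    (auto simp: norm_divide norm_mult norm_power divide_right_mono)

lemma summand_summable: "f \<in> L2 M \<Longrightarrow> summable (\<lambda>n. L2_norm M (summand f n))"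
  by (rule summable_comparison_test'[OF summable_mult2[OF c_summable, of "L2_norm M f"], of 0])
    (use summand_norm in auto)

lemma neumann_AE_summable: "f \<in> L2 M \<Longrightarrow> AE x in M. summable (\<lambda>n. summand f n x)"
  using L2_series(1)[OF summand_L2 summand_summable, of f]
  by (auto elim!: eventually_mono intro: summable_norm_cancel)

lemma neumann_L2: "f \<in> L2 M \<Longrightarrow> neumann T z f \<in> L2 M"
  using L2_series(2)[OF summand_L2 summand_summable, of f] by (simp add: neumann_def[abs_def])

lemma neumann_norm: "f \<in> L2 M \<Longrightarrow> L2_norm M (neumann T z f) \<le> (\<Sum>n. c n / norm z ^ Suc n) * L2_norm M f"
proof -
  assume f: "f \<in> L2 M"
  have "L2_norm M (neumann T z f) \<le> (\<Sum>n. L2_norm M (summand f n))"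
    using L2_series(3)[OF summand_L2 summand_summable, OF f f] by (simp add: neumann_def[abs_def])
  also have "\<dots> \<le> (\<Sum>n. c n / norm z ^ Suc n * L2_norm M f)"
    by (intro suminf_le summand_summable f summable_mult2 c_summable summand_norm)
  also have "\<dots> = (\<Sum>n. c n / norm z ^ Suc n) * L2_norm M f"
    by (rule suminf_mult2[symmetric, OF c_summable])
  finally show ?thesis .
qed

lemma neumann_tail:
  assumes f: "f \<in> L2 M"
  shows "(\<lambda>N. L2_norm M (\<lambda>x. neumann T z f x - (\<Sum>i<N. summand f i x))) \<longlonglongrightarrow> 0"
proof (rule tendsto_sandwich[where f="\<lambda>_. 0"])
  let ?s = "\<lambda>n. L2_norm M (summand f n)"
  have "(\<lambda>N. (\<Sum>n. ?s n) - (\<Sum>n<N. ?s n)) \<longlonglongrightarrow> (\<Sum>n. ?s n) - (\<Sum>n. ?s n)"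
    by (intro tendsto_diff tendsto_const summable_LIMSEQ summand_summable f)
  then show "(\<lambda>N. (\<Sum>n. ?s n) - (\<Sum>n<N. ?s n)) \<longlonglongrightarrow> 0" by simp
  have "L2_norm M (\<lambda>x. neumann T z f x - (\<Sum>i<N. summand f i x)) \<le> (\<Sum>n. ?s n) - (\<Sum>n<N. ?s n)" for N
  proof -
    have sm: "summable (\<lambda>n. ?s (n + N))" by (rule summable_ignore_initial_segment[OF summand_summable[OF f]])
    note tail = L2_series[where g="\<lambda>n. summand f (n + N)", OF summand_L2[OF f] sm]
    have "L2_norm M (\<lambda>x. neumann T z f x - (\<Sum>i<N. summand f i x)) = L2_norm M (\<lambda>x. \<Sum>n. summand f (n + N) x)"
    proof (rule L2_norm_cong_AE[OF L2_diff[OF neumann_L2[OF f] L2_sum[OF summand_L2[OF f]]] tail(2)])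
      show "AE x in M. neumann T z f x - (\<Sum>i<N. summand f i x) = (\<Sum>n. summand f (n + N) x)"
        using neumann_AE_summable[OF f]
      proof eventually_elim
        case (elim x)
        from suminf_minus_initial_segment[OF this, of N] show ?case by (simp only: neumann_def)
      qed
    qed
    also have "\<dots> \<le> (\<Sum>n. ?s (n + N))" by (rule tail(3))
    also have "\<dots> = (\<Sum>n. ?s n) - (\<Sum>n<N. ?s n)"
      by (rule suminf_minus_initial_segment[OF summand_summable[OF f]])
    finally show ?thesis .
  qed
  then show "\<forall>\<^sub>F N in sequentially. L2_norm M (\<lambda>x. neumann T z f x - (\<Sum>i<N. summand f i x)) \<le> (\<Sum>n. ?s n) - (\<Sum>n<N. ?s n)"
    by simp
qed simp_all

lemma bounded_neumann: "bounded_operator M (neumann T z)"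
  unfolding bounded_operator_def
proof (intro conjI ballI allI exI)
  fix f assume f: "f \<in> L2 M"
  show "neumann T z f \<in> L2 M" by (rule neumann_L2[OF f])
  show "L2_norm M (neumann T z f) \<le> (\<Sum>n. c n / norm z ^ Suc n) * L2_norm M f" by (rule neumann_norm[OF f])
  fix g a assume g: "g \<in> L2 M"
  have "AE x in M. \<forall>n. (T ^^ n) (\<lambda>y. a * f y + g y) x = a * (T ^^ n) f x + (T ^^ n) g x"
    unfolding AE_all_countable
    by (intro allI bounded_operatorD(2)[OF bounded_operator_funpow[OF T] f g])
  with neumann_AE_summable[OF f] neumann_AE_summable[OF g]
  show "AE x in M. neumann T z (\<lambda>y. a * f y + g y) x = a * neumann T z f x + neumann T z g x"
  proof eventually_elim
    case (elim x)
    have "neumann T z (\<lambda>y. a * f y + g y) x = (\<Sum>n. a * summand f n x + summand g n x)"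
      unfolding neumann_def using elim(3) by (intro suminf_cong) (simp add: algebra_simps)
    also have "\<dots> = (\<Sum>n. a * summand f n x) + (\<Sum>n. summand g n x)"
      by (intro suminf_add[symmetric] summable_mult elim)
    also have "(\<Sum>n. a * summand f n x) = a * (\<Sum>n. summand f n x)" by (rule suminf_mult[OF elim(1)])
    finally show ?case by (simp only: neumann_def)
  qed
qed

text \<open>The series telescopes pointwise.\<close>

lemma neumann_left_inverse:
  assumes f: "f \<in> L2 M"
  shows "AE x in M. neumann T z (\<lambda>y. z * f y - T f y) x = f x"
proof -
  have Tf: "T f \<in> L2 M" by (rule bounded_operatorD(1)[OF T f])
  have "AE x in M. (T ^^ n) (\<lambda>y. z * f y - T f y) x = z * (T ^^ n) f x - (T ^^ Suc n) f x" for n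
    using bounded_operator_diff[OF bounded_operator_funpow[OF T] L2_scale[OF f] Tf, of n z]
      bounded_operator_scale[OF bounded_operator_funpow[OF T] f, of n z]
    by eventually_elim (simp add: funpow_swap1)
  then have "AE x in M. \<forall>n. (T ^^ n) (\<lambda>y. z * f y - T f y) x = z * (T ^^ n) f x - (T ^^ Suc n) f x"
    unfolding AE_all_countable by blast
  with neumann_AE_summable[OF f] show ?thesis
  proof eventually_elim
    case (elim x)
    let ?a = "\<lambda>n. (T ^^ n) f x / z ^ n"
    have "(\<lambda>n. z * summand f n x) \<longlonglongrightarrow> z * 0"
      by (intro tendsto_mult tendsto_const summable_LIMSEQ_zero elim)
    then have "?a \<longlonglongrightarrow> 0" using z by simp
    then have "(\<lambda>n. ?a n - ?a (Suc n)) sums (?a 0 - 0)" by (rule telescope_sums')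
    moreover have "summand (\<lambda>y. z * f y - T f y) n x = ?a n - ?a (Suc n)" for n
      using elim(2) z by (simp add: field_simps del: funpow.simps)
    ultimately show ?case by (simp add: neumann_def sums_iff)
  qed
qed

text \<open>The partial sums satisfy \<open>T p\<^sub>n = z p\<^sub>n\<^sub>+\<^sub>1 - f\<close>; as \<open>T\<close> is bounded and the tails tend to \<open>0\<close> in
  norm, the identity passes to the limit.\<close>

lemma neumann_right_inverse:
  assumes f: "f \<in> L2 M"
  shows "AE x in M. z * neumann T z f x - T (neumann T z f) x = f x"
proof -
  let ?N = "neumann T z f" and ?p = "\<lambda>n x. \<Sum>i<n. summand f i x"
  obtain C where C: "0 < C" "\<And>f. f \<in> L2 M \<Longrightarrow> L2_norm M (T f) \<le> C * L2_norm M f"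
    using bounded_operator_bound[OF T] by blast
  have N: "?N \<in> L2 M" by (rule neumann_L2[OF f])
  have p: "?p n \<in> L2 M" for n by (intro L2_sum summand_L2 f)
  let ?d = "\<lambda>n x. ?N x - ?p n x"
  have d: "?d n \<in> L2 M" for n by (intro L2_diff N p)
  let ?e = "\<lambda>x. z * ?N x - T ?N x - f x"
  have e: "?e \<in> L2 M" by (intro L2_diff L2_scale N bounded_operatorD(1)[OF T] f)
  have bound: "L2_norm M ?e \<le> norm z * L2_norm M (?d (Suc n)) + C * L2_norm M (?d n)" for n
  proof -
    have "AE x in M. T (?p n) x = (\<Sum>i<n. 1 / z ^ Suc i * (T ^^ Suc i) f x)"
    proof -
      have "AE x in M. \<forall>i. T (summand f i) x = 1 / z ^ Suc i * T ((T ^^ i) f) x"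
        unfolding AE_all_countable by (intro allI bounded_operator_scale[OF T power_L2[OF f]])
      with bounded_operator_sum[where n=n, OF T summand_L2[OF f]] show ?thesis by eventually_elim simp
    qed
    moreover have "z * ?p (Suc n) x = f x + (\<Sum>i<n. 1 / z ^ Suc i * (T ^^ Suc i) f x)" for x
      using z by (simp add: sum.lessThan_Suc_shift sum_distrib_left algebra_simps
          del: sum.lessThan_Suc funpow.simps(2))
    ultimately have 1: "AE x in M. T (?p n) x = z * ?p (Suc n) x - f x" by (auto elim!: eventually_mono)
    have "AE x in M. T (?d n) x = T ?N x - T (?p n) x" by (rule bounded_operator_diff[OF T N p])
    with 1 have "AE x in M. ?e x = z * ?d (Suc n) x - T (?d n) x"
    proof eventually_elim
      case (elim x)
      have "z * a - b - d = z * (a - q) - (b - (z * q - d))" for a b d q :: complex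
        by (simp add: algebra_simps)
      then show ?case unfolding elim .
    qed
    then have "L2_norm M ?e = L2_norm M (\<lambda>x. z * ?d (Suc n) x - T (?d n) x)"
      by (intro L2_norm_cong_AE e L2_diff L2_scale N p bounded_operatorD(1)[OF T])
    also have "\<dots> \<le> L2_norm M (\<lambda>x. z * ?d (Suc n) x) + L2_norm M (T (?d n))"
      by (rule L2_norm_diff[OF L2_scale[OF d] bounded_operatorD(1)[OF T d]])
    also have "L2_norm M (\<lambda>x. z * ?d (Suc n) x) = norm z * L2_norm M (?d (Suc n))"
      by (rule L2_norm_scale[OF d])
    also have "L2_norm M (T (?d n)) \<le> C * L2_norm M (?d n)" by (rule C(2)[OF d])
    finally show ?thesis by simp
  qed
  have "(\<lambda>n. norm z * L2_norm M (?d (Suc n)) + C * L2_norm M (?d n)) \<longlonglongrightarrow> norm z * 0 + C * 0"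
    by (intro tendsto_add tendsto_mult tendsto_const neumann_tail f
        LIMSEQ_Suc[OF neumann_tail[OF f]])
  then have "L2_norm M ?e \<le> norm z * 0 + C * 0" by (rule LIMSEQ_le_const) (use bound in auto)
  then have "L2_norm M ?e = 0" using L2_norm_nonneg[of M ?e] by simp
  then have "AE x in M. ?e x = 0" by (rule L2_norm_eq_0[OF e])
  then show ?thesis by eventually_elim simp
qed

lemma not_in_spectrum: "z \<notin> spectrum M T"
  unfolding spectrum_def using bounded_neumann neumann_left_inverse neumann_right_inverse by blast

end

section \<open>The spectral radius of a positive kernel operator\<close>

definition ae_nonneg :: "'a measure \<Rightarrow> ('a \<Rightarrow> complex) \<Rightarrow> bool" where
  "ae_nonneg M f \<longleftrightarrow> (AE x in M. f x \<in> \<real>\<^sub>\<ge>\<^sub>0)"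

lemma nonneg_suminf:
  fixes f :: "nat \<Rightarrow> complex"
  assumes "summable f" "\<And>n. f n \<in> \<real>\<^sub>\<ge>\<^sub>0"
  shows "(\<Sum>n. f n) \<in> \<real>\<^sub>\<ge>\<^sub>0"
proof -
  have eq: "f n = complex_of_real (Re (f n))" for n
    using assms(2)[of n] by (auto simp: complex_nonneg_Reals_iff complex_eq_iff)
  have sm: "summable (\<lambda>n. Re (f n))" by (rule summable_Re[OF assms(1)])
  have "(\<Sum>n. f n) = complex_of_real (\<Sum>n. Re (f n))"
    by (subst eq) (rule suminf_of_real[OF sm, symmetric])
  moreover have "0 \<le> (\<Sum>n. Re (f n))"
    using assms(2) by (intro suminf_nonneg sm) (auto simp: complex_nonneg_Reals_iff)
  ultimately show ?thesis by simp
qed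

lemma ae_nonneg_sum: "(\<And>i. i \<in> I \<Longrightarrow> ae_nonneg M (f i)) \<Longrightarrow> ae_nonneg M (\<lambda>x. \<Sum>i\<in>I. f i x)"
proof (induction I rule: infinite_finite_induct)
  case (insert i I)
  then have "AE x in M. f i x \<in> \<real>\<^sub>\<ge>\<^sub>0" "AE x in M. (\<Sum>i\<in>I. f i x) \<in> \<real>\<^sub>\<ge>\<^sub>0" by (auto simp: ae_nonneg_def)
  then show ?case unfolding ae_nonneg_def sum.insert[OF insert(1,2)]
    by eventually_elim (rule nonneg_Reals_add_I)
qed (auto simp: ae_nonneg_def)

lemma ae_nonneg_add:
  assumes "ae_nonneg M f" "ae_nonneg M g"
  shows "ae_nonneg M (\<lambda>x. f x + g x)"
  using assms unfolding ae_nonneg_def by eventually_elim (rule nonneg_Reals_add_I)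

lemma ae_nonneg_scale: "ae_nonneg M f \<Longrightarrow> c \<in> \<real>\<^sub>\<ge>\<^sub>0 \<Longrightarrow> ae_nonneg M (\<lambda>x. c * f x)"
  unfolding ae_nonneg_def by (auto elim!: eventually_mono intro: nonneg_Reals_mult_I)

lemma ae_nonneg_cong:
  assumes "AE x in M. f x = g x" "ae_nonneg M f"
  shows "ae_nonneg M g"
  using assms unfolding ae_nonneg_def by eventually_elim simp

lemma ae_nonneg_norm_le:
  assumes f: "f \<in> L2 M" "ae_nonneg M f" and g: "g \<in> L2 M" "ae_nonneg M (\<lambda>x. g x - f x)"
  shows "L2_norm M f \<le> L2_norm M g"
proof (rule L2_norm_mono_AE[OF f(1) g(1)])
  show "AE x in M. norm (f x) \<le> norm (g x)"
    using f(2) g(2) unfolding ae_nonneg_def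
  proof eventually_elim
    case (elim x)
    then have "norm (f x) = Re (f x)" "Re (f x) \<le> Re (g x)"
      by (auto simp: complex_nonneg_Reals_iff cmod_eq_Re)
    then show ?case using complex_Re_le_cmod[of "g x"] by linarith
  qed
qed

context sigma_finite_measure
begin

lemma kernel_op_nonneg:
  assumes k: "pos_kernel M k" and f: "f \<in> L2 M" "ae_nonneg M f"
  shows "ae_nonneg M (kernel_op M k f)"
proof -
  note [measurable] = pos_kernelD(1)[OF k] L2_measurable[OF f(1)]
  let ?g = "\<lambda>x. complex_of_real (max 0 (Re (f x)))"
  have eq: "AE x in M. ?g x = f x"
    using f(2) unfolding ae_nonneg_def
    by eventually_elim (auto simp: complex_nonneg_Reals_iff complex_eq_iff)
  have "(\<integral>\<^sup>+x. (nn_abs ?g x)\<^sup>2 \<partial>M) = (\<integral>\<^sup>+x. (nn_abs f x)\<^sup>2 \<partial>M)"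
  proof (rule nn_integral_cong_AE)
    show "AE x in M. (nn_abs ?g x)\<^sup>2 = (nn_abs f x)\<^sup>2" using eq by eventually_elim (simp only:)
  qed
  then have g: "?g \<in> L2 M" using f by (simp add: L2_iff)
  have "AE x in M. kernel_op M k ?g x \<in> \<real>\<^sub>\<ge>\<^sub>0" using kernel_op_real[OF k g] by auto
  moreover have "AE x in M. kernel_op M k ?g x = kernel_op M k f x"
    by (rule bounded_operator_cong[OF bounded_kernel_op[OF k] g f(1) eq])
  ultimately show ?thesis unfolding ae_nonneg_def by eventually_elim simp
qed

lemma kernel_op_power_nonneg:
  assumes k: "pos_kernel M k" and f: "f \<in> L2 M" "ae_nonneg M f"
  shows "ae_nonneg M ((kernel_op M k ^^ n) f)"
proof (induction n)
  case (Suc n)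
  then show ?case
    using kernel_op_nonneg[OF k bounded_operatorD(1)[OF bounded_operator_funpow[OF bounded_kernel_op[OF k]] f(1)]]
    by simp
qed (use f in simp)

text \<open>By the absence of cancellation, the norm of a positive operator is determined by nonnegative
  functions.\<close>

lemma size_power_le:
  assumes k: "pos_kernel M k" and n: "1 \<le> n" and b: "0 \<le> b"
    and le: "\<And>f. f \<in> L2 M \<Longrightarrow> ae_nonneg M f \<Longrightarrow> L2_norm M ((kernel_op M k ^^ n) f) \<le> b * L2_norm M f"
  shows "kernel_size M zero_cone (kernel_power M k n) \<le> b"
proof (rule kernel_size_zero_leI[OF b])
  fix f g assume f: "f \<in> nn_ball M" and g: "g \<in> nn_ball M"
  let ?k = "kernel_power M k n"
  have K: "pos_kernel M ?k" by (rule pos_kernel_power[OF k])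
  note [measurable] = pos_kernelD(1)[OF K]
  have gm[measurable]: "g \<in> borel_measurable M" using g by (simp add: nn_ball_def)
  let ?f = "\<lambda>x. complex_of_real (enn2real (f x))"
  note f' = nn_ball_complex[OF f]
  note [measurable] = L2_measurable[OF f'(1)]
  have "L2_norm M (kernel_op M ?k ?f) = L2_norm M ((kernel_op M k ^^ n) ?f)"
    by (rule L2_norm_cong_AE[OF kernel_op_L2[OF K f'(1)]
          bounded_operatorD(1)[OF bounded_operator_funpow[OF bounded_kernel_op[OF k]] f'(1)]])
      (use kernel_op_power[OF k n f'(1)] in \<open>auto elim!: eventually_mono\<close>)
  also have "\<dots> \<le> b * L2_norm M ?f" by (rule le[OF f'(1)]) (simp add: ae_nonneg_def)
  also have "\<dots> \<le> b" using f'(2) b by (rule mult_left_le)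
  finally have nb: "L2_norm M (kernel_op M ?k ?f) \<le> b" .
  have act: "act M ?k f x = act M ?k (\<lambda>x. ennreal (enn2real (f x))) x" for x
    by (rule act_cong_AE) (use f'(3) in auto)
  have "form M ?k f g = (\<integral>\<^sup>+x. nn_abs (kernel_op M ?k ?f) x * g x \<partial>M)"
    unfolding form_def act
  proof (rule nn_integral_cong_AE)
    show "AE x in M. act M ?k (\<lambda>x. ennreal (enn2real (f x))) x * g x = nn_abs (kernel_op M ?k ?f) x * g x"
      using kernel_op_real[OF K f'(1) enn2real_nonneg] by eventually_elim (elim conjE, simp only:)
  qed
  also have "\<dots> \<le> ennreal (b * 1)"
    by (rule nn_cauchy_schwarz)
      (use b g nb in \<open>auto simp: nn_ball_def simp flip: L2_norm_le_iff[OF kernel_op_L2[OF K f'(1)]]\<close>)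
  finally show "form M ?k f g \<le> ennreal b" by simp
qed

text \<open>All terms of the tail are nonnegative.\<close>

lemma neumann_ge_partial_sum:
  assumes k: "pos_kernel M k" and nc: "neumann_convergent M (kernel_op M k) (complex_of_real l) c"
    and l: "0 < l" and f: "f \<in> L2 M" "ae_nonneg M f"
  shows "ae_nonneg M (\<lambda>x. neumann (kernel_op M k) (complex_of_real l) f x
    - (\<Sum>i<n. 1 / complex_of_real l ^ Suc i * (kernel_op M k ^^ i) f x))"
proof -
  interpret N: neumann_convergent M "kernel_op M k" "complex_of_real l" c by (rule nc)
  have lr: "1 / complex_of_real l ^ Suc i \<in> \<real>\<^sub>\<ge>\<^sub>0" for i
    using l by (simp flip: of_real_power of_real_mult of_real_divide add: nonneg_Reals_of_real_iff)
  have "AE x in M. \<forall>i. (kernel_op M k ^^ i) f x \<in> \<real>\<^sub>\<ge>\<^sub>0"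
    unfolding AE_all_countable using kernel_op_power_nonneg[OF k f] by (simp add: ae_nonneg_def)
  with N.neumann_AE_summable[OF f(1)] show ?thesis
    unfolding ae_nonneg_def
  proof eventually_elim
    case (elim x)
    have "(\<Sum>i. N.summand f (i + n) x) \<in> \<real>\<^sub>\<ge>\<^sub>0"
      by (intro nonneg_suminf summable_ignore_initial_segment[OF elim(1)] nonneg_Reals_mult_I lr)
        (use elim in blast)
    then show ?case
      unfolding neumann_def using suminf_minus_initial_segment[OF elim(1), of n] by (simp only:)
  qed
qed

lemma neumann_ge_term:
  assumes k: "pos_kernel M k" and nc: "neumann_convergent M (kernel_op M k) (complex_of_real l) c"
    and l: "0 < l" and f: "f \<in> L2 M" "ae_nonneg M f"
  shows "ae_nonneg M (\<lambda>x. neumann (kernel_op M k) (complex_of_real l) f x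
    - 1 / complex_of_real l ^ Suc n * (kernel_op M k ^^ n) f x)"
proof -
  let ?t = "\<lambda>i x. 1 / complex_of_real l ^ Suc i * (kernel_op M k ^^ i) f x"
  have lr: "1 / complex_of_real l ^ Suc i \<in> \<real>\<^sub>\<ge>\<^sub>0" for i
    using l by (simp flip: of_real_power of_real_mult of_real_divide add: nonneg_Reals_of_real_iff)
  have "ae_nonneg M (\<lambda>x. (neumann (kernel_op M k) (complex_of_real l) f x - (\<Sum>i<Suc n. ?t i x)) + (\<Sum>i<n. ?t i x))"
    by (intro ae_nonneg_add neumann_ge_partial_sum[OF k nc l f] ae_nonneg_sum ae_nonneg_scale lr
        kernel_op_power_nonneg k f)
  then show ?thesis by (simp only: sum.lessThan_Suc) (simp only: diff_add_eq_diff_diff_swap diff_add_cancel)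
qed

text \<open>The square of the Neumann series is the sum of \<open>(m + 1) T\<^sup>m / l\<^sup>m\<^sup>+\<^sup>2\<close>, and positivity allows all but
  one term to be dropped.  To avoid double series, the outer series is replaced by its partial sum up
  to \<open>m\<close>, and in the term with \<open>T\<^sup>i\<close> the inner series is replaced by its term with \<open>T\<^sup>m\<^sup>-\<^sup>i\<close>.\<close>

lemma neumann_square_ge:
  assumes k: "pos_kernel M k" and nc: "neumann_convergent M (kernel_op M k) (complex_of_real l) c"
    and l: "0 < l" and f: "f \<in> L2 M" "ae_nonneg M f"
  defines "T \<equiv> kernel_op M k" and "P \<equiv> neumann (kernel_op M k) (complex_of_real l)"
  shows "real (Suc m) / l ^ (m + 2) * L2_norm M ((T ^^ m) f) \<le> L2_norm M (P (P f))"
proof -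
  interpret N: neumann_convergent M T "complex_of_real l" c using nc by (simp add: T_def)
  let ?l = "complex_of_real l"
  note P_def' = P_def[folded T_def]
  have Tn: "bounded_operator M (T ^^ n)" for n by (intro bounded_operator_funpow N.T)
  have PL: "P g \<in> L2 M" if "g \<in> L2 M" for g unfolding P_def' by (rule N.neumann_L2[OF that])
  have lr: "1 / ?l ^ Suc i \<in> \<real>\<^sub>\<ge>\<^sub>0" for i
    using l by (simp flip: of_real_power of_real_mult of_real_divide add: nonneg_Reals_of_real_iff)
  have Tnn: "ae_nonneg M ((T ^^ n) g)" if "g \<in> L2 M" "ae_nonneg M g" for g n
    unfolding T_def by (rule kernel_op_power_nonneg[OF k that])
  have Pf: "ae_nonneg M (P f)"
    using neumann_ge_partial_sum[OF k nc l f, of 0] by (simp add: P_def)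
  (* The nonnegative remainder after the term with exponent m - i. *)
  define h where "h i x = P f x - 1 / ?l ^ Suc (m - i) * (T ^^ (m - i)) f x" for i x
  have h: "h i \<in> L2 M" "ae_nonneg M (h i)" for i
  proof -
    show "h i \<in> L2 M" unfolding h_def by (intro L2_diff PL f L2_scale N.power_L2)
    show "ae_nonneg M (h i)"
      unfolding h_def P_def T_def by (rule neumann_ge_term[OF k nc l f])
  qed
  have part: "AE x in M. (T ^^ i) (h i) x = (T ^^ i) (P f) x - 1 / ?l ^ Suc (m - i) * (T ^^ m) f x"
    if "i \<le> m" for i
  proof -
    have "(T ^^ i) ((T ^^ (m - i)) f) = (T ^^ m) f"
      using that by (simp flip: funpow_add comp_apply[of "T ^^ i" "T ^^ (m - i)"])
    moreover from bounded_operator_diff[OF Tn PL[OF f(1)] L2_scale[OF N.power_L2[OF f(1)]], of i "1 / ?l ^ Suc (m - i)" "m - i"]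
      bounded_operator_scale[OF Tn N.power_L2[OF f(1)], of i "1 / ?l ^ Suc (m - i)" "m - i"]
    have "AE x in M. (T ^^ i) (h i) x = (T ^^ i) (P f) x - 1 / ?l ^ Suc (m - i) * (T ^^ i) ((T ^^ (m - i)) f) x"
      unfolding h_def by eventually_elim (simp only:)
    ultimately show ?thesis by (simp only:)
  qed
  let ?c = "complex_of_real (real (Suc m) / l ^ (m + 2))"
  have "ae_nonneg M (\<lambda>x. (P (P f) x - (\<Sum>i<Suc m. 1 / ?l ^ Suc i * (T ^^ i) (P f) x))
      + (\<Sum>i<Suc m. 1 / ?l ^ Suc i * (T ^^ i) (h i) x))"
  proof (intro ae_nonneg_add ae_nonneg_sum ae_nonneg_scale lr Tnn h)
    show "ae_nonneg M (\<lambda>x. P (P f) x - (\<Sum>i<Suc m. 1 / ?l ^ Suc i * (T ^^ i) (P f) x))"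
      unfolding P_def T_def
      by (rule neumann_ge_partial_sum[OF k nc l PL[OF f(1), unfolded P_def T_def] Pf[unfolded P_def T_def]])
  qed
  moreover have "AE x in M. (P (P f) x - (\<Sum>i<Suc m. 1 / ?l ^ Suc i * (T ^^ i) (P f) x))
      + (\<Sum>i<Suc m. 1 / ?l ^ Suc i * (T ^^ i) (h i) x) = P (P f) x - ?c * (T ^^ m) f x"
  proof -
    have "AE x in M. \<forall>i\<in>{..<Suc m}. (T ^^ i) (h i) x = (T ^^ i) (P f) x - 1 / ?l ^ Suc (m - i) * (T ^^ m) f x"
      by (rule AE_finite_allI, simp, rule part, simp)
    then show ?thesis
    proof eventually_elim
      case (elim x)
      have "(\<Sum>i<Suc m. 1 / ?l ^ Suc i * (T ^^ i) (h i) x)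
        = (\<Sum>i<Suc m. 1 / ?l ^ Suc i * (T ^^ i) (P f) x - 1 / ?l ^ (m + 2) * (T ^^ m) f x)"
      proof (rule sum.cong[OF refl])
        fix i assume i: "i \<in> {..<Suc m}"
        have "1 / ?l ^ Suc i * (1 / ?l ^ Suc (m - i)) = 1 / ?l ^ (m + 2)"
          using i by (simp flip: power_add power_Suc add: mult.assoc)
        then show "1 / ?l ^ Suc i * (T ^^ i) (h i) x
          = 1 / ?l ^ Suc i * (T ^^ i) (P f) x - 1 / ?l ^ (m + 2) * (T ^^ m) f x"
          using elim i by (simp only: right_diff_distrib mult.assoc[symmetric])
      qed
      also have "\<dots> = (\<Sum>i<Suc m. 1 / ?l ^ Suc i * (T ^^ i) (P f) x) - of_nat (Suc m) * (1 / ?l ^ (m + 2) * (T ^^ m) f x)"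
        by (simp only: sum_subtractf sum_constant card_lessThan)
      also have "of_nat (Suc m) * (1 / ?l ^ (m + 2) * (T ^^ m) f x) = ?c * (T ^^ m) f x"
        by simp
      finally have eq: "(\<Sum>i<Suc m. 1 / ?l ^ Suc i * (T ^^ i) (h i) x)
        = (\<Sum>i<Suc m. 1 / ?l ^ Suc i * (T ^^ i) (P f) x) - ?c * (T ^^ m) f x" .
      have "p - q + (q - d) = p - d" for p q d :: complex by simp
      then show ?case unfolding eq .
    qed
  qed
  ultimately have nn: "ae_nonneg M (\<lambda>x. P (P f) x - ?c * (T ^^ m) f x)" by (rule ae_nonneg_cong[rotated])
  have c: "?c \<in> \<real>\<^sub>\<ge>\<^sub>0" "norm ?c = real (Suc m) / l ^ (m + 2)"
    using l by (auto simp del: of_real_divide simp add: nonneg_Reals_of_real_iff norm_of_real)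
  have "L2_norm M (\<lambda>x. ?c * (T ^^ m) f x) \<le> L2_norm M (P (P f))"
    by (intro ae_nonneg_norm_le nn L2_scale N.power_L2 PL f ae_nonneg_scale c Tnn)
  then show ?thesis by (simp only: L2_norm_scale[OF N.power_L2[OF f(1)]] c)
qed

text \<open>No complex analysis is needed for positive operators.  Let \<open>R\<close> be the limit of the roots.  If \<open>R\<close> were
  not in the spectrum, the resolvent identity would bound the Neumann series \<open>P\<close> at \<open>R + e\<close> by \<open>2 C\<close>
  for small \<open>e\<close>, where \<open>C\<close> bounds the inverse at \<open>R\<close>.  Then \<open>neumann_square_ge\<close> forces
  \<open>(m + 1) a m \<le> 4 C\<^sup>2 R\<^sup>m\<^sup>+\<^sup>2\<close> for all \<open>m\<close>, against \<open>R\<^sup>m \<le> a m\<close>.\<close>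

lemma spectral_radius_limit:
  assumes k: "pos_kernel M k"
  shows "(\<lambda>j. root j (kernel_size M zero_cone (kernel_power M k j)))
    \<longlonglongrightarrow> spectral_radius M (kernel_op M k)"
proof -
  define a where "a j = kernel_size M zero_cone (kernel_power M k j)" for j
  let ?T = "kernel_op M k"
  have T: "bounded_operator M ?T" by (rule bounded_kernel_op[OF k])
  have a0: "0 \<le> a j" for j
    unfolding a_def by (intro pos_kernel_size_nonneg pos_kernel_power k nn_cone_zero)
  have sub: "a (m + n) \<le> a m * a n" if "1 \<le> m" "1 \<le> n" for m n
  proof -
    have "a (m + n) \<le> kernel_size M zero_cone (kernel_comp M (kernel_power M k m) (kernel_power M k n))"
      unfolding a_def
      by (intro kernel_size_mono pos_kernel_comp pos_kernel_power k nn_cone_zero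
          ae_eq_imp_le kernel_power_add that)
    also have "\<dots> \<le> a m * a n" unfolding a_def by (intro kernel_size_comp pos_kernel_power k)
    finally show ?thesis .
  qed
  obtain R where R: "(\<lambda>n. root n (a n)) \<longlonglongrightarrow> R" "0 \<le> R" "\<And>n. 1 \<le> n \<Longrightarrow> R ^ n \<le> a n"
    by (rule root_submultiplicative[OF a0 sub]) blast+
  define c where "c n = (if n = 0 then 1 else a n)" for n :: nat
  have nc: "neumann_convergent M ?T z c" if z: "R < norm z" for z
  proof
    show "z \<noteq> 0" using z R(2) by auto
    show "0 \<le> c n" for n using a0 by (simp add: c_def)
    show "L2_norm M ((?T ^^ n) f) \<le> c n * L2_norm M f" if "f \<in> L2 M" for f n
      using kernel_op_power_bound[OF k _ that, of n] by (cases "n = 0") (auto simp: c_def a_def)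
    (* Comparison with a geometric series of ratio q / norm z. *)
    obtain q where q: "R < q" "q < norm z" using dense[OF z] by blast
    then have q0: "0 < q" using R(2) by linarith
    have "\<forall>\<^sub>F n in sequentially. root n (a n) < q" using q by (intro order_tendstoD(2)[OF R(1)])
    then obtain n0 where n0: "\<And>n. n0 \<le> n \<Longrightarrow> root n (a n) < q" by (auto simp: eventually_sequentially)
    show "summable (\<lambda>n. c n / norm z ^ Suc n)"
    proof (rule summable_comparison_test')
      have "0 < norm z" using q q0 by linarith
      then show "summable (\<lambda>n. 1 / norm z * (q / norm z) ^ n)"
        using q q0 by (intro summable_mult summable_geometric) (auto simp: divide_less_eq)
      fix n assume n: "n \<ge> max 1 n0"
      then have "root n (a n) ^ n \<le> q ^ n" using n0[of n] a0[of n] by (intro power_mono) auto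
      then have "c n \<le> q ^ n" using n a0[of n] by (simp add: c_def real_root_pow_pos2)
      then have "c n / norm z ^ Suc n \<le> q ^ n / norm z ^ Suc n" by (rule divide_right_mono) simp
      also have "\<dots> = 1 / norm z * (q / norm z) ^ n" by (simp add: power_divide)
      finally show "norm (c n / norm z ^ Suc n) \<le> 1 / norm z * (q / norm z) ^ n"
        using n a0 by (simp add: c_def)
    qed
  qed (rule T)
  have upper: "norm z \<le> R" if "z \<in> spectrum M ?T" for z
    using neumann_convergent.not_in_spectrum[OF nc, of z] that by (meson not_le)
  have mem: "complex_of_real R \<in> spectrum M ?T" if "0 < R"
  proof (rule ccontr)
    assume "complex_of_real R \<notin> spectrum M ?T"
    then obtain S where S: "bounded_operator M S"
      "\<And>f. f \<in> L2 M \<Longrightarrow> AE x in M. S (\<lambda>y. complex_of_real R * f y - ?T f y) x = f x"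
      unfolding spectrum_def by auto
    obtain C where C: "0 < C" "\<And>f. f \<in> L2 M \<Longrightarrow> L2_norm M (S f) \<le> C * L2_norm M f"
      using bounded_operator_bound[OF S(1)] by blast
    have ncR: "neumann_convergent M ?T (complex_of_real (R + e)) c" if "0 < e" for e
    proof (rule nc)
      have "R < \<bar>R + e\<bar>" using that by linarith
      then show "R < norm (complex_of_real (R + e))" by (simp only: norm_of_real)
    qed
    have Pb: "L2_norm M (neumann ?T (complex_of_real (R + e)) f) \<le> 2 * C * L2_norm M f"
      if e: "0 < e" "e * C \<le> 1 / 2" and f: "f \<in> L2 M" for e f
    proof -
      interpret N: neumann_convergent M ?T "complex_of_real (R + e)" c
        by (rule ncR[OF e(1)])
      let ?P = "neumann ?T (complex_of_real (R + e)) f"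
      have P: "?P \<in> L2 M" by (rule N.neumann_L2[OF f])
      let ?g = "\<lambda>y. f y - complex_of_real e * ?P y"
      have g: "?g \<in> L2 M" by (intro L2_diff f L2_scale P)
      have "AE x in M. complex_of_real R * ?P x - ?T ?P x = ?g x"
        using N.neumann_right_inverse[OF f]
      proof eventually_elim
        case (elim x)
        then show ?case by (simp add: distrib_right) (simp add: algebra_simps)
      qed
      then have "AE x in M. S (\<lambda>y. complex_of_real R * ?P y - ?T ?P y) x = S ?g x"
        by (intro bounded_operator_cong[OF S(1)] L2_diff L2_scale P kernel_op_L2[OF k] f)
      with S(2)[OF P] have "AE x in M. ?P x = S ?g x" by eventually_elim simp
      then have "L2_norm M ?P = L2_norm M (S ?g)"
        by (rule L2_norm_cong_AE[OF P bounded_operatorD(1)[OF S(1) g]])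
      also have "\<dots> \<le> C * L2_norm M ?g" by (rule C(2)[OF g])
      also have "\<dots> \<le> C * (L2_norm M f + e * L2_norm M ?P)"
      proof (rule mult_left_mono)
        have "L2_norm M ?g \<le> L2_norm M f + L2_norm M (\<lambda>y. complex_of_real e * ?P y)"
          by (rule L2_norm_diff[OF f L2_scale[OF P]])
        also have "L2_norm M (\<lambda>y. complex_of_real e * ?P y) = e * L2_norm M ?P"
          using e(1) by (simp only: L2_norm_scale[OF P] norm_of_real abs_of_pos)
        finally show "L2_norm M ?g \<le> L2_norm M f + e * L2_norm M ?P" .
      qed (use C(1) in simp)
      also have "\<dots> = C * L2_norm M f + (e * C) * L2_norm M ?P" by (simp add: algebra_simps)
      also have "\<dots> \<le> C * L2_norm M f + 1 / 2 * L2_norm M ?P"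
        by (intro add_left_mono mult_right_mono e) simp
      finally show ?thesis by simp
    qed
    have am: "real (Suc m) * a m \<le> 4 * C\<^sup>2 * R ^ (m + 2)" if m: "1 \<le> m" for m
    proof -
      have le: "real (Suc m) * a m \<le> 4 * C\<^sup>2 * (R + e) ^ (m + 2)" if e: "0 < e" "e * C \<le> 1 / 2" for e
      proof -
        let ?P = "neumann ?T (complex_of_real (R + e))"
        have re: "0 < R + e" using e \<open>0 < R\<close> by simp
        have nc': "neumann_convergent M ?T (complex_of_real (R + e)) c"
          by (rule ncR[OF e(1)])
        interpret N: neumann_convergent M ?T "complex_of_real (R + e)" c by (rule nc')
        have "a m \<le> 4 * C\<^sup>2 * (R + e) ^ (m + 2) / real (Suc m)"
          unfolding a_def
        proof (rule size_power_le[OF k m])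
          show "0 \<le> 4 * C\<^sup>2 * (R + e) ^ (m + 2) / real (Suc m)" using re by simp
          fix f assume f: "f \<in> L2 M" "ae_nonneg M f"
          have "real (Suc m) / (R + e) ^ (m + 2) * L2_norm M ((?T ^^ m) f) \<le> L2_norm M (?P (?P f))"
            by (rule neumann_square_ge[OF k nc' re f])
          also have "\<dots> \<le> 2 * C * L2_norm M (?P f)" by (rule Pb[OF e N.neumann_L2[OF f(1)]])
          also have "\<dots> \<le> 2 * C * (2 * C * L2_norm M f)"
            using C(1) Pb[OF e f(1)] by (intro mult_left_mono) auto
          also have "\<dots> = 4 * C\<^sup>2 * L2_norm M f" by (simp add: power2_eq_square)
          finally have "real (Suc m) / (R + e) ^ (m + 2) * L2_norm M ((?T ^^ m) f) \<le> 4 * C\<^sup>2 * L2_norm M f" .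
          then have "(R + e) ^ (m + 2) / real (Suc m) * (real (Suc m) / (R + e) ^ (m + 2) * L2_norm M ((?T ^^ m) f))
            \<le> (R + e) ^ (m + 2) / real (Suc m) * (4 * C\<^sup>2 * L2_norm M f)"
            using re by (intro mult_left_mono) auto
          moreover have "(R + e) ^ (m + 2) / real (Suc m) * (real (Suc m) / (R + e) ^ (m + 2) * L2_norm M ((?T ^^ m) f))
            = L2_norm M ((?T ^^ m) f)"
            using re by (simp del: power_add power_Suc of_nat_Suc)
          ultimately show "L2_norm M ((?T ^^ m) f) \<le> 4 * C\<^sup>2 * (R + e) ^ (m + 2) / real (Suc m) * L2_norm M f"
            by (simp add: ac_simps)
        qed
        then show ?thesis by (simp add: le_divide_eq mult.commute)
      qed
      have lim: "((\<lambda>e. 4 * C\<^sup>2 * (R + e) ^ (m + 2)) \<longlongrightarrow> 4 * C\<^sup>2 * (R + 0) ^ (m + 2)) (at_right 0)"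
        by (intro tendsto_intros)
      have "\<forall>\<^sub>F e in at_right 0. e < 1 / (2 * C)"
        using eventually_at_right_real[of 0 "1 / (2 * C)"] C(1) by (auto elim!: eventually_mono)
      with eventually_at_right_less[of "0::real"]
      have "\<forall>\<^sub>F e in at_right 0. real (Suc m) * a m \<le> 4 * C\<^sup>2 * (R + e) ^ (m + 2)"
      proof eventually_elim
        case (elim e)
        then have "e * C \<le> 1 / 2" using C(1) by (simp add: field_simps)
        then show ?case using elim by (intro le) auto
      qed
      then have "real (Suc m) * a m \<le> 4 * C\<^sup>2 * (R + 0) ^ (m + 2)"
        by (rule tendsto_lowerbound[OF lim]) simp
      then show ?thesis by simp
    qed
    obtain m :: nat where m: "4 * C\<^sup>2 * R\<^sup>2 < real m" using reals_Archimedean2 by blast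
    then have m1: "1 \<le> m" by (cases m) (auto simp: mult_less_0_iff not_less[symmetric])
    have "real (Suc m) * R ^ m \<le> real (Suc m) * a m" using R(3)[OF m1] by (intro mult_left_mono) auto
    also have "\<dots> \<le> (4 * C\<^sup>2 * R\<^sup>2) * R ^ m" using am[OF m1] by (simp add: power_add ac_simps power2_eq_square)
    finally have "real (Suc m) \<le> 4 * C\<^sup>2 * R\<^sup>2" using \<open>0 < R\<close> by simp
    then show False using m by simp
  qed
  have "spectral_radius M ?T = R"
  proof (cases "R = 0")
    case True
    then have "insert 0 (norm ` spectrum M ?T) = {0}" using upper by auto
    then show ?thesis unfolding spectral_radius_def True by (simp only: cSup_singleton)
  next
    case False
    then have "R \<in> norm ` spectrum M ?T" using mem R(2) by (intro image_eqI[of _ _ "complex_of_real R"]) auto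
    then show ?thesis unfolding spectral_radius_def
      using upper R(2) by (intro cSup_eq_maximum) auto
  qed
  then show ?thesis using R(1) by (simp add: a_def)
qed

end

section \<open>Kernels of positive operators\<close>

text \<open>Sets of pairs whose section over \<open>x\<close> is one of countably many sets and is selected by \<open>i x\<close>.  They
  form an algebra containing the rectangles, and a statement that holds for almost all \<open>x\<close> and each
  fixed section holds for almost all \<open>x\<close> and the selected section.\<close>

definition stripes :: "'a measure \<Rightarrow> ('a \<Rightarrow> nat) \<Rightarrow> (nat \<Rightarrow> 'a set) \<Rightarrow> ('a \<times> 'a) set" where
  "stripes M i H = (\<Union>n. (i -` {n} \<inter> space M) \<times> H n)"

definition stripe_sets :: "'a measure \<Rightarrow> ('a \<times> 'a) set set" where
  "stripe_sets M = {stripes M i H | i H. i \<in> M \<rightarrow>\<^sub>M count_space UNIV \<and> range H \<subseteq> sets M}"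

lemma stripes_iff: "(x, y) \<in> stripes M i H \<longleftrightarrow> x \<in> space M \<and> y \<in> H (i x)"
  by (auto simp: stripes_def)

lemma stripe_sets_measurable: "G \<in> stripe_sets M \<Longrightarrow> G \<in> sets (M \<Otimes>\<^sub>M M)"
  by (auto simp: stripe_sets_def stripes_def intro!: sets.countable_UN pair_measureI measurable_sets)

lemma stripe_sets_rectangle:
  assumes [measurable]: "A \<in> sets M" "B \<in> sets M"
  shows "A \<times> B \<in> stripe_sets M"
proof -
  let ?i = "\<lambda>x. if x \<in> A then 0 else Suc 0" and ?H = "\<lambda>n. if n = 0 then B else {}"
  have "A \<times> B = stripes M ?i ?H"
  proof (rule set_eqI)
    fix p show "p \<in> A \<times> B \<longleftrightarrow> p \<in> stripes M ?i ?H"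
      using sets.sets_into_space[OF assms(1)] by (cases p; cases "fst p \<in> A") (auto simp: stripes_iff)
  qed
  moreover have "?i \<in> M \<rightarrow>\<^sub>M count_space UNIV" by measurable
  moreover have "range ?H \<subseteq> sets M" using assms(2) by auto
  ultimately show ?thesis unfolding stripe_sets_def mem_Collect_eq by (intro exI conjI)
qed

lemma stripe_sets_compl:
  assumes "G \<in> stripe_sets M"
  shows "space (M \<Otimes>\<^sub>M M) - G \<in> stripe_sets M"
proof -
  obtain i H where G: "G = stripes M i H" "i \<in> M \<rightarrow>\<^sub>M count_space UNIV" "range H \<subseteq> sets M"
    using assms by (auto simp: stripe_sets_def)
  have "space (M \<Otimes>\<^sub>M M) - G = stripes M i (\<lambda>n. space M - H n)"
    by (auto simp: G stripes_iff space_pair_measure)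
  moreover have "range (\<lambda>n. space M - H n) \<subseteq> sets M" using G by auto
  ultimately show ?thesis unfolding stripe_sets_def using G(2) by blast
qed

lemma stripe_sets_Un:
  assumes "G \<in> stripe_sets M" "G' \<in> stripe_sets M"
  shows "G \<union> G' \<in> stripe_sets M"
proof -
  obtain i H where G: "G = stripes M i H" "i \<in> M \<rightarrow>\<^sub>M count_space UNIV" "range H \<subseteq> sets M"
    using assms(1) by (auto simp: stripe_sets_def)
  obtain j K where G': "G' = stripes M j K" "j \<in> M \<rightarrow>\<^sub>M count_space UNIV" "range K \<subseteq> sets M"
    using assms(2) by (auto simp: stripe_sets_def)
  let ?i = "\<lambda>x. prod_encode (i x, j x)"
  let ?H = "\<lambda>n. H (fst (prod_decode n)) \<union> K (snd (prod_decode n))"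
  have "G \<union> G' = stripes M ?i ?H" by (auto simp: G G' stripes_iff)
  moreover have "?i \<in> M \<rightarrow>\<^sub>M count_space UNIV"
  proof (rule measurable_compose_countable[OF _ G(2), of "\<lambda>n x. prod_encode (n, j x)"])
    show "(\<lambda>x. prod_encode (n, j x)) \<in> M \<rightarrow>\<^sub>M count_space UNIV" for n
      by (rule measurable_compose[OF G'(2)]) simp
  qed
  moreover have "range ?H \<subseteq> sets M" using G(3) G'(3) by auto
  ultimately show ?thesis unfolding stripe_sets_def by blast
qed

lemma stripe_sets_approx:
  assumes Q: "finite_measure Q" and sets_Q: "sets Q = sets (M \<Otimes>\<^sub>M M)" and E: "E \<in> sets (M \<Otimes>\<^sub>M M)"
  shows "\<forall>\<epsilon>>0. \<exists>G\<in>stripe_sets M. measure Q (E - G \<union> (G - E)) < \<epsilon>"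
proof -
  interpret finite_measure Q by (rule Q)
  have G_sets: "G \<in> sets Q" if "G \<in> stripe_sets M" for G
    using stripe_sets_measurable[OF that] sets_Q by simp
  have base: "\<forall>\<epsilon>>0. \<exists>G\<in>stripe_sets M. measure Q (E - G \<union> (G - E)) < \<epsilon>" if "E \<in> stripe_sets M" for E
    using that by (intro allI impI bexI[of _ E]) auto
  have Un: "\<forall>\<epsilon>>0. \<exists>G\<in>stripe_sets M. measure Q ((E \<union> E') - G \<union> (G - (E \<union> E'))) < \<epsilon>"
    if E: "E \<in> sets Q" "\<forall>\<epsilon>>0. \<exists>G\<in>stripe_sets M. measure Q (E - G \<union> (G - E)) < \<epsilon>"
      and E': "E' \<in> sets Q" "\<forall>\<epsilon>>0. \<exists>G\<in>stripe_sets M. measure Q (E' - G \<union> (G - E')) < \<epsilon>" for E E'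
  proof (intro allI impI)
    fix \<epsilon> :: real assume "0 < \<epsilon>"
    then obtain G G' where G: "G \<in> stripe_sets M" "measure Q (E - G \<union> (G - E)) < \<epsilon> / 2"
      and G': "G' \<in> stripe_sets M" "measure Q (E' - G' \<union> (G' - E')) < \<epsilon> / 2"
      using E(2) E'(2) half_gt_zero by blast
    have "measure Q ((E \<union> E') - (G \<union> G') \<union> ((G \<union> G') - (E \<union> E')))
      \<le> measure Q ((E - G \<union> (G - E)) \<union> (E' - G' \<union> (G' - E')))"
      using E E' G_sets[OF G(1)] G_sets[OF G'(1)] by (intro finite_measure_mono) auto
    also have "\<dots> \<le> measure Q (E - G \<union> (G - E)) + measure Q (E' - G' \<union> (G' - E'))"
      using E E' G_sets[OF G(1)] G_sets[OF G'(1)] by (intro measure_Un_le) auto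
    finally show "\<exists>G\<in>stripe_sets M. measure Q ((E \<union> E') - G \<union> (G - (E \<union> E'))) < \<epsilon>"
      using G G' by (intro bexI[of _ "G \<union> G'"] stripe_sets_Un) auto
  qed
  show ?thesis
    using Int_stable_pair_measure_generator[of M M] pair_measure_closed[of M M] E[unfolded sets_pair_measure]
  proof (induct rule: sigma_sets_induct_disjoint)
    case (basic E)
    then show ?case using base stripe_sets_rectangle by blast
  next
    case empty
    then show ?case using base[of "{}"] stripe_sets_rectangle[of "{}" M "{}"] by simp
  next
    case (compl E)
    then have "E \<in> sets (M \<Otimes>\<^sub>M M)" by (simp add: sets_pair_measure)
    then have sub: "E \<subseteq> space (M \<Otimes>\<^sub>M M)" by (rule sets.sets_into_space)
    show ?case
    proof (intro allI impI)
      fix \<epsilon> :: real assume "0 < \<epsilon>"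
      then obtain G where G: "G \<in> stripe_sets M" "measure Q (E - G \<union> (G - E)) < \<epsilon>" using compl(2) by blast
      have "G \<subseteq> space (M \<Otimes>\<^sub>M M)" by (rule sets.sets_into_space[OF stripe_sets_measurable[OF G(1)]])
      then have "(space M \<times> space M - E) - (space (M \<Otimes>\<^sub>M M) - G) \<union> ((space (M \<Otimes>\<^sub>M M) - G) - (space M \<times> space M - E))
        = E - G \<union> (G - E)"
        using sub by (auto simp: space_pair_measure)
      then show "\<exists>G\<in>stripe_sets M. measure Q ((space M \<times> space M - E) - G \<union> (G - (space M \<times> space M - E))) < \<epsilon>"
        using G by (intro bexI[of _ "space (M \<Otimes>\<^sub>M M) - G"] stripe_sets_compl) auto
    qed
  next
    case (union A)
    have A: "A n \<in> sets Q" for n using union(2) sets_Q by (auto simp: sets_pair_measure)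
    let ?U = "\<lambda>n. \<Union>i<n. A i"
    have U: "?U n \<in> sets Q" for n using A by auto
    have part: "\<forall>\<epsilon>>0. \<exists>G\<in>stripe_sets M. measure Q (?U n - G \<union> (G - ?U n)) < \<epsilon>" for n :: nat
    proof (induction n)
      case 0
      then show ?case using base[of "{}"] stripe_sets_rectangle[of "{}" M "{}"] by simp
    next
      case (Suc n)
      have "?U (Suc n) = ?U n \<union> A n" by (auto simp: less_Suc_eq)
      then show ?case using Un[OF U[of n] Suc A[of n] union(3)] by simp
    qed
    have "(\<lambda>n. measure Q (?U n)) \<longlonglongrightarrow> measure Q (\<Union>n. ?U n)"
    proof (rule finite_Lim_measure_incseq)
      show "incseq ?U" by (intro monoI UN_mono) auto
    qed (use U in blast)
    moreover have UU: "(\<Union>n. ?U n) = (\<Union>n. A n)" by auto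
    ultimately have lim: "(\<lambda>n. measure Q (?U n)) \<longlonglongrightarrow> measure Q (\<Union>n. A n)" by simp
    show ?case
    proof (intro allI impI)
      fix \<epsilon> :: real assume \<epsilon>: "0 < \<epsilon>"
      have "\<forall>\<^sub>F n in sequentially. measure Q (\<Union>n. A n) - \<epsilon> / 2 < measure Q (?U n)"
        using \<epsilon> by (intro order_tendstoD(1)[OF lim]) simp
      then obtain n where n: "measure Q (\<Union>n. A n) - \<epsilon> / 2 < measure Q (?U n)"
        using eventually_happens'[OF sequentially_bot] by blast
      obtain G where G: "G \<in> stripe_sets M" "measure Q (?U n - G \<union> (G - ?U n)) < \<epsilon> / 2"
        using part[of n] half_gt_zero[OF \<epsilon>] by blast
      have AU: "(\<Union>n. A n) \<in> sets Q" using A by auto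
      have "measure Q ((\<Union>n. A n) - ?U n) = measure Q (\<Union>n. A n) - measure Q (?U n)"
        by (rule finite_measure_Diff[OF AU U]) auto
      then have d: "measure Q ((\<Union>n. A n) - ?U n) < \<epsilon> / 2" using n by simp
      have "measure Q ((\<Union>n. A n) - G \<union> (G - (\<Union>n. A n)))
        \<le> measure Q (((\<Union>n. A n) - ?U n) \<union> (?U n - G \<union> (G - ?U n)))"
        using AU U[of n] G_sets[OF G(1)] by (intro finite_measure_mono) auto
      also have "\<dots> \<le> measure Q ((\<Union>n. A n) - ?U n) + measure Q (?U n - G \<union> (G - ?U n))"
        using AU U[of n] G_sets[OF G(1)] by (intro measure_Un_le) auto
      finally show "\<exists>G\<in>stripe_sets M. measure Q ((\<Union>n. A n) - G \<union> (G - (\<Union>n. A n))) < \<epsilon>"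
        using G d by (intro bexI[of _ G]) auto
    qed
  qed
qed

lemma nn_integral_neg_le_pos:
  fixes u :: "'a \<Rightarrow> real"
  assumes u: "integrable M u" "0 \<le> (LINT x|M. u x)"
  shows "(\<integral>\<^sup>+x. ennreal (- u x) \<partial>M) \<le> (\<integral>\<^sup>+x. ennreal (u x) \<partial>M)"
proof -
  have fin: "(\<integral>\<^sup>+x. ennreal (u x) \<partial>M) < \<infinity>" "(\<integral>\<^sup>+x. ennreal (- u x) \<partial>M) < \<infinity>"
    using u(1) by (auto simp: real_integrable_def less_top)
  have "enn2real (\<integral>\<^sup>+x. ennreal (- u x) \<partial>M) \<le> enn2real (\<integral>\<^sup>+x. ennreal (u x) \<partial>M)"
    using u(2) real_lebesgue_integral_def[OF u(1)] by simp
  then have "ennreal (enn2real (\<integral>\<^sup>+x. ennreal (- u x) \<partial>M)) \<le> ennreal (enn2real (\<integral>\<^sup>+x. ennreal (u x) \<partial>M))"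
    by (rule ennreal_leI)
  then show ?thesis using fin by (metis ennreal_enn2real infinity_ennreal_def)
qed

context sigma_finite_measure
begin

interpretation P: pair_sigma_finite M M ..

text \<open>Positivity yields \<open>\<integral>\<^sub>B k(x,y) \<phi>(y) dy \<ge> 0\<close> for each set \<open>B\<close> and almost all \<open>x\<close>, but the null set
  depends on \<open>B\<close>.  With weights \<open>\<phi>\<close> and \<open>\<rho>\<close> that make the measure \<open>Q\<close> with density
  \<open>\<bar>k\<bar> \<phi> \<rho>\<close> finite, it follows that every stripe set \<open>G\<close> carries at least as much mass on \<open>{k > 0}\<close> as on
  \<open>E = {k < 0}\<close>.  If \<open>G\<close> approximates \<open>E\<close>, the former mass is small and the latter is close to \<open>Q(E)\<close>.\<close>

lemma positive_operator_kernel_nonneg: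
  assumes k: "kernel_operator M k" and pos: "positive_operator M (kernel_op M k)"
  shows "AE x in M. AE y in M. 0 \<le> k x y"
proof -
  have km[measurable]: "measurable_kernel M k"
    and int: "\<And>f. f \<in> L2 M \<Longrightarrow> AE x in M. integrable M (\<lambda>y. complex_of_real (k x y) * f y)"
    using k by (auto simp: kernel_operator_def)
  obtain \<phi> :: "'a \<Rightarrow> real" where \<phi>m[measurable]: "\<phi> \<in> borel_measurable M" and \<phi>: "\<And>x. 0 < \<phi> x"
    "integrable M \<phi>" "(\<integral>\<^sup>+x. (ennreal (\<phi> x))\<^sup>2 \<partial>M) < \<infinity>"
    by (rule obtain_positive_L2) blast
  note \<phi>0 = less_imp_le[OF \<phi>(1)]
  have sec: "AE x in M. integrable M (\<lambda>y. k x y * (\<phi> y * indicator B y)) \<and> 0 \<le> (LINT y|M. k x y * (\<phi> y * indicator B y))"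
    if B[measurable]: "B \<in> sets M" for B
  proof -
    let ?f = "\<lambda>y. complex_of_real (\<phi> y * indicator B y)"
    have "(\<integral>\<^sup>+x. (nn_abs ?f x)\<^sup>2 \<partial>M) \<le> (\<integral>\<^sup>+x. (ennreal (\<phi> x))\<^sup>2 \<partial>M)"
      using \<phi>0 by (intro nn_integral_mono power_mono ennreal_leI) (auto simp: indicator_def)
    then have f: "?f \<in> L2 M" using \<phi>(3) by (simp add: L2_iff le_less_trans)
    have "AE x in M. ?f x \<in> \<real>\<^sub>\<ge>\<^sub>0" using \<phi>0 by (intro AE_I2) (auto simp: indicator_def)
    then have "AE x in M. kernel_op M k ?f x \<in> \<real>\<^sub>\<ge>\<^sub>0" 
      by (rule pos[unfolded positive_operator_def, rule_format, OF f])
    with int[OF f] show ?thesis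
    proof eventually_elim
      case (elim x)
      have i: "integrable M (\<lambda>y. k x y * (\<phi> y * indicator B y))"
        using integrable_Re[OF elim(1)] by simp
      have "kernel_op M k ?f x = complex_of_real (LINT y|M. k x y * (\<phi> y * indicator B y))"
        unfolding kernel_op_def integral_complex_of_real[symmetric]
        by (intro Bochner_Integration.integral_cong) simp_all
      then show ?case using i elim(2) by (simp add: nonneg_Reals_of_real_iff)
    qed
  qed
  define h where "h x = (\<integral>\<^sup>+y. ennreal (\<bar>k x y\<bar> * \<phi> y) \<partial>M)" for x
  have [measurable]: "h \<in> borel_measurable M" unfolding h_def by measurable
  have hfin: "AE x in M. h x < \<infinity>"
    using sec[OF sets.top]
  proof eventually_elim
    case (elim x)
    have "h x = (\<integral>\<^sup>+y. ennreal (norm (k x y * (\<phi> y * indicator (space M) y))) \<partial>M)"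
      unfolding h_def using \<phi>0 by (intro nn_integral_cong) (simp add: abs_mult)
    then show ?case using elim by (simp add: integrable_iff_bounded)
  qed
  (* The denominator compensates for h, so that the integral of h * \<rho> is finite. *)
  define \<rho> where "\<rho> x = \<phi> x / (1 + enn2real (h x))" for x
  have [measurable]: "\<rho> \<in> borel_measurable M" unfolding \<rho>_def by measurable
  have \<rho>: "0 < \<rho> x" for x using \<phi>(1)[of x] by (simp add: \<rho>_def add_pos_nonneg)
  define q where "q = (\<lambda>(x, y). ennreal (\<bar>k x y\<bar> * \<phi> y) * ennreal (\<rho> x))"
  have qm[measurable]: "q \<in> borel_measurable (M \<Otimes>\<^sub>M M)" unfolding q_def by measurable
  define Q where "Q = density (M \<Otimes>\<^sub>M M) q"
  have sets_Q: "sets Q = sets (M \<Otimes>\<^sub>M M)" by (simp add: Q_def)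
  have emQ: "emeasure Q S = (\<integral>\<^sup>+x. (\<integral>\<^sup>+y. ennreal (\<bar>k x y\<bar> * \<phi> y) * indicator S (x, y) \<partial>M) * ennreal (\<rho> x) \<partial>M)"
    if [measurable]: "S \<in> sets (M \<Otimes>\<^sub>M M)" for S
  proof -
    have "emeasure Q S = (\<integral>\<^sup>+p. q p * indicator S p \<partial>(M \<Otimes>\<^sub>M M))"
      unfolding Q_def by (rule emeasure_density[OF qm that])
    also have "\<dots> = (\<integral>\<^sup>+x. \<integral>\<^sup>+y. q (x, y) * indicator S (x, y) \<partial>M \<partial>M)"
      by (rule nn_integral_fst[symmetric]) measurable
    also have "\<dots> = (\<integral>\<^sup>+x. (\<integral>\<^sup>+y. ennreal (\<bar>k x y\<bar> * \<phi> y) * indicator S (x, y) \<partial>M) * ennreal (\<rho> x) \<partial>M)"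
      unfolding q_def by (intro nn_integral_cong, subst nn_integral_multc[symmetric]) (auto simp: ac_simps)
    finally show ?thesis .
  qed
  have "emeasure Q (space Q) < \<infinity>"
  proof -
    have "emeasure Q (space (M \<Otimes>\<^sub>M M)) \<le> (\<integral>\<^sup>+x. h x * ennreal (\<rho> x) \<partial>M)"
      unfolding h_def by (subst emQ) (auto intro!: nn_integral_mono mult_right_mono simp: indicator_def)
    also have "\<dots> \<le> (\<integral>\<^sup>+x. ennreal (\<phi> x) \<partial>M)"
    proof (rule nn_integral_mono_AE)
      show "AE x in M. h x * ennreal (\<rho> x) \<le> ennreal (\<phi> x)"
        using hfin
      proof eventually_elim
        case (elim x)
        then obtain t where t: "h x = ennreal t" "0 \<le> t" by (cases "h x") auto
        have "t * (\<phi> x / (1 + t)) \<le> \<phi> x" using t \<phi>0[of x] by (simp add: divide_le_eq mult_left_mono distrib_left mult.commute)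
        then show ?case using t \<phi>0[of x] by (simp add: \<rho>_def ennreal_leI flip: ennreal_mult)
      qed
    qed
    also have "\<dots> < \<infinity>" using \<phi>(2) \<phi>0 by (simp add: nn_integral_eq_integral)
    finally show ?thesis by (simp add: Q_def)
  qed
  then interpret Q: finite_measure Q by (intro finite_measureI) auto
  define E where "E = {p \<in> space (M \<Otimes>\<^sub>M M). k (fst p) (snd p) < 0}"
  define E' where "E' = {p \<in> space (M \<Otimes>\<^sub>M M). 0 < k (fst p) (snd p)}"
  have Em[measurable]: "E \<in> sets (M \<Otimes>\<^sub>M M)" "E' \<in> sets (M \<Otimes>\<^sub>M M)" unfolding E_def E'_def by measurable
  have sign: "emeasure Q (G \<inter> E) \<le> emeasure Q (G \<inter> E')" if G: "G \<in> stripe_sets M" for G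
  proof -
    note [measurable] = stripe_sets_measurable[OF G]
    obtain i H where GH: "G = stripes M i H" "i \<in> M \<rightarrow>\<^sub>M count_space UNIV" "range H \<subseteq> sets M"
      using G by (auto simp: stripe_sets_def)
    have Hm: "H n \<in> sets M" for n using GH by auto
    have "AE x in M. \<forall>n. integrable M (\<lambda>y. k x y * (\<phi> y * indicator (H n) y)) \<and> 0 \<le> (LINT y|M. k x y * (\<phi> y * indicator (H n) y))"
      unfolding AE_all_countable by (intro allI sec Hm)
    then have "AE x in M. (\<integral>\<^sup>+y. ennreal (\<bar>k x y\<bar> * \<phi> y) * indicator (G \<inter> E) (x, y) \<partial>M) * ennreal (\<rho> x)
      \<le> (\<integral>\<^sup>+y. ennreal (\<bar>k x y\<bar> * \<phi> y) * indicator (G \<inter> E') (x, y) \<partial>M) * ennreal (\<rho> x)"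
      using AE_space
    proof eventually_elim
      case (elim x)
      let ?u = "\<lambda>y. k x y * (\<phi> y * indicator (H (i x)) y)"
      have "(\<integral>\<^sup>+y. ennreal (\<bar>k x y\<bar> * \<phi> y) * indicator (G \<inter> E) (x, y) \<partial>M) = (\<integral>\<^sup>+y. ennreal (- ?u y) \<partial>M)"
        using elim(2) \<phi>0 by (intro nn_integral_cong)
          (auto simp: indicator_def GH stripes_iff E_def space_pair_measure not_less mult_nonneg_nonneg intro!: ennreal_neg)
      also have "\<dots> \<le> (\<integral>\<^sup>+y. ennreal (?u y) \<partial>M)" by (rule nn_integral_neg_le_pos) (use elim in auto)
      also have "\<dots> = (\<integral>\<^sup>+y. ennreal (\<bar>k x y\<bar> * \<phi> y) * indicator (G \<inter> E') (x, y) \<partial>M)"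
        using elim(2) \<phi>0 by (intro nn_integral_cong)
          (auto simp: indicator_def GH stripes_iff E'_def space_pair_measure mult_nonpos_nonneg not_less intro!: ennreal_neg)
      finally show ?case by (rule mult_right_mono) simp
    qed
    then show ?thesis by (simp add: emQ nn_integral_mono_AE)
  qed
  have "measure Q E \<le> 0"
  proof (rule field_le_epsilon)
    fix \<epsilon> :: real assume "0 < \<epsilon>"
    then have "0 < \<epsilon> / 2" by simp
    then obtain G where G: "G \<in> stripe_sets M" "measure Q (E - G \<union> (G - E)) < \<epsilon> / 2"
      using stripe_sets_approx[OF Q.finite_measure_axioms sets_Q Em(1)] by blast
    have GQ: "G \<in> sets Q" "E \<in> sets Q" "E' \<in> sets Q" using stripe_sets_measurable[OF G(1)] sets_Q Em by auto
    have "measure Q E = measure Q ((E - G) \<union> (G \<inter> E))" by (rule arg_cong[where f="measure Q"]) auto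
    also have "\<dots> \<le> measure Q (E - G) + measure Q (G \<inter> E)" using GQ by (intro measure_Un_le) auto
    also have "measure Q (G \<inter> E) \<le> measure Q (G \<inter> E')"
      using sign[OF G(1)] by (simp add: Q.emeasure_eq_measure)
    also have "\<dots> \<le> measure Q (G - E)"
      using GQ by (intro Q.finite_measure_mono) (auto simp: E_def E'_def)
    also have "measure Q (E - G) + measure Q (G - E) \<le> measure Q (E - G \<union> (G - E)) + measure Q (E - G \<union> (G - E))"
      using GQ by (intro add_mono Q.finite_measure_mono) auto
    also have "\<dots> \<le> 0 + \<epsilon>" using G(2) by simp
    finally show "measure Q E \<le> 0 + \<epsilon>" by simp
  qed
  then have "emeasure Q E = 0" by (simp add: Q.emeasure_eq_measure measure_le_0_iff)
  then have "(\<integral>\<^sup>+p. q p * indicator E p \<partial>(M \<Otimes>\<^sub>M M)) = 0"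
    unfolding Q_def by (subst (asm) emeasure_density) auto
  then have "AE p in M \<Otimes>\<^sub>M M. q p * indicator E p = 0" by (subst (asm) nn_integral_0_iff_AE) auto
  then have "AE x in M. AE y in M. q (x, y) * indicator E (x, y) = 0" by (rule P.AE_pair)
  with AE_space show ?thesis
  proof eventually_elim
    case (elim x)
    from elim(2) AE_space show ?case
    proof eventually_elim
      case (elim y)
      show ?case
      proof (rule ccontr)
        assume "\<not> 0 \<le> k x y"
        then have "(x, y) \<in> E" "q (x, y) \<noteq> 0"
          using \<open>x \<in> space M\<close> \<open>y \<in> space M\<close> \<phi>(1)[of y] \<rho>[of x]
          by (auto simp: E_def space_pair_measure q_def ennreal_eq_0_iff not_le intro!: mult_neg_pos)
        then show False using elim by simp
      qed
    qed
  qed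
qed

end

context sigma_finite_measure
begin

interpretation P: pair_sigma_finite M M ..

text \<open>If the form were unbounded on the unit ball, there would be \<open>f\<^sub>n\<close> and \<open>g\<^sub>n\<close> in it with form at least
  \<open>n 4\<^sup>n\<close>.  The square roots \<open>\<phi>\<close> and \<open>\<psi>\<close> of the sums of \<open>(f\<^sub>n / 2\<^sup>n)\<^sup>2\<close> and \<open>(g\<^sub>n / 2\<^sup>n)\<^sup>2\<close> are square
  integrable and dominate all \<open>f\<^sub>n / 2\<^sup>n\<close> and \<open>g\<^sub>n / 2\<^sup>n\<close>, so their form would be infinite.\<close>

lemma kernel_operator_bounded:
  assumes k: "kernel_operator M k" and h: "measurable_kernel M h"
    "\<And>x y. 0 \<le> h x y" "ae_eq M k h"
  shows "pos_kernel M h"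
proof -
  note [measurable] = h(1)
  have km[measurable]: "measurable_kernel M k"
    and int: "\<And>f. f \<in> L2 M \<Longrightarrow> AE x in M. integrable M (\<lambda>y. complex_of_real (k x y) * f y)"
    and L2: "\<And>f. f \<in> L2 M \<Longrightarrow> kernel_op M k f \<in> L2 M"
    using k by (auto simp: kernel_operator_def)
  have fin: "form M h (\<lambda>x. ennreal (\<phi> x)) (\<lambda>x. ennreal (\<psi> x)) < \<infinity>"
    if [measurable]: "\<phi> \<in> borel_measurable M" "\<psi> \<in> borel_measurable M"
      and nn: "\<And>x. 0 \<le> \<phi> x" and \<phi>: "(\<integral>\<^sup>+x. (ennreal (\<phi> x))\<^sup>2 \<partial>M) < \<infinity>"
      and \<psi>: "(\<integral>\<^sup>+x. (ennreal (\<psi> x))\<^sup>2 \<partial>M) < \<infinity>" for \<phi> \<psi> :: "'a \<Rightarrow> real"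
  proof -
    let ?f = "\<lambda>x. complex_of_real (\<phi> x)"
    have f: "?f \<in> L2 M" using \<phi> nn by (simp add: L2_iff)
    have "AE x in M. act M h (\<lambda>x. ennreal (\<phi> x)) x = nn_abs (kernel_op M k ?f) x"
      using int[OF f] h(3)[unfolded ae_eq_def] AE_space
    proof eventually_elim
      case (elim x)
      then have [measurable]: "x \<in> space M" by simp
      have i: "integrable M (\<lambda>y. k x y * \<phi> y)" using integrable_Re[OF elim(1)] by simp
      have n: "AE y in M. 0 \<le> k x y * \<phi> y"
        using elim(2) by eventually_elim (use h(2) nn in simp)
      have e: "kernel_op M k ?f x = complex_of_real (LINT y|M. k x y * \<phi> y)"
        unfolding kernel_op_def by (simp flip: of_real_mult)
      have "act M h (\<lambda>x. ennreal (\<phi> x)) x = (\<integral>\<^sup>+y. ennreal (k x y * \<phi> y) \<partial>M)"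
        unfolding act_def
      proof (rule nn_integral_cong_AE)
        show "AE y in M. ennreal (h x y) * ennreal (\<phi> y) = ennreal (k x y * \<phi> y)"
          using elim(2)
        proof eventually_elim
          case (elim y)
          then show ?case using h(2)[of x y] by (simp add: ennreal_mult')
        qed
      qed
      also have "\<dots> = ennreal (LINT y|M. k x y * \<phi> y)" by (rule nn_integral_eq_integral[OF i n])
      finally show ?case using integral_nonneg_AE[OF n] by (simp add: e)
    qed
    then have "form M h (\<lambda>x. ennreal (\<phi> x)) (\<lambda>x. ennreal (\<psi> x)) = (\<integral>\<^sup>+x. nn_abs (kernel_op M k ?f) x * ennreal (\<psi> x) \<partial>M)"
      unfolding form_def by (intro nn_integral_cong_AE) (auto elim!: eventually_mono)
    also have "\<dots> < \<infinity>"
    proof -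
      obtain t where t: "(\<integral>\<^sup>+x. (ennreal (\<psi> x))\<^sup>2 \<partial>M) = ennreal t" "0 \<le> t"
        using \<psi> by (cases "\<integral>\<^sup>+x. (ennreal (\<psi> x))\<^sup>2 \<partial>M") auto
      note [measurable] = L2_measurable[OF L2[OF f]]
      have "(\<integral>\<^sup>+x. nn_abs (kernel_op M k ?f) x * ennreal (\<psi> x) \<partial>M) \<le> ennreal (L2_norm M (kernel_op M k ?f) * sqrt t)"
        by (rule nn_cauchy_schwarz) (use t in \<open>auto simp: L2_norm_nn[OF L2[OF f]]\<close>)
      then show ?thesis by (simp add: le_less_trans)
    qed
    finally show ?thesis .
  qed
  have "\<exists>C\<ge>0. \<forall>f\<in>nn_ball M. \<forall>g\<in>nn_ball M. form M h f g \<le> ennreal C"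
  proof (rule ccontr)
    assume "\<not> ?thesis"
    then have unbounded: "\<exists>f\<in>nn_ball M. \<exists>g\<in>nn_ball M. \<not> form M h f g \<le> ennreal C" if "0 \<le> C" for C
      using that by blast
    have "\<forall>n::nat. \<exists>f g. f \<in> nn_ball M \<and> g \<in> nn_ball M \<and> \<not> form M h f g \<le> ennreal (real n * 4 ^ n)"
    proof
      fix n :: nat
      have "0 \<le> real n * 4 ^ n" by simp
      from unbounded[OF this] show "\<exists>f g. f \<in> nn_ball M \<and> g \<in> nn_ball M \<and> \<not> form M h f g \<le> ennreal (real n * 4 ^ n)"
        by blast
    qed
    then have "\<exists>f. \<forall>n::nat. \<exists>g. f n \<in> nn_ball M \<and> g \<in> nn_ball M \<and> \<not> form M h (f n) g \<le> ennreal (real n * 4 ^ n)"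
      by (rule choice)
    then obtain f where
      "\<forall>n::nat. \<exists>g. f n \<in> nn_ball M \<and> g \<in> nn_ball M \<and> \<not> form M h (f n) g \<le> ennreal (real n * 4 ^ n)"
      by (elim exE)
    then have "\<exists>g. \<forall>n::nat. f n \<in> nn_ball M \<and> g n \<in> nn_ball M \<and> \<not> form M h (f n) (g n) \<le> ennreal (real n * 4 ^ n)"
      by (rule choice)
    then obtain g where fg: "\<And>n. f n \<in> nn_ball M" "\<And>n. g n \<in> nn_ball M"
      "\<And>n::nat. ennreal (real n * 4 ^ n) < form M h (f n) (g n)" by (auto simp: not_le)
    have sup: "\<exists>\<phi>. \<phi> \<in> borel_measurable M \<and> (\<forall>x. 0 \<le> \<phi> x) \<and> (\<integral>\<^sup>+x. (ennreal (\<phi> x))\<^sup>2 \<partial>M) < \<infinity>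
        \<and> (\<forall>n. AE x in M. ennreal (1 / 2 ^ n) * f n x \<le> ennreal (\<phi> x))"
      if f: "\<And>n. f n \<in> nn_ball M" for f :: "nat \<Rightarrow> 'a \<Rightarrow> ennreal"
    proof -
      have [measurable]: "f n \<in> borel_measurable M" for n using f by (auto simp: nn_ball_def)
      define q where "q x = (\<Sum>n. (ennreal (1 / 2 ^ n) * f n x)\<^sup>2)" for x
      have [measurable]: "q \<in> borel_measurable M" unfolding q_def by measurable
      have "(\<integral>\<^sup>+x. q x \<partial>M) = (\<Sum>n. \<integral>\<^sup>+x. (ennreal (1 / 2 ^ n) * f n x)\<^sup>2 \<partial>M)"
        unfolding q_def by (rule nn_integral_suminf) measurable
      also have "\<dots> \<le> (\<Sum>n. ennreal ((1 / 4) ^ n))"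
      proof (intro suminf_le)
        fix n
        have "(1 / 2 ^ n * 1)\<^sup>2 = (1 / 4 :: real) ^ n"
          by (simp add: power_divide power2_eq_square flip: power_mult_distrib)
        moreover have "(\<integral>\<^sup>+x. (ennreal (1 / 2 ^ n) * f n x)\<^sup>2 \<partial>M) \<le> ennreal ((1 / 2 ^ n * 1)\<^sup>2)"
          by (rule nn_scale) (use f in \<open>auto simp: nn_ball_def\<close>)
        ultimately show "(\<integral>\<^sup>+x. (ennreal (1 / 2 ^ n) * f n x)\<^sup>2 \<partial>M) \<le> ennreal ((1 / 4) ^ n)"
          by (simp only:)
      qed (rule summableI)+
      also have "\<dots> = ennreal (\<Sum>n. (1 / 4) ^ n)" by (intro suminf_ennreal2 summable_geometric) auto
      finally have qfin: "(\<integral>\<^sup>+x. q x \<partial>M) < \<infinity>" by (simp add: le_less_trans)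
      have "AE x in M. q x \<noteq> \<infinity>" by (rule nn_integral_PInf_AE) (use qfin in auto)
      then have qAE: "AE x in M. (ennreal (sqrt (enn2real (q x))))\<^sup>2 = q x"
        by eventually_elim (simp add: ennreal_power less_top)
      have "(\<integral>\<^sup>+x. (ennreal (sqrt (enn2real (q x))))\<^sup>2 \<partial>M) = (\<integral>\<^sup>+x. q x \<partial>M)"
        by (rule nn_integral_cong_AE[OF qAE])
      moreover have "AE x in M. ennreal (1 / 2 ^ n) * f n x \<le> ennreal (sqrt (enn2real (q x)))" for n
        using qAE
      proof eventually_elim
        case (elim x)
        have "(ennreal (1 / 2 ^ n) * f n x)\<^sup>2 \<le> q x"
          unfolding q_def by (rule order_trans[OF _ sum_le_suminf[of _ "{n}"]]) auto
        then have "(ennreal (1 / 2 ^ n) * f n x)\<^sup>2 \<le> (ennreal (sqrt (enn2real (q x))))\<^sup>2"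
          by (simp only: elim)
        then show ?case by (simp only: ennreal_power2_le_iff)
      qed
      ultimately show ?thesis using qfin
        by (intro exI[of _ "\<lambda>x. sqrt (enn2real (q x))"]) auto
    qed
    obtain \<phi> where \<phi>: "\<phi> \<in> borel_measurable M" "\<And>x. 0 \<le> \<phi> x" "(\<integral>\<^sup>+x. (ennreal (\<phi> x))\<^sup>2 \<partial>M) < \<infinity>"
      "\<And>n. AE x in M. ennreal (1 / 2 ^ n) * f n x \<le> ennreal (\<phi> x)"
      using sup[of f, OF fg(1)] by blast
    obtain \<psi> where \<psi>: "\<psi> \<in> borel_measurable M" "\<And>x. 0 \<le> \<psi> x" "(\<integral>\<^sup>+x. (ennreal (\<psi> x))\<^sup>2 \<partial>M) < \<infinity>"
      "\<And>n. AE x in M. ennreal (1 / 2 ^ n) * g n x \<le> ennreal (\<psi> x)"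
      using sup[of g, OF fg(2)] by blast
    note [measurable] = \<phi>(1) \<psi>(1)
    let ?F = "form M h (\<lambda>x. ennreal (\<phi> x)) (\<lambda>x. ennreal (\<psi> x))"
    have big: "ennreal (real n) \<le> ?F" for n
    proof -
      have [measurable]: "f n \<in> borel_measurable M" "g n \<in> borel_measurable M"
        using fg by (auto simp: nn_ball_def)
      let ?c = "ennreal (1 / 2 ^ n)"
      have c: "?c * ?c = ennreal (1 / 4 ^ n)" by (simp flip: ennreal_mult power_mult_distrib)
      have "ennreal (real n) = ennreal (1 / 4 ^ n) * ennreal (real n * 4 ^ n)"
        by (simp flip: ennreal_mult)
      also have "\<dots> \<le> ennreal (1 / 4 ^ n) * form M h (f n) (g n)"
        using fg(3)[of n] by (intro mult_left_mono) auto
      also have "\<dots> = (\<integral>\<^sup>+x. act M h (\<lambda>y. ?c * f n y) x * (?c * g n x) \<partial>M)"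
      proof -
        have "(\<integral>\<^sup>+x. act M h (\<lambda>y. ?c * f n y) x * (?c * g n x) \<partial>M) = (\<integral>\<^sup>+x. (?c * ?c) * (act M h (f n) x * g n x) \<partial>M)"
        proof (rule nn_integral_cong)
          fix x assume "x \<in> space M"
          then have "act M h (\<lambda>y. ?c * f n y) x = ?c * act M h (f n) x" by (intro act_scale) auto
          then show "act M h (\<lambda>y. ?c * f n y) x * (?c * g n x) = (?c * ?c) * (act M h (f n) x * g n x)"
            by (simp only: ac_simps)
        qed
        also have "\<dots> = (?c * ?c) * form M h (f n) (g n)" unfolding form_def by (rule nn_integral_cmult) measurable
        finally show ?thesis by (simp only: c)
      qed
      also have "\<dots> \<le> ?F"
        unfolding form_def
      proof (rule nn_integral_mono_AE)
        have "act M h (\<lambda>y. ?c * f n y) x \<le> act M h (\<lambda>x. ennreal (\<phi> x)) x" for x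
          unfolding act_def by (rule nn_integral_mono_AE) (use \<phi>(4)[of n] in \<open>auto elim!: eventually_mono intro!: mult_left_mono\<close>)
        then show "AE x in M. act M h (\<lambda>y. ?c * f n y) x * (?c * g n x) \<le> act M h (\<lambda>x. ennreal (\<phi> x)) x * ennreal (\<psi> x)"
          using \<psi>(4)[of n] by (auto elim!: eventually_mono intro!: mult_mono)
      qed
      finally show ?thesis .
    qed
    obtain t where t: "?F = ennreal t" "0 \<le> t"
      using fin[OF \<phi>(1) \<psi>(1) \<phi>(2,3) \<psi>(3)] by (cases ?F) auto
    obtain n :: nat where "t < real n" using reals_Archimedean2 by blast
    then show False using big[of n] t by simp
  qed
  then show ?thesis using h unfolding pos_kernel_def by blast
qed

section \<open>Kernels that agree almost everywhere\<close>

lemma kernel_op_ae_eq: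
  assumes [measurable]: "measurable_kernel M h" "measurable_kernel M k"
    and eq: "ae_eq M h k" and f: "f \<in> L2 M"
  shows "AE x in M. kernel_op M h f x = kernel_op M k f x"
  using eq[unfolded ae_eq_def] AE_space
proof eventually_elim
  case (elim x)
  note [measurable] = L2_measurable[OF f] \<open>x \<in> space M\<close>
  show ?case unfolding kernel_op_def
    by (rule integral_cong_AE) (measurable, use elim(1) in \<open>auto elim!: eventually_mono\<close>)
qed

lemma
  assumes hm[measurable]: "measurable_kernel M h" and k: "pos_kernel M k"
    and eq: "ae_eq M h k"
  shows spectral_radius_cong: "spectral_radius M (kernel_op M h) = spectral_radius M (kernel_op M k)"
    and ess_spectral_radius_cong: "ess_spectral_radius M (kernel_op M h) = ess_spectral_radius M (kernel_op M k)"
proof -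
  note [measurable] = pos_kernelD(1)[OF k]
  let ?H = "kernel_op M h" and ?K = "kernel_op M k"
  have HK: "AE x in M. ?H f x = ?K f x" if "f \<in> L2 M" for f
    by (rule kernel_op_ae_eq[OF hm pos_kernelD(1)[OF k] eq that])
  have KL: "?K f \<in> L2 M" if "f \<in> L2 M" for f by (rule kernel_op_L2[OF k that])
  have HL: "?H f \<in> L2 M" if f: "f \<in> L2 M" for f
  proof -
    note [measurable] = L2_measurable[OF f]
    have "(\<integral>\<^sup>+x. (nn_abs (?H f) x)\<^sup>2 \<partial>M) = (\<integral>\<^sup>+x. (nn_abs (?K f) x)\<^sup>2 \<partial>M)"
    proof (rule nn_integral_cong_AE)
      show "AE x in M. (nn_abs (?H f) x)\<^sup>2 = (nn_abs (?K f) x)\<^sup>2" using HK[OF f] by eventually_elim simp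
    qed
    then show ?thesis using KL[OF f] by (simp add: L2_iff)
  qed
  show "spectral_radius M ?H = spectral_radius M ?K"
    unfolding spectral_radius_def using spectrum_cong[of M ?H ?K, OF HL KL HK] by simp
  have pow: "(?H ^^ j) f \<in> L2 M \<and> (AE x in M. (?H ^^ j) f x = (?K ^^ j) f x)" if f: "f \<in> L2 M" for j f
  proof (induction j)
    case (Suc j)
    have L: "(?H ^^ j) f \<in> L2 M" using Suc by simp
    have L': "(?K ^^ j) f \<in> L2 M" by (rule bounded_operatorD(1)[OF bounded_operator_funpow[OF bounded_kernel_op[OF k]] f])
    have "AE x in M. ?K ((?H ^^ j) f) x = ?K ((?K ^^ j) f) x"
      by (rule bounded_operator_cong[OF bounded_kernel_op[OF k] L L']) (use Suc in simp)
    with HK[OF L] have "AE x in M. (?H ^^ Suc j) f x = (?K ^^ Suc j) f x" by eventually_elim simp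
    then show ?case using HL[OF L] by simp
  qed (use f in simp)
  have "noncompactness M (?H ^^ j) = noncompactness M (?K ^^ j)" for j
  proof (rule noncompactness_cong)
    fix f assume f: "f \<in> L2 M"
    show "(?H ^^ j) f \<in> L2 M" "AE x in M. (?H ^^ j) f x = (?K ^^ j) f x" using pow[OF f] by auto
    show "(?K ^^ j) f \<in> L2 M" by (rule bounded_operatorD(1)[OF bounded_operator_funpow[OF bounded_kernel_op[OF k]] f])
  qed
  then show "ess_spectral_radius M ?H = ess_spectral_radius M ?K" by (simp add: ess_spectral_radius_def)
qed

lemma AE_eq_swap:
  assumes [measurable]: "measurable_kernel M k"
    "measurable_kernel M h"
    and "ae_eq M k h"
  shows "AE y in M. AE x in M. k x y = h x y"
  using assms(3) unfolding ae_eq_def by (subst P.AE_commute[symmetric]) measurable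

lemma kernel_comp_ae_eq:
  assumes k[measurable]: "measurable_kernel M k" "measurable_kernel M k'"
    and h[measurable]: "measurable_kernel M h" "measurable_kernel M h'"
    and eq: "ae_eq M k k'" "ae_eq M h h'"
  shows "ae_eq M (kernel_comp M k h) (kernel_comp M k' h')"
  unfolding ae_eq_def using eq(1)[unfolded ae_eq_def] AE_space
proof eventually_elim
  case (elim x)
  note [measurable] = \<open>x \<in> space M\<close>
  from AE_eq_swap[OF h eq(2)] AE_space show ?case
  proof eventually_elim
    case (elim y)
    note [measurable] = \<open>y \<in> space M\<close>
    have "AE z in M. k x z * h z y = k' x z * h' z y"
      using \<open>AE y in M. k x y = k' x y\<close> elim(1) by eventually_elim simp
    then show ?case unfolding kernel_comp_def by (intro integral_cong_AE) measurable
  qed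
qed

lemma measurable_kernel_power:
  assumes [measurable]: "measurable_kernel M k"
  shows "(\<lambda>(x, y). kernel_power M k m x y) \<in> borel_measurable (M \<Otimes>\<^sub>M M)"
proof -
  have "(\<lambda>(x, y). (kernel_comp M k ^^ n) k x y) \<in> borel_measurable (M \<Otimes>\<^sub>M M)" for n
  proof (induction n)
    case (Suc n)
    note [measurable] = Suc
    show ?case unfolding funpow.simps o_apply by measurable
  qed simp
  then show ?thesis by (simp add: kernel_power_def)
qed

lemma kernel_power_ae_eq:
  assumes k: "measurable_kernel M k" "measurable_kernel M h"
    and eq: "ae_eq M k h"
  shows "ae_eq M (kernel_power M k m) (kernel_power M h m)"
proof (cases "m = 0")
  case False
  then have "1 \<le> m" by simp
  then show ?thesis
  proof (induction m rule: dec_induct)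
    case (step m)
    then show ?case
      by (simp add: kernel_power_Suc) (intro kernel_comp_ae_eq k measurable_kernel_power eq)
  qed (simp add: eq)
qed (simp add: eq)

lemma S2_ae_eq:
  assumes k: "measurable_kernel M k" "measurable_kernel M h"
    and eq: "ae_eq M k h"
  shows "ae_eq M (S2 a b k) (S2 a b h)"
proof -
  have "AE x in M. AE y in M. k y x = h y x" by (rule AE_eq_swap[OF k eq])
  from AE_AE_elim2[OF eq[unfolded ae_eq_def] this] show ?thesis
    unfolding ae_eq_def by (simp add: S2_eq)
qed

section \<open>Symmetrised powers of a positive kernel operator\<close>

lemma radius_spectral: "kernel_radius M zero_cone (\<lambda>k. spectral_radius M (kernel_op M k))"
  by standard (auto intro: nn_cone_zero spectral_radius_limit)

lemma radius_ess: "kernel_radius M (nn_L2 M) (\<lambda>k. ess_spectral_radius M (kernel_op M k))"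
  by standard (auto intro: nn_cone_L2 ess_radius_limit)

lemma positive_part:
  assumes k: "kernel_operator M k" and nn: "AE x in M. AE y in M. 0 \<le> k x y"
  defines "h \<equiv> \<lambda>x y. max 0 (k x y)"
  shows "pos_kernel M h" "ae_eq M k h"
proof -
  have [measurable]: "measurable_kernel M k"
    using k by (simp add: kernel_operator_def)
  have hm: "measurable_kernel M h" unfolding h_def by measurable
  show eq: "ae_eq M k h"
    unfolding ae_eq_def using nn
  proof eventually_elim
    case (elim x)
    then show ?case by eventually_elim (simp add: h_def)
  qed
  show "pos_kernel M h" by (rule kernel_operator_bounded[OF k hm _ eq]) (simp add: h_def)
qed

lemma radius_S2_power_cong:
  assumes k: "measurable_kernel M k" and h: "pos_kernel M h" and eq: "ae_eq M k h"
    and S: "\<And>h. pos_kernel M h \<Longrightarrow> pos_kernel M (S2 a b h)"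
    and \<rho>: "\<rho> \<in> {spectral_radius, ess_spectral_radius}"
  shows "\<rho> M (kernel_op M (S2 a b (kernel_power M k m))) = \<rho> M (kernel_op M (S2 a b (kernel_power M h m)))"
proof -
  note hm = pos_kernelD(1)[OF h]
  have m: "(\<lambda>(x, y). S2 a b (kernel_power M k m) x y) \<in> borel_measurable (M \<Otimes>\<^sub>M M)"
  proof -
    note [measurable] = measurable_kernel_power[OF k]
    show ?thesis by measurable
  qed
  have e: "ae_eq M (S2 a b (kernel_power M k m)) (S2 a b (kernel_power M h m))"
    by (intro S2_ae_eq measurable_kernel_power kernel_power_ae_eq k hm eq)
  note P = S[OF pos_kernel_power[OF h]]
  show ?thesis using \<rho> spectral_radius_cong[OF m P e] ess_spectral_radius_cong[OF m P e] by auto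
qed

lemma radius_kernel_cong:
  assumes "measurable_kernel M k" "pos_kernel M h" "ae_eq M k h"
    and \<rho>: "\<rho> \<in> {spectral_radius, ess_spectral_radius}"
  shows "\<rho> M (kernel_op M k) = \<rho> M (kernel_op M h)"
  using \<rho> spectral_radius_cong[OF assms(1-3)] ess_spectral_radius_cong[OF assms(1-3)] by auto

lemma symmetrisation_chain:
  assumes k: "kernel_operator M k" and nn: "AE x in M. AE y in M. 0 \<le> k x y"
    and \<alpha>: "0 \<le> \<alpha>" "\<alpha> \<le> 1" and \<rho>: "\<rho> \<in> {spectral_radius, ess_spectral_radius}"
  defines "r \<equiv> \<lambda>m. \<rho> M (kernel_op M (S1 \<alpha> (kernel_power M k (2 ^ m)))) powr (1 / 2 ^ m)"
  shows "\<rho> M (kernel_op M (S1 \<alpha> k)) = r 0 \<and> (\<forall>m<n. r m \<le> r (Suc m)) \<and> r n \<le> \<rho> M (kernel_op M k)"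
proof -
  define h where "h = (\<lambda>x y. max 0 (k x y))"
  have h: "pos_kernel M h" "ae_eq M k h" unfolding h_def by (rule positive_part[OF k nn])+
  have km: "measurable_kernel M k"
    using k by (simp add: kernel_operator_def)
  obtain U where U: "kernel_radius M U (\<lambda>k. \<rho> M (kernel_op M k))"
    using \<rho> radius_spectral radius_ess by blast
  interpret R: kernel_radius M U "\<lambda>k. \<rho> M (kernel_op M k)" by (rule U)
  have \<alpha>': "0 \<le> 1 - \<alpha>" "\<alpha> + (1 - \<alpha>) = 1" using \<alpha> by auto
  note S = pos_kernel_S2[OF _ \<alpha>(1) \<alpha>']
  note cong = radius_S2_power_cong[OF km h S \<rho>]
  have r: "r m = R.sym_radius \<alpha> (1 - \<alpha>) h m" for m
    by (simp add: r_def R.sym_radius_def S1_def cong)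
  have "\<rho> M (kernel_op M (S1 \<alpha> k)) = r 0"
    using cong[of 0] R.sym_radius_0[OF S[OF h(1)]] by (simp add: r S1_def)
  moreover have "r m \<le> r (Suc m)" for m
    unfolding r by (rule R.sym_radius_Suc[OF h(1) \<alpha>(1) \<alpha>'(1)]) (use \<alpha>' in simp)
  moreover have "r n \<le> \<rho> M (kernel_op M k)"
    unfolding r radius_kernel_cong[OF km h \<rho>] by (rule R.sym_radius_le[OF h(1) \<alpha>(1) \<alpha>'])
  ultimately show ?thesis by blast
qed

end

section \<open>Nonnegative matrices\<close>

lemma sigma_finite_count_space_nat: "sigma_finite_measure (count_space (R :: nat set))"
  by (rule sigma_finite_measure_count_space_countable) simp

lemma counting_count_space: "counting (count_space R)"
  by (simp add: counting_def)

text \<open>The chain itself is the same for all admissible exponents; the two upper bounds come from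
  \<open>sym_radius_le_scaled\<close> and, for the spectral radius, from \<open>sym_radius_le_powr\<close>.\<close>

lemma matrix_symmetrisation_chain:
  fixes R :: "nat set" and n :: nat
  assumes R: "index_set R" and kR: "\<forall>i\<in>R. \<forall>j\<in>R. 0 \<le> k i j" and k: "kernel_operator (count_space R) k"
    and ab: "0 \<le> \<alpha>" "0 \<le> \<beta>" "1 \<le> \<alpha> + \<beta>" and \<rho>: "\<rho> \<in> {spectral_radius, ess_spectral_radius}"
  defines "M \<equiv> count_space R"
  defines "r \<equiv> \<lambda>m. \<rho> M (kernel_op M (S2 \<alpha> \<beta> (kernel_power M k (2 ^ m)))) powr (1 / 2 ^ m)"
    and "c \<equiv> rpow (max_norm R (kernel_power M k (2 ^ n))) ((\<alpha> + \<beta> - 1) / 2 ^ n)"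
    and "s \<equiv> \<rho> M (kernel_op M (S1 (\<alpha> / (\<alpha> + \<beta>)) (kernel_power M k (2 ^ n)))) powr (1 / 2 ^ n)"
  shows "\<rho> M (kernel_op M (S2 \<alpha> \<beta> k)) = r 0 \<and> (\<forall>m<n. r m \<le> r (Suc m)) \<and>
    (\<rho> = spectral_radius \<longrightarrow> r n \<le> min (\<rho> M (kernel_op M k) powr (\<alpha> + \<beta>)) (c * \<rho> M (kernel_op M k))) \<and>
    (\<rho> = ess_spectral_radius \<longrightarrow> r n \<le> c * \<rho> M (kernel_op M k)) \<and>
    r n \<le> c * s \<and> c * s \<le> c * \<rho> M (kernel_op M k)"
proof -
  interpret sigma_finite_measure M unfolding M_def by (rule sigma_finite_count_space_nat)
  have space: "space M = R" by (simp add: M_def)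
  have d: "counting M" unfolding M_def by (rule counting_count_space)
  have kM: "kernel_operator M k" using k by (simp add: M_def)
  have nn: "AE x in M. AE y in M. 0 \<le> k x y" using kR by (simp add: AE_counting[OF d] space)
  define h where "h = (\<lambda>x y. max 0 (k x y))"
  have h: "pos_kernel M h" "ae_eq M k h" unfolding h_def by (rule positive_part[OF kM nn])+
  have km: "measurable_kernel M k"
    using kM by (simp add: kernel_operator_def)
  have H: "\<alpha> + \<beta> = 1 \<or> (1 \<le> \<alpha> + \<beta> \<and> counting M)" using ab d by simp
  note S = pos_kernel_S2_counting[OF _ ab(1,2) H]
  note cong = radius_S2_power_cong[OF km h S \<rho>]
  note ratio = ratio_bounds[OF ab]
  have S': "pos_kernel M (S2 (\<alpha> / (\<alpha> + \<beta>)) (1 - \<alpha> / (\<alpha> + \<beta>)) h)" if "pos_kernel M h" for h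
    by (rule pos_kernel_S2[OF that]) (use ratio in auto)
  note cong' = radius_S2_power_cong[OF km h S' \<rho>]
  note rk = radius_kernel_cong[OF km h \<rho>]
  let ?K = "kernel_power M k (2 ^ n)" and ?H = "kernel_power M h (2 ^ n)"
  have Hpos: "pos_kernel M ?H" by (rule pos_kernel_power[OF h(1)])
  have KH: "?K i j = ?H i j" if "i \<in> R" "j \<in> R" for i j
    using kernel_power_ae_eq[OF km pos_kernelD(1)[OF h(1)] h(2), of "2 ^ n"] that
    by (simp add: ae_eq_def AE_counting[OF d] space)
  have bdd: "bdd_above ((\<lambda>(i, j). ?K i j) ` (R \<times> R))"
    by (rule bdd_aboveI[of _ "kernel_size M zero_cone ?H"])
      (use entry_le_size[OF Hpos d] KH space in auto)
  have entry: "?H i j \<le> max_norm R ?K" if "i \<in> R" "j \<in> R" for i j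
    using cSUP_upper[OF _ bdd, of "(i, j)"] that KH[OF that] by (simp add: max_norm_def)
  obtain i where i: "i \<in> R" using R by (force simp: index_set_def)
  have m0: "0 \<le> max_norm R ?K"
    using entry[OF i i] pos_kernelD(2)[OF Hpos, of i i] by linarith
  have c0: "0 \<le> c" unfolding c_def by (rule rpow_nonneg[OF m0])
  have main: "\<rho> M (kernel_op M (S2 \<alpha> \<beta> k)) = r 0 \<and> (\<forall>m<n. r m \<le> r (Suc m)) \<and>
      r n \<le> c * s \<and> c * s \<le> c * \<rho> M (kernel_op M k) \<and>
      (U = zero_cone \<longrightarrow> r n \<le> \<rho> M (kernel_op M k) powr (\<alpha> + \<beta>))"
    if U: "kernel_radius M U (\<lambda>k. \<rho> M (kernel_op M k))" for U
  proof -
    interpret R: kernel_radius M U "\<lambda>k. \<rho> M (kernel_op M k)" by (rule U)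
    have r: "r m = R.sym_radius \<alpha> \<beta> h m" for m by (simp add: r_def R.sym_radius_def cong)
    have s: "s = \<rho> M (kernel_op M (S1 (\<alpha> / (\<alpha> + \<beta>)) ?H)) powr (1 / 2 ^ n)"
      by (simp add: s_def S1_def cong')
    have "\<rho> M (kernel_op M (S2 \<alpha> \<beta> k)) = r 0"
      using cong[of 0] R.sym_radius_0[OF S[OF h(1)]] by (simp add: r)
    moreover have "r m \<le> r (Suc m)" for m
      unfolding r by (rule R.sym_radius_Suc[OF h(1) ab(1,2) H])
    moreover have "r n \<le> c * s"
      unfolding r c_def s by (rule R.sym_radius_le_scaled[OF h(1) d ab m0]) (use entry space in auto)
    moreover have "c * s \<le> c * \<rho> M (kernel_op M k)"
      unfolding rk s by (intro mult_left_mono c0 R.scaled_sym_radius_le[OF h(1) ab])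
    moreover have "r n \<le> \<rho> M (kernel_op M k) powr (\<alpha> + \<beta>)" if "U = zero_cone"
      unfolding r rk by (rule R.sym_radius_le_powr[OF that h(1) d ab])
    ultimately show ?thesis by blast
  qed
  show ?thesis
  proof (cases "\<rho> = spectral_radius")
    case True
    then have *: "kernel_radius M zero_cone (\<lambda>k. \<rho> M (kernel_op M k))" using radius_spectral by simp
    show ?thesis using main[OF *] by auto
  next
    case False
    then have *: "kernel_radius M (nn_L2 M) (\<lambda>k. \<rho> M (kernel_op M k))" using \<rho> radius_ess by auto
    show ?thesis using main[OF *] False by auto
  qed
qed

theorem theorem2p5:
  "(\<forall>(M :: 'a measure) k \<alpha>.
      sigma_finite_measure M \<longrightarrow> space M \<noteq> {} \<longrightarrow>
      kernel_operator M k \<longrightarrow> positive_operator M (kernel_op M k) \<longrightarrow>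
      0 \<le> \<alpha> \<longrightarrow> \<alpha> \<le> 1 \<longrightarrow>
      (\<forall>\<rho>\<in>{spectral_radius, ess_spectral_radius}. \<forall>n.
        let r = (\<lambda>m. \<rho> M (kernel_op M (S1 \<alpha> (kernel_power M k (2 ^ m)))) powr (1 / 2 ^ m))
        in \<rho> M (kernel_op M (S1 \<alpha> k)) = r 0 \<and>
           (\<forall>m<n. r m \<le> r (Suc m)) \<and>
           r n \<le> \<rho> M (kernel_op M k)))
   \<and>
   (\<forall>(R :: nat set) k \<alpha> \<beta>.
      index_set R \<longrightarrow> (\<forall>i\<in>R. \<forall>j\<in>R. 0 \<le> k i j) \<longrightarrow>
      kernel_operator (count_space R) k \<longrightarrow>
      0 \<le> \<alpha> \<longrightarrow> 0 \<le> \<beta> \<longrightarrow> 1 \<le> \<alpha> + \<beta> \<longrightarrow>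
      (\<forall>\<rho>\<in>{spectral_radius, ess_spectral_radius}. \<forall>n.
        let M = count_space R;
            r = (\<lambda>m. \<rho> M (kernel_op M (S2 \<alpha> \<beta> (kernel_power M k (2 ^ m)))) powr (1 / 2 ^ m));
            c = rpow (max_norm R (kernel_power M k (2 ^ n))) ((\<alpha> + \<beta> - 1) / 2 ^ n);
            s = \<rho> M (kernel_op M (S1 (\<alpha> / (\<alpha> + \<beta>)) (kernel_power M k (2 ^ n)))) powr (1 / 2 ^ n)
        in \<rho> M (kernel_op M (S2 \<alpha> \<beta> k)) = r 0 \<and>
           (\<forall>m<n. r m \<le> r (Suc m)) \<and>
           (\<rho> = spectral_radius \<longrightarrow>
              r n \<le> min (\<rho> M (kernel_op M k) powr (\<alpha> + \<beta>)) (c * \<rho> M (kernel_op M k))) \<and>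
           (\<rho> = ess_spectral_radius \<longrightarrow> r n \<le> c * \<rho> M (kernel_op M k)) \<and>
           r n \<le> c * s \<and> c * s \<le> c * \<rho> M (kernel_op M k)))"
proof (intro conjI allI impI ballI, goal_cases)
  case (1 M k \<alpha> \<rho> n)
  interpret sigma_finite_measure M by (rule 1(1))
  have nn: "AE x in M. AE y in M. 0 \<le> k x y" by (rule positive_operator_kernel_nonneg[OF 1(3,4)])
  show ?case unfolding Let_def by (rule symmetrisation_chain[OF 1(3) nn 1(5,6,7)])
next
  case (2 R k \<alpha> \<beta> \<rho> n)
  show ?case unfolding Let_def by (rule matrix_symmetrisation_chain[OF 2])
qed

end
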